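(* Let $(\epsilon_i)_{i\in\mathbb{Z}}$ be i.i.d. real random variables with density $f_\epsilon$ satisfying $\sup_{x\in\mathbb{R}}|f_\epsilon''(x)|<\infty$ and $\mathbb{E}|\epsilon_k|^r<\infty$ for some $r>0$, and let $Z_k=\sum_{i=0}^\infty a_i\epsilon_{k-i}$ be a causal stationary linear process with $\sum_{i=1}^\infty|a_i|^{\min(r/q,1)}<\infty$ for some $q\ge2$. Assume moreover that $(Z_k)$ is $\alpha$-mixing (strongly mixing). Let $F_Z,f_Z$ be the marginal cumulative distribution function and density of $Z_k$. Let $g$ be strictly increasing and differentiable, $Y_k=g(Z_k)$, and $\widehat g(x)=\xi_n^Y(F_Z(x))$, where $\xi_n^Y(p)=\inf\{y\mid F_n^Y(y)\ge p\}$, $F_n^Y(y)=\frac1n\sum_{i=1}^n\mathbf{1}_{Y_i\le y}$. Let $x$ be such that there exist $c<x<d$ with $\inf_{c\le y\le d}f_Z(y)>0$, and $g'(x)>0$. Let $b=b(n)$ satisfy $b\to\infty$ and $b/n\to0$. For $i=1,\dots,n-b+1$ let $\widehat g_{b,i}(x)=\xi^Y_{b,i}(F_Z(x))$, where $\xi^Y_{b,i}(p)$ is the sample $p$-quantile (defined as $\inf\{y: \frac1b\sum_{j=i}^{i+b-1}\mathbf{1}_{Y_j\le y}\ge p\}$) of $Y_i,Y_{i+1},\dots,Y_{i+b-1}$, and for $\eta>0$ define $$S_{n,b}(\eta,x)=\frac{1}{n-b+1}\sum_{i=1}^{n-b+1}\mathbf{1}\big\{\sqrt b\,|\widehat g_{b,i}(x)-\widehat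 g(x)|\le\eta\big\}.$$ Then: (1) for every $\eta>0$, $S_{n,b}(\eta,x)-P\big(\sqrt n|\widehat g(x)-g(x)|\le\eta\big)\to0$ in probability; (2) for $\alpha\in(0,1)$, letting $d(1-\alpha)=\inf\{\eta\mid S_{n,b}(\eta,x)\ge1-\alpha\}$, we have $P\big(\sqrt n|\widehat g(x)-g(x)|\le d(1-\alpha)\big)\to1-\alpha$.
   Context: A stationary sequence $(Z_k)$ is $\alpha$-mixing (strongly mixing) if $\alpha_Z(m)=\sup\{|P(A\cap B)-P(A)P(B)|: A\in\sigma(Z_k,k\le 0),\ B\in\sigma(Z_k,k\ge m)\}\to0$ as $m\to\infty$. *)

theory Defs
  imports "HOL-Probability.Probability"
begin

definition gen_sigma :: "'a measure \<Rightarrow> (int \<Rightarrow> 'a \<Rightarrow> real) \<Rightarrow> int set \<Rightarrow> 'a set set" where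
  "gen_sigma M X I = sigma_sets (space M) (\<Union>i\<in>I. {X i -` A \<inter> space M | A. A \<in> sets borel})"

definition alpha_coef :: "'a measure \<Rightarrow> (int \<Rightarrow> 'a \<Rightarrow> real) \<Rightarrow> int \<Rightarrow> real" where
  "alpha_coef M X m = Sup {\<bar>measure M (A \<inter> B) - measure M A * measure M B\<bar> | A B.
      A \<in> gen_sigma M X {..0} \<and> B \<in> gen_sigma M X {m..}}"

definition alpha_mixing :: "'a measure \<Rightarrow> (int \<Rightarrow> 'a \<Rightarrow> real) \<Rightarrow> bool" where
  "alpha_mixing M X \<longleftrightarrow> (\<lambda>m::nat. alpha_coef M X (int m)) \<longlonglongrightarrow> 0"

definition emp_quantile :: "real list \<Rightarrow> real \<Rightarrow> real" where
  "emp_quantile xs p = Inf {y. real (length (filter (\<lambda>v. v \<le> y) xs)) / real (length xs) \<ge> p}"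

definition conv_prob_zero :: "'a measure \<Rightarrow> (nat \<Rightarrow> 'a \<Rightarrow> real) \<Rightarrow> bool" where
  "conv_prob_zero M X \<longleftrightarrow>
     (\<forall>e>0. (\<lambda>n. measure M {\<omega> \<in> space M. \<bar>X n \<omega>\<bar> > e}) \<longlonglongrightarrow> 0)"

end

theory Submission
  imports Defs
begin

text \<open>
Write \<open>h (Z k)\<close>, for \<open>h\<close> an indicator of a half line, as a telescoping sum of its projections onto the
  single innovations. Smoothness of the innovation density makes the projection onto the
  \<open>j\<close>-th last innovation of size \<open>\<bar>a j\<bar> powr min (r/q) 1\<close> in \<open>L\<^sup>2\<close>, and projections onto different innovations
  are orthogonal, so partial sums have norm of order \<open>sqrt n\<close>. Cutting the moving averages off at the
  beginning of blocks of fixed length changes the partial sums by a small multiple of \<open>sqrt n\<close> and leaves i.i.d. blocks;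
  this reduces the central limit theorem for the empirical distribution function to the classical one. The limit
  variance is positive because the sum of all projections onto one innovation has a jump of
  height 1. Inverting the empirical distribution function gives
  \<open>P (sqrt n * \<bar>ghat - g x\<bar> \<le> t) \<rightarrow> J t\<close> with \<open>J\<close> continuous and strictly increasing. By stationarity and
  strong mixing the variance of the subsampling average tends to 0, and replacing the centre \<open>g x\<close> by
  \<open>ghat\<close> is harmless since \<open>b / n \<rightarrow> 0\<close>; hence \<open>S n \<eta>\<close> tends to \<open>J \<eta>\<close> in probability, and the subsampling
  quantile tends to the quantile of \<open>J\<close>.
\<close>

subsection \<open>Square integrability and approximation in law\<close>


text \<open>Strong mixing comes without a rate, which does not suffice for a central limit theorem.
  Asymptotic normality is therefore drawn from the linear structure, and mixing only decorrelates
  distant subsampling blocks. The obstacle is the discontinuity of half line indicators: integrating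
  out the newest innovation, whose density is bounded, already makes them Lipschitz, so every lag
  except 0 is smooth and lag 0 is treated separately. Innovations may have few moments, so the
  Lipschitz bound is interpolated with the trivial bound to give the power \<rho> = min (r / q) 1; q
  >= 2 yields 2 * \<rho> <= r, hence square integrability of
  \<open>\<bar>eps 0 \<omega>\<bar> powr \<rho>\<close>. Limits are taken lag by lag and exchanged
  with the sum over lags by Tannery's theorem, with the summable majorant \<open>wt\<close>.
  Integrals over the newest coordinate of a product space stand in for conditional expectations and
  give identities for every past. The limit variance comes from a Cauchy argument, not from a
  covariance series.\<close>

definition bdm :: "'a measure \<Rightarrow> ('a \<Rightarrow> real) \<Rightarrow> bool" where
  "bdm M f \<longleftrightarrow> f \<in> borel_measurable M \<and> (\<exists>B. \<forall>x. \<bar>f x\<bar> \<le> B)"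

text \<open>A seminorm on functions rather than on classes. Since \<open>bdm\<close> asks for
  boundedness everywhere, squares and products are integrable over a finite measure without further
  conditions.\<close>

definition l2norm :: "'a measure \<Rightarrow> ('a \<Rightarrow> real) \<Rightarrow> real" where
  "l2norm M f = sqrt (\<integral>x. (f x)\<^sup>2 \<partial>M)"

lemma bdmI: "f \<in> borel_measurable M \<Longrightarrow> (\<And>x. \<bar>f x\<bar> \<le> B) \<Longrightarrow> bdm M f"
  by (auto simp: bdm_def)

lemma bdm_measurable [measurable_dest]: "bdm M f \<Longrightarrow> f \<in> borel_measurable M"
  by (auto simp: bdm_def)

lemma bdm_const [simp]: "bdm M (\<lambda>x. c)"
  by (auto simp: bdm_def)

lemma bdm_add: assumes "bdm M f" "bdm M g" shows "bdm M (\<lambda>x. f x + g x)"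
proof -
  obtain A B where AB: "\<And>x. \<bar>f x\<bar> \<le> A" "\<And>x. \<bar>g x\<bar> \<le> B" using assms by (auto simp: bdm_def)
  have "\<bar>f x + g x\<bar> \<le> A + B" for x using AB(1)[of x] AB(2)[of x] by linarith
  then show ?thesis using assms by (intro bdmI) (auto simp: bdm_def)
qed

lemma bdm_mult: assumes "bdm M f" "bdm M g" shows "bdm M (\<lambda>x. f x * g x)"
proof -
  obtain A B where AB: "\<And>x. \<bar>f x\<bar> \<le> A" "\<And>x. \<bar>g x\<bar> \<le> B" using assms by (auto simp: bdm_def)
  have "\<bar>f x * g x\<bar> \<le> A * B" for x
    unfolding abs_mult using AB(1)[of x] AB(2)[of x] by (intro mult_mono) linarith+
  then show ?thesis using assms by (intro bdmI) (auto simp: bdm_def)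
qed

lemma bdm_uminus: "bdm M f \<Longrightarrow> bdm M (\<lambda>x. - f x)"
  using bdm_mult[of M "\<lambda>_. -1" f] by simp

lemma bdm_diff: "bdm M f \<Longrightarrow> bdm M g \<Longrightarrow> bdm M (\<lambda>x. f x - g x)"
  using bdm_add[of M f "\<lambda>x. - g x"] bdm_uminus[of M g] by simp

lemma bdm_power2: "bdm M f \<Longrightarrow> bdm M (\<lambda>x. (f x)\<^sup>2)"
  using bdm_mult[of M f f] by (simp add: power2_eq_square)

lemma bdm_divide: "bdm M f \<Longrightarrow> bdm M (\<lambda>x. f x / c)"
  using bdm_mult[of M f "\<lambda>x. 1 / c"] by simp

lemma bdm_sum: "(\<And>i. i \<in> I \<Longrightarrow> bdm M (f i)) \<Longrightarrow> bdm M (\<lambda>x. \<Sum>i\<in>I. f i x)"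
  by (induction I rule: infinite_finite_induct) (auto intro: bdm_add)

lemma (in finite_measure) bdm_integrable: "bdm M f \<Longrightarrow> integrable M f"
  unfolding bdm_def by (metis AE_I2 integrable_const_bound real_norm_def)

lemma bdm_comp: "bdm N f \<Longrightarrow> h \<in> measurable M N \<Longrightarrow> bdm M (\<lambda>x. f (h x))"
  by (auto simp: bdm_def)

lemma l2norm_nonneg [simp]: "l2norm M f \<ge> 0"
  by (auto simp: l2norm_def)

lemma l2norm_sq: "(l2norm M f)\<^sup>2 = (\<integral>x. (f x)\<^sup>2 \<partial>M)"
  by (auto simp: l2norm_def)

lemma l2norm_minus: "l2norm M (\<lambda>x. - f x) = l2norm M f"
  by (simp add: l2norm_def)

lemma l2norm_commute: "l2norm M (\<lambda>x. f x - g x) = l2norm M (\<lambda>x. g x - f x)"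
  by (simp add: l2norm_def power2_commute)

lemma l2norm_cmult: "l2norm M (\<lambda>x. c * f x) = \<bar>c\<bar> * l2norm M f"
  by (simp add: l2norm_def power_mult_distrib real_sqrt_mult)

lemma l2norm_divide: "l2norm M (\<lambda>x. f x / c) = l2norm M f / \<bar>c\<bar>"
  by (simp add: l2norm_def power_divide real_sqrt_divide)

context finite_measure begin

lemma l2norm_triangle:
  assumes f: "bdm M f" and g: "bdm M g"
  shows "l2norm M (\<lambda>x. f x + g x) \<le> l2norm M f + l2norm M g"
proof (rule field_le_epsilon)
  fix e :: real assume e: "e > 0"
  \<comment> \<open>The slack \<open>e / 2\<close> keeps both weights positive, so the weighted
    arithmetic-geometric inequality below also covers vanishing norms.\<close>
  define \<alpha> \<beta> where "\<alpha> = l2norm M f + e / 2" and "\<beta> = l2norm M g + e / 2"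
  have pos: "\<alpha> > 0" "\<beta> > 0" using e by (auto simp: \<alpha>_def \<beta>_def add_nonneg_pos)
  note int = bdm_integrable[OF bdm_mult[OF f g]] bdm_integrable[OF bdm_power2[OF f]]
     bdm_integrable[OF bdm_power2[OF g]]
  have A: "(\<integral>x. (f x)\<^sup>2 \<partial>M) \<le> \<alpha>\<^sup>2"
    unfolding l2norm_sq[symmetric] \<alpha>_def using e by (intro power_mono) auto
  have B: "(\<integral>x. (g x)\<^sup>2 \<partial>M) \<le> \<beta>\<^sup>2"
    unfolding l2norm_sq[symmetric] \<beta>_def using e by (intro power_mono) auto
  have pt: "2 * (f x * g x) \<le> \<beta> / \<alpha> * (f x)\<^sup>2 + \<alpha> / \<beta> * (g x)\<^sup>2" for x
  proof -
    have "0 \<le> (\<beta> * f x - \<alpha> * g x)\<^sup>2 / (\<alpha> * \<beta>)" using pos by simp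
    also have "\<dots> = \<beta> / \<alpha> * (f x)\<^sup>2 + \<alpha> / \<beta> * (g x)\<^sup>2 - 2 * (f x * g x)"
      using pos by (simp add: field_simps power2_eq_square)
    finally show ?thesis by linarith
  qed
  have "(\<integral>x. 2 * (f x * g x) \<partial>M) \<le> (\<integral>x. \<beta> / \<alpha> * (f x)\<^sup>2 + \<alpha> / \<beta> * (g x)\<^sup>2 \<partial>M)"
    by (rule integral_mono) (use int pt in auto)
  also have "\<dots> = \<beta> / \<alpha> * (\<integral>x. (f x)\<^sup>2 \<partial>M) + \<alpha> / \<beta> * (\<integral>x. (g x)\<^sup>2 \<partial>M)"
    using int by simp
  also have "\<dots> \<le> \<beta> / \<alpha> * \<alpha>\<^sup>2 + \<alpha> / \<beta> * \<beta>\<^sup>2"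
    using A B pos by (intro add_mono mult_left_mono) auto
  also have "\<dots> = 2 * \<alpha> * \<beta>" using pos by (simp add: power2_eq_square)
  finally have C: "(\<integral>x. 2 * (f x * g x) \<partial>M) \<le> 2 * \<alpha> * \<beta>" .
  have "(\<integral>x. (f x + g x)\<^sup>2 \<partial>M) = (\<integral>x. (f x)\<^sup>2 + 2 * (f x * g x) + (g x)\<^sup>2 \<partial>M)"
    by (simp add: power2_sum algebra_simps)
  also have "\<dots> = (\<integral>x. (f x)\<^sup>2 \<partial>M) + (\<integral>x. 2 * (f x * g x) \<partial>M) + (\<integral>x. (g x)\<^sup>2 \<partial>M)"
    using int by simp
  also have "\<dots> \<le> \<alpha>\<^sup>2 + 2 * \<alpha> * \<beta> + \<beta>\<^sup>2" using A B C by linarith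
  also have "\<dots> = (\<alpha> + \<beta>)\<^sup>2" by (simp add: power2_sum)
  finally have "l2norm M (\<lambda>x. f x + g x) \<le> \<alpha> + \<beta>"
    unfolding l2norm_def using pos by (intro real_le_lsqrt) auto
  then show "l2norm M (\<lambda>x. f x + g x) \<le> l2norm M f + l2norm M g + e"
    by (simp add: \<alpha>_def \<beta>_def)
qed

lemma l2norm_triangle_diff:
  assumes "bdm M f" "bdm M g"
  shows "l2norm M (\<lambda>x. f x - g x) \<le> l2norm M f + l2norm M g"
  using l2norm_triangle[OF assms(1) bdm_uminus[OF assms(2)]] by (simp add: l2norm_minus)

lemma l2norm_diff_le:
  assumes "bdm M f" "bdm M g"
  shows "\<bar>l2norm M f - l2norm M g\<bar> \<le> l2norm M (\<lambda>x. f x - g x)"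
  using l2norm_triangle[of "\<lambda>x. f x - g x" g] l2norm_triangle[of "\<lambda>x. g x - f x" f] assms
  by (auto simp: bdm_diff l2norm_commute[of M g f])

lemma l2norm_triangle3:
  assumes "bdm M f" "bdm M g" "bdm M h"
  shows "l2norm M (\<lambda>x. f x - h x) \<le> l2norm M (\<lambda>x. f x - g x) + l2norm M (\<lambda>x. g x - h x)"
  using l2norm_triangle[of "\<lambda>x. f x - g x" "\<lambda>x. g x - h x"] assms by (auto simp: bdm_diff)

lemma l2norm_sum:
  assumes "\<And>i. i \<in> I \<Longrightarrow> bdm M (f i)"
  shows "l2norm M (\<lambda>x. \<Sum>i\<in>I. f i x) \<le> (\<Sum>i\<in>I. l2norm M (f i))"
  using assms
proof (induction I rule: infinite_finite_induct)
  case (insert i I)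
  have "l2norm M (\<lambda>x. f i x + (\<Sum>i\<in>I. f i x)) \<le> l2norm M (f i) + l2norm M (\<lambda>x. \<Sum>i\<in>I. f i x)"
    using insert by (intro l2norm_triangle bdm_sum) auto
  then show ?case using insert by fastforce
qed (auto simp: l2norm_def)

lemma l2norm_mono:
  assumes "bdm M f" "integrable M (\<lambda>x. (g x)\<^sup>2)" "AE x in M. \<bar>f x\<bar> \<le> \<bar>g x\<bar>"
  shows "l2norm M f \<le> l2norm M g"
  unfolding l2norm_def
proof (intro real_sqrt_le_mono integral_mono_AE)
  show "AE x in M. (f x)\<^sup>2 \<le> (g x)\<^sup>2" using assms(3) by eventually_elim (simp add: abs_le_square_iff)
qed (use assms in \<open>auto intro: bdm_integrable bdm_power2\<close>)

lemma l2norm_cong_AE: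
  assumes "bdm M f" "bdm M g" "AE x in M. f x = g x"
  shows "l2norm M f = l2norm M g"
  unfolding l2norm_def using assms
  by (intro arg_cong[where f=sqrt] integral_cong_AE) auto

lemma l2norm_sum_orthogonal:
  assumes "finite I" "\<And>i. i \<in> I \<Longrightarrow> bdm M (f i)"
    and "\<And>i j. i \<in> I \<Longrightarrow> j \<in> I \<Longrightarrow> i \<noteq> j \<Longrightarrow> (\<integral>x. f i x * f j x \<partial>M) = 0"
  shows "(l2norm M (\<lambda>x. \<Sum>i\<in>I. f i x))\<^sup>2 = (\<Sum>i\<in>I. (l2norm M (f i))\<^sup>2)"
proof -
  have int: "integrable M (\<lambda>x. f i x * f j x)" if "i \<in> I" "j \<in> I" for i j
    using assms(2) that by (intro bdm_integrable bdm_mult) auto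
  have "(l2norm M (\<lambda>x. \<Sum>i\<in>I. f i x))\<^sup>2 = (\<integral>x. (\<Sum>i\<in>I. \<Sum>j\<in>I. f i x * f j x) \<partial>M)"
    unfolding l2norm_sq by (simp add: power2_eq_square sum_product)
  also have "\<dots> = (\<Sum>i\<in>I. \<Sum>j\<in>I. \<integral>x. f i x * f j x \<partial>M)"
    using int by (simp add: Bochner_Integration.integral_sum Bochner_Integration.integrable_sum)
  also have "\<dots> = (\<Sum>i\<in>I. \<Sum>j\<in>I. if j = i then \<integral>x. f i x * f i x \<partial>M else 0)"
    using assms(3) by (intro sum.cong refl) auto
  also have "\<dots> = (\<Sum>i\<in>I. (l2norm M (f i))\<^sup>2)"
    using assms(1) unfolding l2norm_sq by (simp add: power2_eq_square)
  finally show ?thesis .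
qed

end

context prob_space begin

lemma l2norm_le_const:
  assumes "bdm M f" "\<And>x. \<bar>f x\<bar> \<le> B"
  shows "l2norm M f \<le> B"
proof -
  have "B \<ge> 0" using assms(2) by (meson abs_ge_zero order_trans)
  have "l2norm M f \<le> l2norm M (\<lambda>_. B)"
    using assms(2) \<open>B \<ge> 0\<close> by (intro l2norm_mono assms(1)) auto
  then show ?thesis using \<open>B \<ge> 0\<close> by (simp add: l2norm_def prob_space)
qed

lemma chebyshev_l2norm:
  assumes "bdm M f" "e > 0"
  shows "prob {x \<in> space M. \<bar>f x\<bar> \<ge> e} \<le> (l2norm M f)\<^sup>2 / e\<^sup>2"
proof -
  have "prob {x \<in> space M. \<bar>f x\<bar> \<ge> e} = prob {x \<in> space M. (f x)\<^sup>2 \<ge> e\<^sup>2}"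
    using assms(2) by (intro arg_cong[where f=prob]) (auto simp: abs_le_square_iff[symmetric])
  also have "\<dots> \<le> (\<integral>x. (f x)\<^sup>2 \<partial>M) / e\<^sup>2"
    using assms by (intro integral_Markov_inequality_measure[where A="{}"]) (auto intro: bdm_integrable bdm_power2)
  finally show ?thesis by (simp add: l2norm_sq)
qed

text \<open>The approximants may be chosen after \<delta>, which is the order of limits required
  later: block length first, sample size second. Continuity of the limit at \<open>t\<close> absorbs
  the shift of the argument.\<close>

lemma cdf_tendsto_l2_approx:
  assumes T: "\<And>n. bdm M (T n)"
    and approx: "\<And>\<delta>. \<delta> > 0 \<Longrightarrow> \<exists>N. (\<forall>n. bdm M (N n)) \<and>
        (\<forall>t. (\<lambda>n. prob {\<omega> \<in> space M. N n \<omega> \<le> t}) \<longlonglongrightarrow> \<Phi> t) \<and>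
        (\<forall>\<^sub>F n in sequentially. l2norm M (\<lambda>\<omega>. T n \<omega> - N n \<omega>) \<le> \<delta>)"
    and cont: "isCont \<Phi> t"
  shows "(\<lambda>n. prob {\<omega> \<in> space M. T n \<omega> \<le> t}) \<longlonglongrightarrow> \<Phi> t"
proof (rule tendstoI)
  fix e :: real assume e: "e > 0"
  obtain d where d: "d > 0" "\<And>s. \<bar>s - t\<bar> < d \<Longrightarrow> \<bar>\<Phi> s - \<Phi> t\<bar> < e / 3"
    using cont e unfolding continuous_at_eps_delta dist_real_def
    by (metis zero_less_divide_iff zero_less_numeral)
  define h where "h = min (d / 2) (e / 3)"
  have h: "h > 0" "h < d" "h \<le> e / 3" using d e by (auto simp: h_def)
  \<comment> \<open>With L2 distance at most \<open>h * sqrt h\<close>, Chebyshev at threshold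
    \<open>h\<close> leaves a probability of at most \<open>h\<close>.\<close>
  obtain N where N: "\<And>n. bdm M (N n)" "\<And>t. (\<lambda>n. prob {\<omega> \<in> space M. N n \<omega> \<le> t}) \<longlonglongrightarrow> \<Phi> t"
    and close: "\<forall>\<^sub>F n in sequentially. l2norm M (\<lambda>\<omega>. T n \<omega> - N n \<omega>) \<le> h * sqrt h"
    using approx[of "h * sqrt h"] h by auto
  have up: "\<forall>\<^sub>F n in sequentially. prob {\<omega> \<in> space M. N n \<omega> \<le> t + h} < \<Phi> t + e / 3 + e / 3"
  proof -
    have "\<Phi> (t + h) < \<Phi> t + e / 3 + e / 3" using abs_ge_self[of "\<Phi> (t + h) - \<Phi> t"] d(2)[of "t + h"] h e by simp
    then show ?thesis using order_tendstoD(2)[OF N(2)] by blast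
  qed
  have lo: "\<forall>\<^sub>F n in sequentially. prob {\<omega> \<in> space M. N n \<omega> \<le> t - h} > \<Phi> t - e / 3 - e / 3"
  proof -
    have "\<Phi> (t - h) > \<Phi> t - e / 3 - e / 3" using abs_ge_minus_self[of "\<Phi> (t - h) - \<Phi> t"] d(2)[of "t - h"] h e by simp
    then show ?thesis using order_tendstoD(1)[OF N(2)] by blast
  qed
  show "\<forall>\<^sub>F n in sequentially. dist (prob {\<omega> \<in> space M. T n \<omega> \<le> t}) (\<Phi> t) < e"
    using close up lo
  proof eventually_elim
    case (elim n)
    note [measurable] = bdm_measurable[OF T] bdm_measurable[OF N(1)]
    let ?B = "{\<omega> \<in> space M. \<bar>T n \<omega> - N n \<omega>\<bar> \<ge> h}"
    have "prob ?B \<le> (l2norm M (\<lambda>\<omega>. T n \<omega> - N n \<omega>))\<^sup>2 / h\<^sup>2"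
      using T N h by (intro chebyshev_l2norm bdm_diff) auto
    also have "\<dots> \<le> (h * sqrt h)\<^sup>2 / h\<^sup>2"
      using elim(1) by (intro divide_right_mono power_mono) auto
    also have "\<dots> = h" using h by (simp add: power_mult_distrib)
    finally have B: "prob ?B \<le> e / 3" using h by linarith
    have "prob {\<omega> \<in> space M. T n \<omega> \<le> t} \<le> prob ({\<omega> \<in> space M. N n \<omega> \<le> t + h} \<union> ?B)"
      by (intro finite_measure_mono) (auto simp: abs_if)
    also have "\<dots> \<le> prob {\<omega> \<in> space M. N n \<omega> \<le> t + h} + prob ?B"
      by (intro measure_Un_le) auto
    finally have 1: "prob {\<omega> \<in> space M. T n \<omega> \<le> t} < \<Phi> t + e" using elim B by linarith
    have "prob {\<omega> \<in> space M. N n \<omega> \<le> t - h} \<le> prob ({\<omega> \<in> space M. T n \<omega> \<le> t} \<union> ?B)"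
      by (intro finite_measure_mono) (auto simp: abs_if)
    also have "\<dots> \<le> prob {\<omega> \<in> space M. T n \<omega> \<le> t} + prob ?B"
      by (intro measure_Un_le) auto
    finally have 2: "prob {\<omega> \<in> space M. T n \<omega> \<le> t} > \<Phi> t - e" using elim B by linarith
    show ?case using 1 2 by (auto simp: dist_real_def)
  qed
qed

end

subsection \<open>Innovations\<close>


locale iid_seq = prob_space M for M :: "'a measure" +
  fixes eps :: "int \<Rightarrow> 'a \<Rightarrow> real" and mu :: "real measure"
  assumes indep_eps: "indep_vars (\<lambda>_. borel) eps UNIV"
    and distr_eps: "\<And>i. distr M borel (eps i) = mu"
begin

lemma eps_measurable [measurable]: "eps i \<in> borel_measurable M"
  using indep_eps by (auto simp: indep_vars_def)

lemma sets_mu [simp, measurable_cong]: "sets mu = sets borel"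
  using distr_eps[of 0] by auto

lemma space_mu [simp]: "space mu = UNIV"
  using sets_eq_imp_space_eq[OF sets_mu] by simp

lemma prob_space_mu: "prob_space mu"
  using distr_eps[of 0] prob_space_distr[of "eps 0" borel] by auto

text \<open>The law of an innovation past. Coordinate 0 is the newest, and
  \<open>case_nat e w\<close> puts a newer innovation \<open>e\<close> in front of the past
  \<open>w\<close>.\<close>

definition Sq :: "(nat \<Rightarrow> real) measure" where
  "Sq = PiM UNIV (\<lambda>_. mu)"

lemma sets_Sq [simp, measurable_cong]: "sets Sq = sets (PiM UNIV (\<lambda>_. borel))"
  unfolding Sq_def by (intro sets_PiM_cong) auto

lemma space_Sq [simp]: "space Sq = UNIV"
  unfolding Sq_def by (auto simp: space_PiM)

lemma sequence_space_mu: "sequence_space mu"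
  unfolding sequence_space_def product_prob_space_def product_prob_space_axioms_def
    product_sigma_finite_def
  using prob_space_mu by (auto simp: prob_space_imp_sigma_finite)

lemma prob_space_Sq: "prob_space Sq"
  unfolding Sq_def by (intro prob_space_PiM prob_space_mu)

text \<open>The law of \<open>pst l\<close> does not depend on \<open>l\<close>, which is the source of all stationarity.\<close>
definition pst :: "int \<Rightarrow> 'a \<Rightarrow> nat \<Rightarrow> real" where
  "pst l \<omega> = (\<lambda>i. eps (l - int i) \<omega>)"

lemma pst_measurable_borel: "pst l \<in> measurable M (PiM UNIV (\<lambda>_. borel))"
  unfolding pst_def by (rule measurable_PiM_single') auto

lemma pst_measurable [measurable]: "pst l \<in> measurable M Sq"
  using pst_measurable_borel measurable_cong_sets[OF refl sets_Sq] by blast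

lemma indep_eps_reindex:
  assumes "inj h"
  shows "indep_vars (\<lambda>_. borel) (\<lambda>i::'i. eps (h i)) UNIV"
proof -
  have "indep_vars (\<lambda>j. PiM {h j} (\<lambda>_. borel)) (\<lambda>j \<omega>. restrict (\<lambda>i. eps i \<omega>) {h j}) (UNIV :: 'i set)"
    by (intro indep_vars_restrict[OF indep_eps])
       (use assms in \<open>auto simp: disjoint_family_on_def inj_def\<close>)
  then have "indep_vars (\<lambda>_. borel) (\<lambda>j \<omega>. (\<lambda>f. f (h j)) (restrict (\<lambda>i. eps i \<omega>) {h j})) (UNIV :: 'i set)"
    by (rule indep_vars_compose2) (auto intro!: measurable_component_singleton)
  then show ?thesis by simp
qed

lemma distr_pst: "distr M Sq (pst l) = Sq"
proof -
  have "indep_vars (\<lambda>_. borel) (\<lambda>i::nat. eps (l - int i)) UNIV"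
    by (rule indep_eps_reindex) (auto simp: inj_def)
  then have "distr M (PiM UNIV (\<lambda>_. borel)) (\<lambda>x. \<lambda>i\<in>UNIV. eps (l - int i) x)
    = PiM UNIV (\<lambda>i::nat. distr M borel (eps (l - int i)))"
    by (subst (asm) indep_vars_iff_distr_eq_PiM') auto
  then have "distr M (PiM UNIV (\<lambda>_. borel)) (pst l) = Sq"
    unfolding distr_eps Sq_def pst_def restrict_UNIV .
  then show ?thesis
    by (metis distr_cong sets_Sq)
qed

lemma expectation_pst:
  fixes \<phi> :: "(nat \<Rightarrow> real) \<Rightarrow> real"
  assumes [measurable]: "\<phi> \<in> borel_measurable Sq"
  shows "(\<integral>\<omega>. \<phi> (pst l \<omega>) \<partial>M) = (\<integral>w. \<phi> w \<partial>Sq)"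
  by (subst distr_pst[of l, symmetric], subst integral_distr) auto

lemma bdm_pst: "bdm Sq \<phi> \<Longrightarrow> bdm M (\<lambda>\<omega>. \<phi> (pst l \<omega>))"
  by (rule bdm_comp[of Sq]) auto

lemma l2norm_pst: "bdm Sq \<phi> \<Longrightarrow> l2norm M (\<lambda>\<omega>. \<phi> (pst l \<omega>)) = l2norm Sq \<phi>"
  unfolding l2norm_def by (subst expectation_pst[symmetric, of _ l]) auto

text \<open>Forgets the \<open>N\<close> newest innovations, which moves the time of observation
  back by \<open>N\<close>.\<close>

definition sh :: "nat \<Rightarrow> (nat \<Rightarrow> real) \<Rightarrow> nat \<Rightarrow> real" where
  "sh N w = (\<lambda>i. w (i + N))"

lemma sh_measurable [measurable]: "sh N \<in> measurable Sq Sq"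
proof -
  have "sh N \<in> measurable Sq (PiM UNIV (\<lambda>_. borel))"
    unfolding sh_def by (rule measurable_PiM_single') auto
  then show ?thesis using measurable_cong_sets[OF refl sets_Sq] by blast
qed

lemma pst_shift: "pst (l - int N) \<omega> = sh N (pst l \<omega>)"
  by (auto simp: pst_def sh_def algebra_simps)

lemma case_nat_measurable [measurable]: "(\<lambda>(e, w). case_nat e w) \<in> measurable (mu \<Otimes>\<^sub>M Sq) Sq"
proof -
  have "(\<lambda>(e, w). case_nat e w) \<in> measurable (mu \<Otimes>\<^sub>M Sq) (PiM UNIV (\<lambda>_. borel))"
    by (rule measurable_PiM_single') (auto simp: split_beta' split: nat.split)
  then show ?thesis using measurable_cong_sets[OF refl sets_Sq] by blast
qed

lemma case_nat_measurable1 [measurable]: "(\<lambda>e. case_nat e w) \<in> measurable mu Sq"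
  using measurable_compose[OF measurable_Pair2'[of w Sq mu] case_nat_measurable] by simp

text \<open>Splitting off the newest coordinate by Fubini takes the place of conditioning: the inner
  integral is the conditional expectation given the older past \<open>w\<close>.\<close>

lemma integral_Sq_iter:
  fixes \<phi> :: "(nat \<Rightarrow> real) \<Rightarrow> real"
  assumes "bdm Sq \<phi>"
  shows "(\<integral>w. \<phi> w \<partial>Sq) = (\<integral>w. \<integral>e. \<phi> (case_nat e w) \<partial>mu \<partial>Sq)"
proof -
  interpret Sq: prob_space Sq by (rule prob_space_Sq)
  interpret mu: prob_space mu by (rule prob_space_mu)
  interpret pair_prob_space mu Sq ..
  note [measurable] = bdm_measurable[OF assms]
  have iter: "distr (mu \<Otimes>\<^sub>M Sq) Sq (\<lambda>(e, w). case_nat e w) = Sq"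
    using sequence_space.PiM_iter[OF sequence_space_mu] unfolding Sq_def .
  have "(\<integral>w. \<phi> w \<partial>Sq) = (\<integral>z. \<phi> ((\<lambda>(e, w). case_nat e w) z) \<partial>(mu \<Otimes>\<^sub>M Sq))"
    by (subst iter[symmetric], subst integral_distr) auto
  also have "\<dots> = (\<integral>z. case_prod (\<lambda>e w. \<phi> (case_nat e w)) z \<partial>(mu \<Otimes>\<^sub>M Sq))"
    by (simp add: split_beta')
  also have "\<dots> = (\<integral>w. \<integral>e. \<phi> (case_nat e w) \<partial>mu \<partial>Sq)"
    using P.bdm_integrable[OF bdm_comp[OF assms case_nat_measurable]]
    by (intro integral_snd[symmetric]) (simp add: split_beta')
  finally show ?thesis .
qed

text \<open>A martingale difference as a function of the past. The mean is zero for every older past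
  \<open>w\<close>, which avoids exceptional null sets in later identities.\<close>

definition mdiff :: "((nat \<Rightarrow> real) \<Rightarrow> real) \<Rightarrow> bool" where
  "mdiff d \<longleftrightarrow> bdm Sq d \<and> (\<forall>w. (\<integral>e. d (case_nat e w) \<partial>mu) = 0)"

lemma mdiff_bdm: "mdiff d \<Longrightarrow> bdm Sq d"
  by (simp add: mdiff_def)

lemma mdiff_bdm_iter: "bdm Sq d \<Longrightarrow> bdm mu (\<lambda>e. d (case_nat e w))"
  by (rule bdm_comp[of Sq]) auto

lemma mdiff_diff: "mdiff d \<Longrightarrow> mdiff d' \<Longrightarrow> mdiff (\<lambda>w. d w - d' w)"
proof -
  interpret mu: prob_space mu by (rule prob_space_mu)
  assume "mdiff d" "mdiff d'"
  then show "mdiff (\<lambda>w. d w - d' w)"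
    by (auto simp: mdiff_def bdm_diff mdiff_bdm_iter mu.bdm_integrable)
qed

lemma mdiff_sum: "(\<And>i. i \<in> I \<Longrightarrow> mdiff (d i)) \<Longrightarrow> mdiff (\<lambda>w. \<Sum>i\<in>I. d i w)"
proof -
  interpret mu: prob_space mu by (rule prob_space_mu)
  assume "\<And>i. i \<in> I \<Longrightarrow> mdiff (d i)"
  then show "mdiff (\<lambda>w. \<Sum>i\<in>I. d i w)"
    by (auto simp: mdiff_def bdm_sum mdiff_bdm_iter mu.bdm_integrable)
qed

text \<open>The second factor depends only on innovations older than time \<open>l\<close>, so it is
  constant in the inner integral, where \<open>d\<close> has mean 0. Beyond being
  \<open>bdm\<close>, \<psi> is arbitrary; the constant 1 yields \<open>mdiff_mean\<close>.\<close>

lemma mdiff_orthogonal: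
  assumes d: "mdiff d" and \<psi>: "bdm Sq \<psi>" and "l' < l"
  shows "(\<integral>\<omega>. d (pst l \<omega>) * \<psi> (pst l' \<omega>) \<partial>M) = 0"
proof -
  obtain N where N: "l' = l - int (Suc N)"
    using \<open>l' < l\<close> by (metis add_diff_cancel_left' diff_add_cancel zless_iff_Suc_zadd)
  have bd: "bdm Sq (\<lambda>w. d w * \<psi> (sh (Suc N) w))"
    by (intro bdm_mult mdiff_bdm[OF d] bdm_comp[OF \<psi>]) auto
  have "(\<integral>\<omega>. d (pst l \<omega>) * \<psi> (pst l' \<omega>) \<partial>M) = (\<integral>w. d w * \<psi> (sh (Suc N) w) \<partial>Sq)"
    unfolding N pst_shift using bd by (subst expectation_pst[symmetric, of _ l]) auto
  also have "\<dots> = (\<integral>w. \<integral>e. d (case_nat e w) * \<psi> (sh N w) \<partial>mu \<partial>Sq)"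
    by (subst integral_Sq_iter[OF bd]) (simp add: sh_def)
  also have "\<dots> = 0" using d by (simp add: mdiff_def)
  finally show ?thesis .
qed

text \<open>For a fixed lag \<open>j\<close> the terms sit on different innovations
  \<open>k - j\<close> and are orthogonal, so squares add over \<open>k\<close>; the triangle
  inequality is spent only on the sum over lags. This is the source of the order sqrt n.\<close>

lemma l2norm_mdiff_array:
  assumes "finite A" and b: "\<And>k j. k \<in> A \<Longrightarrow> j < J \<Longrightarrow> mdiff (b k j)"
  shows "l2norm M (\<lambda>\<omega>. \<Sum>k\<in>A. \<Sum>j<J. b k j (pst (k - int j) \<omega>))
    \<le> (\<Sum>j<J. sqrt (\<Sum>k\<in>A. (l2norm Sq (b k j))\<^sup>2))"
proof -
  have "l2norm M (\<lambda>\<omega>. \<Sum>k\<in>A. \<Sum>j<J. b k j (pst (k - int j) \<omega>))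
    = l2norm M (\<lambda>\<omega>. \<Sum>j<J. \<Sum>k\<in>A. b k j (pst (k - int j) \<omega>))"
    by (subst sum.swap) simp
  also have "\<dots> \<le> (\<Sum>j<J. l2norm M (\<lambda>\<omega>. \<Sum>k\<in>A. b k j (pst (k - int j) \<omega>)))"
    by (intro l2norm_sum bdm_sum bdm_pst[OF mdiff_bdm[OF b]]) auto
  also have "\<dots> = (\<Sum>j<J. sqrt (\<Sum>k\<in>A. (l2norm Sq (b k j))\<^sup>2))"
  proof (intro sum.cong refl)
    fix j assume j: "j \<in> {..<J}"
    have "(l2norm M (\<lambda>\<omega>. \<Sum>k\<in>A. b k j (pst (k - int j) \<omega>)))\<^sup>2
      = (\<Sum>k\<in>A. (l2norm M (\<lambda>\<omega>. b k j (pst (k - int j) \<omega>)))\<^sup>2)"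
    proof (rule l2norm_sum_orthogonal)
      fix k k' assume k: "k \<in> A" "k' \<in> A" "k \<noteq> k'"
      have "(\<integral>\<omega>. b k j (pst (k - int j) \<omega>) * b k' j (pst (k' - int j) \<omega>) \<partial>M) = 0" if "k' < k"
        using k j that by (intro mdiff_orthogonal[OF b mdiff_bdm[OF b]]) auto
      moreover have "(\<integral>\<omega>. b k' j (pst (k' - int j) \<omega>) * b k j (pst (k - int j) \<omega>) \<partial>M) = 0" if "k < k'"
        using k j that by (intro mdiff_orthogonal[OF b mdiff_bdm[OF b]]) auto
      ultimately show "(\<integral>\<omega>. b k j (pst (k - int j) \<omega>) * b k' j (pst (k' - int j) \<omega>) \<partial>M) = 0"
        using k(3) by (cases "k < k'") (auto simp: mult.commute)
    qed (use assms j in \<open>auto intro: bdm_pst[OF mdiff_bdm[OF b]]\<close>)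
    also have "\<dots> = (\<Sum>k\<in>A. (l2norm Sq (b k j))\<^sup>2)"
      using b j by (intro sum.cong refl) (auto simp: l2norm_pst mdiff_bdm)
    finally show "l2norm M (\<lambda>\<omega>. \<Sum>k\<in>A. b k j (pst (k - int j) \<omega>)) = sqrt (\<Sum>k\<in>A. (l2norm Sq (b k j))\<^sup>2)"
      by (intro real_sqrt_unique[symmetric] l2norm_nonneg)
  qed
  finally show ?thesis .
qed

section \<open>Independent blocks of innovations\<close>

definition trunc :: "nat \<Rightarrow> (nat \<Rightarrow> real) \<Rightarrow> nat \<Rightarrow> real" where
  "trunc p w = (\<lambda>i. if i < p then w i else 0)"

lemma trunc_measurable [measurable]: "trunc p \<in> measurable Sq Sq"
proof -
  have "trunc p \<in> measurable Sq (PiM UNIV (\<lambda>_. borel))"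
    unfolding trunc_def by (rule measurable_PiM_single') auto
  then show ?thesis using measurable_cong_sets[OF refl sets_Sq] by blast
qed

text \<open>Seen from time \<open>Suc q * p\<close>, the \<open>p\<close> newest innovations have
  times in \<open>{int (q * p) <.. int (Suc q * p)}\<close>, and these intervals are disjoint;
  \<open>trunc\<close> discards everything older.\<close>

lemma indep_blocks:
  assumes [measurable]: "B \<in> borel_measurable Sq"
  shows "indep_vars (\<lambda>_. borel) (\<lambda>q \<omega>. B (trunc p (pst (int (Suc q * p)) \<omega>)) :: real) (UNIV :: nat set)"
proof -
  define K where "K q = {int (q * p) <.. int (Suc q * p)}" for q :: nat
  have dis: "disjoint_family_on K UNIV"
  proof (unfold disjoint_family_on_def, intro ballI impI)
    fix m n :: nat assume "m \<noteq> n"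
    have *: "K m \<inter> K n = {}" if "m < n" for m n
    proof -
      have "Suc m * p \<le> n * p" using that by (intro mult_le_mono1) auto
      then show ?thesis unfolding K_def by (auto simp del: mult_Suc of_nat_mult)
    qed
    show "K m \<inter> K n = {}" using *[of m n] *[of n m] \<open>m \<noteq> n\<close> by (cases "m < n") auto
  qed
  define Y where "Y q f = B (\<lambda>i. if i < p then f (int (Suc q * p) - int i) else 0)" for q :: nat and f :: "int \<Rightarrow> real"
  have "indep_vars (\<lambda>q. PiM (K q) (\<lambda>_. borel)) (\<lambda>q \<omega>. restrict (\<lambda>i. eps i \<omega>) (K q)) (UNIV :: nat set)"
    by (intro indep_vars_restrict[OF indep_eps] dis) auto
  then have "indep_vars (\<lambda>_. borel) (\<lambda>q \<omega>. Y q (restrict (\<lambda>i. eps i \<omega>) (K q))) (UNIV :: nat set)"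
  proof (rule indep_vars_compose2)
    fix q :: nat
    have "(\<lambda>f i. if i < p then f (int (Suc q * p) - int i) else 0) \<in> measurable (PiM (K q) (\<lambda>_. borel)) (PiM UNIV (\<lambda>_. borel))"
    proof (rule measurable_PiM_single')
      fix i :: nat
      show "(\<lambda>f. if i < p then f (int (Suc q * p) - int i) else 0) \<in> borel_measurable (PiM (K q) (\<lambda>_. borel))"
      proof (cases "i < p")
        case True
        then have "int (Suc q * p) - int i \<in> K q" by (auto simp: K_def)
        then show ?thesis using True by simp
      qed simp
    qed auto
    then have *: "(\<lambda>f i. if i < p then f (int (Suc q * p) - int i) else 0) \<in> measurable (PiM (K q) (\<lambda>_. borel)) Sq"
      using measurable_cong_sets[OF refl sets_Sq] by blast
    show "Y q \<in> borel_measurable (PiM (K q) (\<lambda>_. borel))"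
      unfolding Y_def by (rule measurable_compose[OF *]) simp
  qed
  moreover have "Y q (restrict (\<lambda>i. eps i \<omega>) (K q)) = B (trunc p (pst (int (Suc q * p)) \<omega>))" for q \<omega>
    unfolding Y_def trunc_def pst_def by (intro arg_cong[where f=B] ext) (auto simp: K_def)
  ultimately show ?thesis by simp
qed

lemma distr_block:
  assumes [measurable]: "B \<in> borel_measurable Sq"
  shows "distr M borel (\<lambda>\<omega>. B (pst l \<omega>) :: real) = distr Sq borel B"
proof -
  have "distr (distr M Sq (pst l)) borel B = distr M borel (B \<circ> pst l)"
    by (rule distr_distr) auto
  then show ?thesis by (simp add: distr_pst comp_def)
qed

end

subsection \<open>Projections of a linear process\<close>


text \<open>The moment of order 2 * \<rho> makes \<open>\<bar>e\<bar> powr \<rho>\<close> square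
  integrable, and the leading coefficient 1 makes averaging over the newest innovation a convolution
  with \<open>mu\<close> itself.\<close>

locale linear_process = iid_seq M eps mu
  for M :: "'a measure" and eps :: "int \<Rightarrow> 'a \<Rightarrow> real" and mu :: "real measure" +
  fixes f0 :: "real \<Rightarrow> real" and K \<rho> :: real and a :: "nat \<Rightarrow> real" and Z :: "int \<Rightarrow> 'a \<Rightarrow> real"
  assumes mu_density: "mu = density lborel (\<lambda>t. ennreal (f0 t))"
    and f0_cont: "continuous_on UNIV f0"
    and f0_nonneg: "\<And>t. 0 \<le> f0 t"
    and f0_le: "\<And>t. f0 t \<le> K"
    and rho: "0 < \<rho>" "\<rho> \<le> 1"
    and moment: "integrable mu (\<lambda>e. \<bar>e\<bar> powr (2 * \<rho>))"
    and a_0: "a 0 = 1"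
    and a_summable: "summable (\<lambda>i. \<bar>a i\<bar> powr \<rho>)"
    and Z_measurable [measurable]: "\<And>k. Z k \<in> borel_measurable M"
    and Z_sums: "\<And>k. AE \<omega> in M. (\<lambda>i. a i * eps (k - int i) \<omega>) sums Z k \<omega>"
begin

sublocale mu: prob_space mu by (rule prob_space_mu)
sublocale Sq: prob_space Sq by (rule prob_space_Sq)

lemma f0_measurable [measurable]: "f0 \<in> borel_measurable borel"
  by (intro borel_measurable_continuous_onI f0_cont)

lemma K_nonneg: "0 \<le> K"
  using f0_nonneg f0_le order_trans by blast

text \<open>\<open>avg h j y\<close> is the mean of \<open>h\<close> at \<open>y\<close> plus the
  contribution of the \<open>j\<close> newest innovations, that is, the conditional expectation of
  \<open>h (Z k)\<close> when all older ones contribute \<open>y\<close>.\<close>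

primrec avg :: "(real \<Rightarrow> real) \<Rightarrow> nat \<Rightarrow> real \<Rightarrow> real" where
  "avg h 0 = h"
| "avg h (Suc j) = (\<lambda>y. \<integral>e. avg h j (a j * e + y) \<partial>mu)"

text \<open>Contribution of a past whose newest entry carries the coefficient of lag
  \<open>J\<close>. Where the series diverges, \<open>suminf\<close> still yields a measurable
  function; for the coefficients \<open>a\<close> this happens only on a null set.\<close>

definition tail :: "(nat \<Rightarrow> real) \<Rightarrow> nat \<Rightarrow> (nat \<Rightarrow> real) \<Rightarrow> real" where
  "tail c J w = (\<Sum>i. c (J + i) * w i)"

definition cutoff :: "nat \<Rightarrow> nat \<Rightarrow> real" where
  "cutoff i l = (if l < i then a l else 0)"

text \<open>\<open>dif h c j\<close>, evaluated at \<open>pst (k - j)\<close>, is the projection of \<open>h (Z k)\<close> onto the innovation at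
  time \<open>k - j\<close>; the coefficients \<open>c\<close> beyond \<open>j\<close> may be those of a truncated process.\<close>
definition dif :: "(real \<Rightarrow> real) \<Rightarrow> (nat \<Rightarrow> real) \<Rightarrow> nat \<Rightarrow> (nat \<Rightarrow> real) \<Rightarrow> real" where
  "dif h c j w = avg h j (a j * w 0 + tail c (Suc j) (sh 1 w)) - avg h (Suc j) (tail c (Suc j) (sh 1 w))"

lemma tail_measurable [measurable]: "tail c J \<in> borel_measurable Sq"
  unfolding tail_def by measurable

lemma avg_measurable [measurable]:
  "h \<in> borel_measurable borel \<Longrightarrow> avg h j \<in> borel_measurable borel"
proof (induction j)
  case (Suc j)
  then have [measurable]: "avg h j \<in> borel_measurable borel" by simp
  show ?case by simp
qed simp

lemma avg_bound:
  assumes [measurable]: "h \<in> borel_measurable borel" and h: "\<And>y. \<bar>h y\<bar> \<le> B"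
  shows "\<bar>avg h j y\<bar> \<le> B"
proof (induction j arbitrary: y)
  case (Suc j)
  have bd: "bdm mu (\<lambda>e. avg h j (a j * e + y))" by (rule bdmI[OF _ Suc]) simp
  have "\<bar>\<integral>e. avg h j (a j * e + y) \<partial>mu\<bar> \<le> (\<integral>e. \<bar>avg h j (a j * e + y)\<bar> \<partial>mu)"
    by (rule integral_abs_bound)
  also have "\<dots> \<le> (\<integral>e. B \<partial>mu)"
    using Suc by (intro integral_mono mu.bdm_integrable integrable_abs bd) auto
  finally show ?case using mu.prob_space by simp
qed (use h in auto)

definition lip :: "real \<Rightarrow> (real \<Rightarrow> real) \<Rightarrow> bool" where
  "lip L f \<longleftrightarrow> 0 \<le> L \<and> (\<forall>y y'. \<bar>f y - f y'\<bar> \<le> L * \<bar>y - y'\<bar>)"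

text \<open>Smoothness is asked for after one averaging only, since \<open>h\<close> itself will be
  an indicator or a difference of indicators.\<close>

definition adm :: "real \<Rightarrow> (real \<Rightarrow> real) \<Rightarrow> bool" where
  "adm L h \<longleftrightarrow> h \<in> borel_measurable borel \<and> (\<forall>y. \<bar>h y\<bar> \<le> 1) \<and> lip L (avg h 1)"

lemma adm_measurable [measurable_dest]: "adm L h \<Longrightarrow> h \<in> borel_measurable borel"
  by (simp add: adm_def)

lemma adm_bound: "adm L h \<Longrightarrow> \<bar>avg h j y\<bar> \<le> 1"
  by (rule avg_bound) (auto simp: adm_def)

lemma adm_bdm:
  assumes "adm L h" "u \<in> borel_measurable N"
  shows "bdm N (\<lambda>x. avg h j (u x))"
  using assms adm_bound[OF assms(1)] adm_measurable[OF assms(1)] by (intro bdmI[where B=1]) auto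

text \<open>Averaging a Lipschitz function over translates keeps its constant, so one
  \<open>L\<close> serves all lags from 1 on.\<close>

lemma adm_lip:
  assumes h: "adm L h"
  shows "lip L (avg h (Suc j))"
proof (induction j)
  case 0
  then show ?case using h by (simp add: adm_def)
next
  case (Suc j)
  note L = Suc[unfolded lip_def]
  show ?case unfolding lip_def
  proof (intro conjI allI)
    show "0 \<le> L" using L by simp
    fix y y' :: real
    let ?g = "avg h (Suc j)" and ?a = "a (Suc j)"
    have bd: "bdm mu (\<lambda>e. ?g (?a * e + y))" for y by (rule adm_bdm[OF h]) simp
    have "\<bar>avg h (Suc (Suc j)) y - avg h (Suc (Suc j)) y'\<bar> = \<bar>\<integral>e. ?g (?a * e + y) - ?g (?a * e + y') \<partial>mu\<bar>"
      by (subst Bochner_Integration.integral_diff) (auto intro: mu.bdm_integrable bd simp del: avg.simps(2) simp: avg.simps(2)[of h "Suc j"])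
    also have "\<dots> \<le> (\<integral>e. \<bar>?g (?a * e + y) - ?g (?a * e + y')\<bar> \<partial>mu)"
      by (rule integral_abs_bound)
    also have "\<dots> \<le> (\<integral>e. L * \<bar>y - y'\<bar> \<partial>mu)"
    proof (intro integral_mono)
      show "integrable mu (\<lambda>e. \<bar>?g (?a * e + y) - ?g (?a * e + y')\<bar>)"
        by (intro integrable_abs mu.bdm_integrable bdm_diff bd)
      fix e :: real
      have "\<bar>?g (?a * e + y) - ?g (?a * e + y')\<bar> \<le> L * \<bar>(?a * e + y) - (?a * e + y')\<bar>"
        using L by blast
      then show "\<bar>?g (?a * e + y) - ?g (?a * e + y')\<bar> \<le> L * \<bar>y - y'\<bar>" by simp
    qed simp
    finally show "\<bar>avg h (Suc (Suc j)) y - avg h (Suc (Suc j)) y'\<bar> \<le> L * \<bar>y - y'\<bar>"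
      using mu.prob_space by simp
  qed
qed

lemma sh_1_case_nat [simp]: "sh 1 (case_nat e w) = w" "sh (Suc 0) (case_nat e w) = w"
  by (auto simp: sh_def)

lemma dif_measurable [measurable]:
  assumes [measurable]: "h \<in> borel_measurable borel"
  shows "dif h c j \<in> borel_measurable Sq"
proof -
  note [measurable] = avg_measurable[OF assms]
  show ?thesis unfolding dif_def by (simp del: avg.simps)
qed

lemma dif_bound: "adm L h \<Longrightarrow> \<bar>dif h c j w\<bar> \<le> 2"
  unfolding dif_def
  using adm_bound[of L h j "a j * w 0 + tail c (Suc j) (sh 1 w)"]
    adm_bound[of L h "Suc j" "tail c (Suc j) (sh 1 w)"] by (simp del: avg.simps)

lemma dif_bdm: "adm L h \<Longrightarrow> bdm Sq (dif h c j)"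
  by (rule bdmI[OF dif_measurable dif_bound]) (auto simp: adm_def)

lemma dif_mdiff: assumes h: "adm L h" shows "mdiff (dif h c j)"
  unfolding mdiff_def
proof (intro conjI allI dif_bdm[OF h])
  fix w
  let ?y = "tail c (Suc j) w"
  have "(\<integral>e. dif h c j (case_nat e w) \<partial>mu) = (\<integral>e. avg h j (a j * e + ?y) - avg h (Suc j) ?y \<partial>mu)"
    unfolding dif_def by simp
  also have "\<dots> = (\<integral>e. avg h j (a j * e + ?y) \<partial>mu) - avg h (Suc j) ?y"
  proof -
    have "bdm mu (\<lambda>e. avg h j (a j * e + ?y))" by (rule adm_bdm[OF h]) measurable
    then show ?thesis using mu.prob_space
      by (subst Bochner_Integration.integral_diff) (auto intro: mu.bdm_integrable)
  qed
  finally show "(\<integral>e. dif h c j (case_nat e w) \<partial>mu) = 0" by simp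
qed

text \<open>The second summand comes from averaging over an independent copy of the newest
  innovation in \<open>dif_le_env\<close>.\<close>

definition env :: "(nat \<Rightarrow> real) \<Rightarrow> real" where
  "env w = \<bar>w 0\<bar> powr \<rho> + (\<integral>e. \<bar>e\<bar> powr \<rho> \<partial>mu)"

lemma integrable_powr_rho: "integrable mu (\<lambda>e. \<bar>e\<bar> powr \<rho>)"
proof (rule Bochner_Integration.integrable_bound)
  show "integrable mu (\<lambda>e. 1 + \<bar>e\<bar> powr (2 * \<rho>))" using moment by simp
  show "AE e in mu. norm (\<bar>e\<bar> powr \<rho>) \<le> norm (1 + \<bar>e\<bar> powr (2 * \<rho>))"
  proof (rule AE_I2)
    fix e :: real
    \<comment> \<open>With t for \<open>\<bar>e\<bar> powr \<rho>\<close>, this expands to t <= 1 +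
      t^2.\<close>
    have "0 \<le> (\<bar>e\<bar> powr \<rho> - 1)\<^sup>2 + (\<bar>e\<bar> powr \<rho>)\<^sup>2 + 1" by (intro add_nonneg_nonneg) auto
    moreover have "\<bar>e\<bar> powr (2 * \<rho>) = (\<bar>e\<bar> powr \<rho>)\<^sup>2"
      by (simp add: power2_eq_square powr_add[symmetric])
    ultimately show "norm (\<bar>e\<bar> powr \<rho>) \<le> norm (1 + \<bar>e\<bar> powr (2 * \<rho>))"
      by (simp add: power2_diff)
  qed
qed measurable

lemma env_integrable: "integrable Sq (\<lambda>w. (env w)\<^sup>2)"
proof -
  have c: "distr M borel (\<lambda>\<omega>. pst 0 \<omega> 0) = distr Sq borel (\<lambda>w. w 0)"
    by (rule distr_block) simp
  have m: "distr Sq borel (\<lambda>w. w 0) = mu"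
    unfolding c[symmetric] using distr_eps[of 0] by (simp add: pst_def)
  have sq: "(\<bar>e\<bar> powr \<rho>)\<^sup>2 = \<bar>e\<bar> powr (2 * \<rho>)" for e :: real
    by (simp add: power2_eq_square powr_add[symmetric])
  have "integrable mu (\<lambda>e. (\<bar>e\<bar> powr \<rho> + c)\<^sup>2)" for c
    unfolding power2_sum sq using moment integrable_powr_rho by simp
  then have "integrable (distr Sq borel (\<lambda>w. w 0)) (\<lambda>e. (\<bar>e\<bar> powr \<rho> + (\<integral>e. \<bar>e\<bar> powr \<rho> \<partial>mu))\<^sup>2)"
    unfolding m .
  then show ?thesis unfolding env_def by (subst (asm) integrable_distr_eq) auto
qed

text \<open>At lags \<open>j > 0\<close> the projection compares the newest innovation with an
  independent copy. The difference is at most u by the Lipschitz bound and at most 2 trivially,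
  hence at most 2 * u powr \<rho>; splitting \<open>\<bar>w 0 - e\<bar> powr \<rho>\<close> costs
  another factor 2.\<close>

lemma dif_le_env:
  assumes h: "adm L h" and j: "j > 0"
  shows "\<bar>dif h c j w\<bar> \<le> 4 * (L * \<bar>a j\<bar>) powr \<rho> * env w"
proof -
  define y where "y = tail c (Suc j) (sh 1 w)"
  have L: "0 \<le> L" using h by (simp add: adm_def lip_def)
  obtain j' where j': "j = Suc j'" using j by (cases j) auto
  have lip: "\<bar>avg h j u - avg h j v\<bar> \<le> L * \<bar>u - v\<bar>" for u v
    using adm_lip[OF h, of j'] unfolding j' lip_def by blast
  have bd: "bdm mu (\<lambda>e. avg h j (a j * e + y))" by (rule adm_bdm[OF h]) measurable
  have pt: "\<bar>avg h j (a j * w 0 + y) - avg h j (a j * e + y)\<bar>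
     \<le> 4 * (L * \<bar>a j\<bar>) powr \<rho> * (\<bar>w 0\<bar> powr \<rho> + \<bar>e\<bar> powr \<rho>)" for e
  proof -
    let ?u = "L * \<bar>a j\<bar> * \<bar>w 0 - e\<bar>" and ?D = "\<bar>avg h j (a j * w 0 + y) - avg h j (a j * e + y)\<bar>"
    have u0: "0 \<le> ?u" using L by simp
    have "?D \<le> L * \<bar>(a j * w 0 + y) - (a j * e + y)\<bar>" by (rule lip)
    also have "\<dots> = ?u" by (simp add: abs_mult[symmetric] algebra_simps)
    finally have D1: "?D \<le> ?u" .
    have D2: "?D \<le> 2" using adm_bound[OF h, of j "a j * w 0 + y"] adm_bound[OF h, of j "a j * e + y"] by linarith
    have D3: "?D \<le> 2 * ?u powr \<rho>"
    proof (cases "?u \<le> 1")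
      case True
      have "?u powr 1 \<le> ?u powr \<rho>" using True u0 rho by (intro powr_mono') auto
      then show ?thesis using D1 u0 by auto
    next
      case False
      then have "1 \<le> ?u powr \<rho>" using rho by (intro ge_one_powr_ge_zero) auto
      then show ?thesis using D2 by linarith
    qed
    have D4: "?u powr \<rho> = (L * \<bar>a j\<bar>) powr \<rho> * \<bar>w 0 - e\<bar> powr \<rho>" by (simp add: powr_mult)
    have "\<bar>w 0 - e\<bar> powr \<rho> \<le> (2 * max \<bar>w 0\<bar> \<bar>e\<bar>) powr \<rho>"
      using rho by (intro powr_mono2) auto
    also have "\<dots> = 2 powr \<rho> * max \<bar>w 0\<bar> \<bar>e\<bar> powr \<rho>" by (simp add: powr_mult)
    also have "\<dots> \<le> 2 * (\<bar>w 0\<bar> powr \<rho> + \<bar>e\<bar> powr \<rho>)"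
    proof (intro mult_mono)
      show "2 powr \<rho> \<le> (2::real)" using powr_mono[of \<rho> 1 2] rho by simp
      show "max \<bar>w 0\<bar> \<bar>e\<bar> powr \<rho> \<le> \<bar>w 0\<bar> powr \<rho> + \<bar>e\<bar> powr \<rho>" by (auto simp: max_def)
    qed auto
    finally have "(L * \<bar>a j\<bar>) powr \<rho> * \<bar>w 0 - e\<bar> powr \<rho>
        \<le> (L * \<bar>a j\<bar>) powr \<rho> * (2 * (\<bar>w 0\<bar> powr \<rho> + \<bar>e\<bar> powr \<rho>))"
      by (rule mult_left_mono) simp
    then show ?thesis using D3 unfolding D4 by (simp add: algebra_simps)
  qed
  have "\<bar>dif h c j w\<bar> = \<bar>\<integral>e. avg h j (a j * w 0 + y) - avg h j (a j * e + y) \<partial>mu\<bar>"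
    unfolding dif_def y_def[symmetric] using mu.prob_space
    by (subst Bochner_Integration.integral_diff) (auto intro: mu.bdm_integrable bd)
  also have "\<dots> \<le> (\<integral>e. \<bar>avg h j (a j * w 0 + y) - avg h j (a j * e + y)\<bar> \<partial>mu)"
    by (rule integral_abs_bound)
  also have "\<dots> \<le> (\<integral>e. 4 * (L * \<bar>a j\<bar>) powr \<rho> * (\<bar>w 0\<bar> powr \<rho> + \<bar>e\<bar> powr \<rho>) \<partial>mu)"
  proof (intro integral_mono pt)
    show "integrable mu (\<lambda>e. \<bar>avg h j (a j * w 0 + y) - avg h j (a j * e + y)\<bar>)"
      by (intro integrable_abs mu.bdm_integrable bdm_diff bdm_const bd)
  qed (use integrable_powr_rho in simp)
  also have "\<dots> = 4 * (L * \<bar>a j\<bar>) powr \<rho> * env w"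
    using integrable_powr_rho mu.prob_space by (simp add: env_def)
  finally show ?thesis .
qed

text \<open>Majorant of the projection at lag \<open>j\<close>, uniform in the coefficients behind
  that lag and so valid for truncated processes as well. Lag 0 gets the trivial bound 2 because
  \<open>h\<close> is not yet smoothed there.\<close>

definition wt :: "real \<Rightarrow> nat \<Rightarrow> real" where
  "wt L j = (if j = 0 then 2 else 4 * L powr \<rho> * l2norm Sq env * \<bar>a j\<bar> powr \<rho>)"

lemma wt_nonneg: "0 \<le> wt L j"
  by (simp add: wt_def)

lemma wt_summable: "summable (wt L)"
proof -
  have "summable (\<lambda>j. 4 * L powr \<rho> * l2norm Sq env * \<bar>a (Suc j)\<bar> powr \<rho>)"
    using a_summable by (intro summable_mult) (subst summable_Suc_iff)
  then have "summable (\<lambda>j. wt L (Suc j))" by (simp add: wt_def)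
  then show ?thesis by (simp add: summable_Suc_iff)
qed

lemma l2norm_dif_le: assumes h: "adm L h" shows "l2norm Sq (dif h c j) \<le> wt L j"
proof (cases "j = 0")
  case True
  then show ?thesis using Sq.l2norm_le_const[OF dif_bdm[OF h] dif_bound[OF h]] by (simp add: wt_def)
next
  case False
  let ?k = "4 * (L * \<bar>a j\<bar>) powr \<rho>"
  have "l2norm Sq (dif h c j) \<le> l2norm Sq (\<lambda>w. ?k * env w)"
  proof (rule Sq.l2norm_mono)
    show "AE w in Sq. \<bar>dif h c j w\<bar> \<le> \<bar>?k * env w\<bar>"
      using dif_le_env[OF h, of j c] False by (intro AE_I2) (meson abs_ge_self gr0I order_trans)
  qed (use dif_bdm[OF h] env_integrable in \<open>auto simp: power_mult_distrib\<close>)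
  also have "\<dots> = wt L j" using False by (simp add: l2norm_cmult wt_def powr_mult)
  finally show ?thesis .
qed

lemma Z_sums_all: "AE \<omega> in M. \<forall>k. (\<lambda>i. a i * eps (k - int i) \<omega>) sums Z k \<omega>"
  using Z_sums by (subst AE_all_countable) auto

lemma tail_pst:
  assumes "(\<lambda>i. a i * eps (k - int i) \<omega>) sums Z k \<omega>"
  shows "tail a J (pst (k - int J) \<omega>) = Z k \<omega> - (\<Sum>i<J. a i * eps (k - int i) \<omega>)"
proof -
  have "(\<lambda>i. a (i + J) * eps (k - int (i + J)) \<omega>) sums (Z k \<omega> - (\<Sum>i<J. a i * eps (k - int i) \<omega>))"
    using assms by (rule sums_split_initial_segment)
  then have "(\<lambda>i. a (J + i) * pst (k - int J) \<omega> i) sums (Z k \<omega> - (\<Sum>i<J. a i * eps (k - int i) \<omega>))"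
    by (simp add: pst_def add.commute algebra_simps)
  then show ?thesis unfolding tail_def by (rule sums_unique[symmetric])
qed

text \<open>One innovation is peeled off at a time, exactly and for finite \<open>J\<close>; the
  rest is disposed of by \<open>remainder_tendsto\<close>.\<close>

lemma telescope:
  assumes s: "(\<lambda>i. a i * eps (k - int i) \<omega>) sums Z k \<omega>"
  shows "h (Z k \<omega>) = (\<Sum>j<J. dif h a j (pst (k - int j) \<omega>)) + avg h J (tail a J (pst (k - int J) \<omega>))"
proof -
  have eq: "dif h a j (pst (k - int j) \<omega>) = avg h j (tail a j (pst (k - int j) \<omega>))
    - avg h (Suc j) (tail a (Suc j) (pst (k - int (Suc j)) \<omega>))" for j
  proof -
    have "sh 1 (pst (k - int j) \<omega>) = pst (k - int (Suc j)) \<omega>"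
      unfolding pst_shift[symmetric] by (simp add: algebra_simps)
    moreover have "a j * pst (k - int j) \<omega> 0 + tail a (Suc j) (pst (k - int (Suc j)) \<omega>) = tail a j (pst (k - int j) \<omega>)"
      unfolding tail_pst[OF s] by (simp add: pst_def)
    ultimately show ?thesis unfolding dif_def by (simp del: avg.simps)
  qed
  have "(\<Sum>j<J. dif h a j (pst (k - int j) \<omega>)) = avg h 0 (tail a 0 (pst (k - int 0) \<omega>)) - avg h J (tail a J (pst (k - int J) \<omega>))"
    unfolding eq by (rule sum_lessThan_telescope')
  also have "avg h 0 (tail a 0 (pst (k - int 0) \<omega>)) = h (Z k \<omega>)"
    unfolding tail_pst[OF s] by simp
  finally show ?thesis by simp
qed

lemma tail_cut: "tail (cutoff i) J w = (\<Sum>l<i - J. a (J + l) * w l)"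
proof -
  have "tail (cutoff i) J w = (\<Sum>l<i - J. cutoff i (J + l) * w l)"
    unfolding tail_def by (rule suminf_finite) (auto simp: cutoff_def)
  also have "\<dots> = (\<Sum>l<i - J. a (J + l) * w l)"
    by (intro sum.cong) (auto simp: cutoff_def)
  finally show ?thesis .
qed

lemma tail_cut_Suc:
  assumes "j < i"
  shows "tail (cutoff i) j w = a j * w 0 + tail (cutoff i) (Suc j) (sh 1 w)"
proof -
  obtain m where m: "i - j = Suc m" using assms by (cases "i - j") auto
  then have "i - Suc j = m" by simp
  then show ?thesis unfolding tail_cut m by (subst sum.lessThan_Suc_shift) (simp add: sh_def)
qed

text \<open>After \<open>i\<close> steps no innovation is left in the truncated sum, so the
  remainder is the number \<open>avg h i 0\<close>, the mean of the left side.\<close>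

lemma telescope_cut:
  "h (tail (cutoff i) 0 (pst k \<omega>)) = (\<Sum>j<i. dif h (cutoff i) j (pst (k - int j) \<omega>)) + avg h i 0"
proof -
  have eq: "dif h (cutoff i) j (pst (k - int j) \<omega>) = avg h j (tail (cutoff i) j (pst (k - int j) \<omega>))
    - avg h (Suc j) (tail (cutoff i) (Suc j) (pst (k - int (Suc j)) \<omega>))" if "j < i" for j
  proof -
    have "sh 1 (pst (k - int j) \<omega>) = pst (k - int (Suc j)) \<omega>"
      unfolding pst_shift[symmetric] by (simp add: algebra_simps)
    then show ?thesis unfolding tail_cut_Suc[OF that] dif_def by (simp del: avg.simps)
  qed
  have "(\<Sum>j<i. dif h (cutoff i) j (pst (k - int j) \<omega>)) = (\<Sum>j<i. avg h j (tail (cutoff i) j (pst (k - int j) \<omega>))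
    - avg h (Suc j) (tail (cutoff i) (Suc j) (pst (k - int (Suc j)) \<omega>)))"
    by (intro sum.cong refl eq) auto
  also have "\<dots> = avg h 0 (tail (cutoff i) 0 (pst (k - int 0) \<omega>)) - avg h i (tail (cutoff i) i (pst (k - int i) \<omega>))"
    by (rule sum_lessThan_telescope')
  finally show ?thesis by (simp add: tail_cut)
qed

end


section \<open>Remainders and truncation errors in L2\<close>

lemma (in prob_space) abs_expectation_le_l2norm:
  assumes f: "bdm M f"
  shows "\<bar>expectation f\<bar> \<le> l2norm M f"
proof -
  have "0 \<le> variance f" by (rule variance_positive)
  also have "variance f = expectation (\<lambda>x. (f x)\<^sup>2) - (expectation f)\<^sup>2"
    using f by (intro variance_eq) (auto intro: bdm_integrable bdm_power2)
  finally have "(expectation f)\<^sup>2 \<le> (l2norm M f)\<^sup>2" by (simp add: l2norm_sq)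
  then show ?thesis using abs_le_square_iff[of "expectation f" "l2norm M f"] by simp
qed

context linear_process begin

definition mean :: "(real \<Rightarrow> real) \<Rightarrow> real" where
  "mean h = (\<integral>w. h (tail a 0 w) \<partial>Sq)"

lemma Z_eq_tail: "AE \<omega> in M. Z k \<omega> = tail a 0 (pst k \<omega>)"
  using Z_sums[of k] by eventually_elim (use tail_pst[of k _ 0] in simp)

lemma expectation_Z:
  assumes [measurable]: "h \<in> borel_measurable borel"
  shows "(\<integral>\<omega>. h (Z k \<omega>) \<partial>M) = mean h"
proof -
  have "(\<integral>\<omega>. h (Z k \<omega>) \<partial>M) = (\<integral>\<omega>. h (tail a 0 (pst k \<omega>)) \<partial>M)"
    using Z_eq_tail[of k] by (intro integral_cong_AE) auto
  also have "\<dots> = mean h" unfolding mean_def by (rule expectation_pst[of "\<lambda>w. h (tail a 0 w)"]) simp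
  finally show ?thesis .
qed

lemma mdiff_mean: assumes "mdiff d" shows "(\<integral>\<omega>. d (pst l \<omega>) \<partial>M) = 0"
  using mdiff_orthogonal[OF assms, of "\<lambda>_. 1" "l - 1" l] by simp

lemma avg_tail_bdm:
  assumes "adm L h"
  shows "bdm M (\<lambda>\<omega>. avg h J (tail a J (pst l \<omega>)))"
  by (rule adm_bdm[OF assms]) simp

lemma expectation_avg_tail:
  assumes h: "adm L h"
  shows "(\<integral>\<omega>. avg h J (tail a J (pst (k - int J) \<omega>)) \<partial>M) = mean h"
proof -
  note [measurable] = adm_measurable[OF h]
  note bd = bdm_pst[OF dif_bdm[OF h]]
  have "mean h = (\<integral>\<omega>. h (Z k \<omega>) \<partial>M)" by (simp add: expectation_Z)
  also have "\<dots> = (\<integral>\<omega>. (\<Sum>j<J. dif h a j (pst (k - int j) \<omega>)) + avg h J (tail a J (pst (k - int J) \<omega>)) \<partial>M)"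
    using Z_sums[of k]
  proof (intro integral_cong_AE)
    assume "AE \<omega> in M. (\<lambda>i. a i * eps (k - int i) \<omega>) sums Z k \<omega>"
    then show "AE \<omega> in M. h (Z k \<omega>) = (\<Sum>j<J. dif h a j (pst (k - int j) \<omega>)) + avg h J (tail a J (pst (k - int J) \<omega>))"
      by eventually_elim (rule telescope)
    show "(\<lambda>\<omega>. (\<Sum>j<J. dif h a j (pst (k - int j) \<omega>)) + avg h J (tail a J (pst (k - int J) \<omega>))) \<in> borel_measurable M"
      by (intro bdm_measurable bdm_add bdm_sum bd avg_tail_bdm[OF h])
  qed simp
  also have "\<dots> = (\<Sum>j<J. \<integral>\<omega>. dif h a j (pst (k - int j) \<omega>) \<partial>M) + (\<integral>\<omega>. avg h J (tail a J (pst (k - int J) \<omega>)) \<partial>M)"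
    using bdm_integrable[OF bd] bdm_integrable[OF avg_tail_bdm[OF h]] by simp
  finally show ?thesis by (simp add: mdiff_mean[OF dif_mdiff[OF h]])
qed

lemma tail_tendsto_0: "AE \<omega> in M. (\<lambda>J. tail a J (pst (k - int J) \<omega>)) \<longlonglongrightarrow> 0"
  using Z_sums[of k]
proof eventually_elim
  case (elim \<omega>)
  have "(\<lambda>J. Z k \<omega> - (\<Sum>i<J. a i * eps (k - int i) \<omega>)) \<longlonglongrightarrow> Z k \<omega> - Z k \<omega>"
    using elim unfolding sums_def by (intro tendsto_intros)
  then show ?case unfolding tail_pst[OF elim] by simp
qed

text \<open>\<open>avg h J\<close> has the same Lipschitz constant for all \<open>J > 0\<close>, and
  the tail tends to 0 almost surely; the uniform bound 2 permits dominated convergence.\<close>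

lemma avg_tail_tendsto:
  assumes h: "adm L h"
  shows "(\<lambda>J. l2norm M (\<lambda>\<omega>. avg h J (tail a J (pst (k - int J) \<omega>)) - avg h J 0)) \<longlonglongrightarrow> 0"
proof -
  let ?X = "\<lambda>J \<omega>. avg h J (tail a J (pst (k - int J) \<omega>)) - avg h J 0"
  have bd: "bdm M (?X J)" for J by (intro bdm_diff avg_tail_bdm[OF h] bdm_const)
  have X2: "\<bar>?X J \<omega>\<bar> \<le> 2" for J \<omega>
    using adm_bound[OF h, of J "tail a J (pst (k - int J) \<omega>)"] adm_bound[OF h, of J 0] by linarith
  have "(\<lambda>J. \<integral>\<omega>. (?X J \<omega>)\<^sup>2 \<partial>M) \<longlonglongrightarrow> (\<integral>\<omega>. 0 \<partial>M)"
  proof (rule integral_dominated_convergence[where w="\<lambda>_. 4"])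
    show "AE \<omega> in M. (\<lambda>J. (?X J \<omega>)\<^sup>2) \<longlonglongrightarrow> 0"
      using tail_tendsto_0[of k]
    proof eventually_elim
      case (elim \<omega>)
      have "(\<lambda>J. ?X J \<omega>) \<longlonglongrightarrow> 0"
      proof (rule Lim_null_comparison)
        show "\<forall>\<^sub>F J in sequentially. norm (?X J \<omega>) \<le> L * \<bar>tail a J (pst (k - int J) \<omega>)\<bar>"
          using eventually_gt_at_top[of 0]
        proof eventually_elim
          case (elim J)
          then obtain J' where J': "J = Suc J'" by (cases J) auto
          show ?case using adm_lip[OF h, of J'] unfolding J' lip_def real_norm_def by (metis diff_0_right)
        qed
        show "(\<lambda>J. L * \<bar>tail a J (pst (k - int J) \<omega>)\<bar>) \<longlonglongrightarrow> 0"
          using tendsto_mult_left[OF tendsto_rabs_zero[OF elim], of L] by simp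
      qed
      then show ?case using tendsto_power[of _ 0 sequentially 2] by simp
    qed
    show "AE \<omega> in M. norm ((?X J \<omega>)\<^sup>2) \<le> 4" for J
      using X2[of J] abs_le_square_iff[of _ "2::real"] by (intro AE_I2) (auto simp: power2_eq_square)
  qed (use bdm_measurable[OF bdm_power2[OF bd]] in auto)
  then have "(\<lambda>J. sqrt (\<integral>\<omega>. (?X J \<omega>)\<^sup>2 \<partial>M)) \<longlonglongrightarrow> sqrt 0" by (intro tendsto_real_sqrt) simp
  then show ?thesis by (simp add: l2norm_def)
qed

text \<open>Comparison with the number \<open>avg h J 0\<close> comes first. The same L2 distance
  then bounds the variable and its expectation, whence the factor 2.\<close>

lemma remainder_tendsto:
  assumes h: "adm L h"
  shows "(\<lambda>J. l2norm M (\<lambda>\<omega>. avg h J (tail a J (pst (k - int J) \<omega>)) - mean h)) \<longlonglongrightarrow> 0"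
proof (rule Lim_null_comparison)
  let ?X = "\<lambda>J \<omega>. avg h J (tail a J (pst (k - int J) \<omega>)) - avg h J 0"
  show "(\<lambda>J. 2 * l2norm M (?X J)) \<longlonglongrightarrow> 0"
    using tendsto_mult_left[OF avg_tail_tendsto[OF h], of 2 k] by simp
  show "\<forall>\<^sub>F J in sequentially. norm (l2norm M (\<lambda>\<omega>. avg h J (tail a J (pst (k - int J) \<omega>)) - mean h)) \<le> 2 * l2norm M (?X J)"
  proof (intro always_eventually allI)
    fix J
    note bd = avg_tail_bdm[OF h, of J "k - int J"]
    have bdX: "bdm M (?X J)" by (intro bdm_diff bd bdm_const)
    have "expectation (?X J) = mean h - avg h J 0"
      using bdm_integrable[OF bd] expectation_avg_tail[OF h, of J k] prob_space by simp
    then have "\<bar>mean h - avg h J 0\<bar> \<le> l2norm M (?X J)"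
      using abs_expectation_le_l2norm[OF bdX] by simp
    moreover have "l2norm M (\<lambda>\<omega>. ?X J \<omega> - (mean h - avg h J 0)) \<le> l2norm M (?X J) + l2norm M (\<lambda>\<omega>. mean h - avg h J 0)"
      by (intro l2norm_triangle_diff bdX bdm_const)
    moreover have "l2norm M (\<lambda>\<omega>. mean h - avg h J 0) = \<bar>mean h - avg h J 0\<bar>"
      by (simp add: l2norm_def prob_space)
    ultimately show "norm (l2norm M (\<lambda>\<omega>. avg h J (tail a J (pst (k - int J) \<omega>)) - mean h)) \<le> 2 * l2norm M (?X J)"
      by simp
  qed
qed

text \<open>Lags from \<open>i\<close> on have no counterpart in the process truncated to
  \<open>i\<close> innovations, so there the whole projection counts as error.\<close>

definition cdif :: "(real \<Rightarrow> real) \<Rightarrow> nat \<Rightarrow> nat \<Rightarrow> (nat \<Rightarrow> real) \<Rightarrow> real" where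
  "cdif h i j w = dif h a j w - (if j < i then dif h (cutoff i) j w else 0)"

lemma cdif_mdiff: assumes "adm L h" shows "mdiff (cdif h i j)"
proof -
  have "mdiff (\<lambda>w. if j < i then dif h (cutoff i) j w else 0)"
    using dif_mdiff[OF assms, of "cutoff i" j] by (cases "j < i") (auto simp: mdiff_def)
  then have "mdiff (\<lambda>w. dif h a j w - (if j < i then dif h (cutoff i) j w else 0))"
    by (intro mdiff_diff dif_mdiff[OF assms])
  then show ?thesis by (simp add: cdif_def[abs_def])
qed

lemma l2norm_cdif_le: assumes h: "adm L h" shows "l2norm Sq (cdif h i j) \<le> 2 * wt L j"
proof (cases "j < i")
  case True
  then have "l2norm Sq (cdif h i j) \<le> l2norm Sq (dif h a j) + l2norm Sq (dif h (cutoff i) j)"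
    unfolding cdif_def[abs_def] using Sq.l2norm_triangle_diff[OF dif_bdm[OF h] dif_bdm[OF h]] by simp
  then show ?thesis using l2norm_dif_le[OF h, of a j] l2norm_dif_le[OF h, of "cutoff i" j] by linarith
next
  case False
  then have "cdif h i j = dif h a j" by (auto simp: cdif_def)
  then show ?thesis using l2norm_dif_le[OF h, of a j] wt_nonneg[of L j] by simp
qed

text \<open>Truncation at order 0 replaces the second process by a constant, so this lemma
  also bounds the variance of \<open>\<Sum>k\<in>A. h (Z k)\<close> itself.\<close>
lemma l2norm_truncation:
  assumes h: "adm L h" and A: "finite A"
  shows "summable (\<lambda>j. sqrt (\<Sum>k\<in>A. (l2norm Sq (cdif h (tr k) j))\<^sup>2))"
    and "l2norm M (\<lambda>\<omega>. \<Sum>k\<in>A. (h (Z k \<omega>) - mean h) - (h (tail (cutoff (tr k)) 0 (pst k \<omega>)) - avg h (tr k) 0))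
     \<le> (\<Sum>j. sqrt (\<Sum>k\<in>A. (l2norm Sq (cdif h (tr k) j))\<^sup>2))"
proof -
  let ?s = "\<lambda>j. sqrt (\<Sum>k\<in>A. (l2norm Sq (cdif h (tr k) j))\<^sup>2)"
  have s0: "0 \<le> ?s j" for j by (simp add: sum_nonneg)
  have s_le: "?s j \<le> sqrt (card A) * (2 * wt L j)" for j
  proof -
    have "(\<Sum>k\<in>A. (l2norm Sq (cdif h (tr k) j))\<^sup>2) \<le> (\<Sum>k\<in>A. (2 * wt L j)\<^sup>2)"
      by (intro sum_mono power_mono l2norm_cdif_le[OF h]) auto
    also have "\<dots> = (sqrt (card A) * (2 * wt L j))\<^sup>2" by (simp add: power_mult_distrib)
    finally show ?thesis using wt_nonneg[of L j] by (intro real_le_lsqrt) (auto simp: sum_nonneg)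
  qed
  show sm: "summable ?s"
  proof (rule summable_comparison_test')
    show "summable (\<lambda>j. sqrt (card A) * (2 * wt L j))" by (intro summable_mult wt_summable)
    show "norm (?s j) \<le> sqrt (card A) * (2 * wt L j)" for j using s_le[of j] s0[of j] by simp
  qed
  let ?D = "\<lambda>\<omega>. \<Sum>k\<in>A. (h (Z k \<omega>) - mean h) - (h (tail (cutoff (tr k)) 0 (pst k \<omega>)) - avg h (tr k) 0)"
  let ?R = "\<lambda>J k \<omega>. avg h J (tail a J (pst (k - int J) \<omega>)) - mean h"
  note [measurable] = adm_measurable[OF h]
  have bdR: "bdm M (?R J k)" for J k by (intro bdm_diff avg_tail_bdm[OF h] bdm_const)
  have h0: "bdm M (\<lambda>\<omega>. h (u \<omega>))" if "u \<in> borel_measurable M" for u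
    using adm_bdm[OF h that, of 0] by simp
  have bdD: "bdm M ?D" by (intro bdm_sum bdm_diff bdm_const h0) auto
  \<comment> \<open>A \<open>J\<close> beyond all truncation orders lets both telescoping sums run
    over the same lags.\<close>
  have bound: "l2norm M ?D \<le> suminf ?s + (\<Sum>k\<in>A. l2norm M (?R J k))" if J: "\<And>k. k \<in> A \<Longrightarrow> tr k \<le> J" for J
  proof -
    let ?E = "\<lambda>\<omega>. \<Sum>k\<in>A. \<Sum>j<J. cdif h (tr k) j (pst (k - int j) \<omega>)"
    have bdE: "bdm M ?E" by (intro bdm_sum bdm_pst[OF mdiff_bdm[OF cdif_mdiff[OF h]]])
    have "AE \<omega> in M. ?D \<omega> = ?E \<omega> + (\<Sum>k\<in>A. ?R J k \<omega>)"
      using Z_sums_all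
    proof eventually_elim
      case (elim \<omega>)
      have "(h (Z k \<omega>) - mean h) - (h (tail (cutoff (tr k)) 0 (pst k \<omega>)) - avg h (tr k) 0)
        = (\<Sum>j<J. cdif h (tr k) j (pst (k - int j) \<omega>)) + ?R J k \<omega>" if "k \<in> A" for k
      proof -
        have "(\<Sum>j<J. if j < tr k then dif h (cutoff (tr k)) j (pst (k - int j) \<omega>) else 0)
          = (\<Sum>j<tr k. dif h (cutoff (tr k)) j (pst (k - int j) \<omega>))"
          using J[OF that] by (intro sum.mono_neutral_cong_right) auto
        then have "h (tail (cutoff (tr k)) 0 (pst k \<omega>)) - avg h (tr k) 0
          = (\<Sum>j<J. if j < tr k then dif h (cutoff (tr k)) j (pst (k - int j) \<omega>) else 0)"
          using telescope_cut[of h "tr k" k \<omega>] by simp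
        moreover have "h (Z k \<omega>) - mean h = (\<Sum>j<J. dif h a j (pst (k - int j) \<omega>)) + ?R J k \<omega>"
          using telescope[of k \<omega> h J] elim by simp
        ultimately show ?thesis unfolding cdif_def by (simp add: sum_subtractf)
      qed
      then show ?case unfolding sum.distrib[symmetric] by (intro sum.cong refl)
    qed
    then have "l2norm M ?D = l2norm M (\<lambda>\<omega>. ?E \<omega> + (\<Sum>k\<in>A. ?R J k \<omega>))"
      by (intro l2norm_cong_AE bdD bdm_add bdE bdm_sum bdR)
    also have "\<dots> \<le> l2norm M ?E + l2norm M (\<lambda>\<omega>. \<Sum>k\<in>A. ?R J k \<omega>)"
      by (intro l2norm_triangle bdE bdm_sum bdR)
    also have "l2norm M (\<lambda>\<omega>. \<Sum>k\<in>A. ?R J k \<omega>) \<le> (\<Sum>k\<in>A. l2norm M (?R J k))"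
      by (intro l2norm_sum bdR)
    also have "l2norm M ?E \<le> (\<Sum>j<J. ?s j)"
      by (intro l2norm_mdiff_array A cdif_mdiff[OF h])
    also have "(\<Sum>j<J. ?s j) \<le> suminf ?s"
      by (intro sum_le_suminf sm) (auto simp: sum_nonneg)
    finally show ?thesis by simp
  qed
  \<comment> \<open>The norm to be bounded does not involve \<open>J\<close>, so the remainders can
    be sent to 0.\<close>
  have lim: "(\<lambda>J. suminf ?s + (\<Sum>k\<in>A. l2norm M (?R J k))) \<longlonglongrightarrow> suminf ?s + (\<Sum>k\<in>A. 0)"
    by (intro tendsto_intros remainder_tendsto[OF h])
  show "l2norm M ?D \<le> suminf ?s"
  proof (rule tendsto_lowerbound)
    show "(\<lambda>J. suminf ?s + (\<Sum>k\<in>A. l2norm M (?R J k))) \<longlonglongrightarrow> suminf ?s" using lim by simp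
    show "\<forall>\<^sub>F J in sequentially. l2norm M ?D \<le> suminf ?s + (\<Sum>k\<in>A. l2norm M (?R J k))"
      using eventually_ge_at_top[of "Max (tr ` A)"]
    proof eventually_elim
      case (elim J)
      show ?case
      proof (rule bound)
        fix k assume "k \<in> A"
        then have "tr k \<le> Max (tr ` A)" using A by simp
        then show "tr k \<le> J" using elim by simp
      qed
    qed
  qed simp
qed

end

subsection \<open>Central limit theorem\<close>


lemma cesaro_zero:
  fixes f :: "nat \<Rightarrow> real"
  assumes f: "f \<longlonglongrightarrow> 0"
  shows "(\<lambda>p. (\<Sum>m<p. f m) / real p) \<longlonglongrightarrow> 0"
proof (rule LIMSEQ_I)
  fix e :: real assume e: "e > 0"
  obtain N where N: "\<And>m. m \<ge> N \<Longrightarrow> \<bar>f m\<bar> < e / 2"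
    using LIMSEQ_D[OF f, of "e / 2"] e by auto
  define C where "C = (\<Sum>m<N. \<bar>f m\<bar>)"
  obtain P :: nat where P: "2 * C / e < real P" using reals_Archimedean2 by blast
  show "\<exists>no. \<forall>n\<ge>no. norm ((\<Sum>m<n. f m) / real n - 0) < e"
  proof (intro exI allI impI)
    fix n assume n: "Suc (max P N) \<le> n"
    have "\<bar>\<Sum>m<n. f m\<bar> \<le> (\<Sum>m<n. \<bar>f m\<bar>)" by (rule sum_abs)
    also have "\<dots> = C + (\<Sum>m\<in>{N..<n}. \<bar>f m\<bar>)"
      unfolding C_def using n sum.atLeastLessThan_concat[of 0 N n "\<lambda>m. \<bar>f m\<bar>"]
      by (simp add: atLeast0LessThan)
    also have "(\<Sum>m\<in>{N..<n}. \<bar>f m\<bar>) \<le> (\<Sum>m\<in>{N..<n}. e / 2)"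
      using N by (intro sum_mono) (auto simp: less_imp_le)
    also have "\<dots> \<le> real n * (e / 2)" using e by (simp add: mult_right_mono)
    also have "C < real n * (e / 2)"
    proof -
      have "2 * C / e < real n" using P n by linarith
      then show ?thesis using e by (simp add: field_simps)
    qed
    finally have "\<bar>\<Sum>m<n. f m\<bar> < real n * e" by (simp add: mult.commute)
    then show "norm ((\<Sum>m<n. f m) / real n - 0) < e" using n by (simp add: field_simps)
  qed
qed

lemma filterlim_div_at_top:
  assumes "(p::nat) > 0"
  shows "filterlim (\<lambda>n. n div p) at_top sequentially"
  unfolding filterlim_at_top
proof
  fix Z :: nat
  show "\<forall>\<^sub>F n in sequentially. Z \<le> n div p"
    by (rule eventually_mono[OF eventually_ge_at_top[of "Z * p"]])
       (use assms in \<open>simp add: less_eq_div_iff_mult_less_eq\<close>)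
qed

lemma div_ratio_tendsto:
  assumes "(p::nat) > 0"
  shows "(\<lambda>n. real (n div p) / real n) \<longlonglongrightarrow> 1 / real p"
proof (rule real_tendsto_sandwich)
  show "(\<lambda>n. 1 / real p - 1 / real n) \<longlonglongrightarrow> 1 / real p"
    using tendsto_diff[OF tendsto_const lim_1_over_n, of "1 / real p"] by simp
  show "\<forall>\<^sub>F n in sequentially. 1 / real p - 1 / real n \<le> real (n div p) / real n"
    using eventually_gt_at_top[of 0]
  proof eventually_elim
    case (elim n)
    have "n < (n div p + 1) * p" using assms
      by (metis Suc_eq_plus1 dividend_less_div_times mult.commute mult_Suc_right add.commute)
    then have "real n \<le> (real (n div p) + 1) * real p" by (metis less_imp_le of_nat_1 of_nat_add of_nat_le_iff of_nat_mult)
    then have "1 / real p \<le> (real (n div p) + 1) / real n" using elim assms by (simp add: field_simps)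
    then show ?case by (simp add: add_divide_distrib)
  qed
  show "\<forall>\<^sub>F n in sequentially. real (n div p) / real n \<le> 1 / real p"
    using eventually_gt_at_top[of 0]
  proof eventually_elim
    case (elim n)
    have "real (n div p) * real p \<le> real n" by (metis of_nat_le_iff of_nat_mult div_times_less_eq_dividend)
    then show ?case using elim assms by (simp add: field_simps)
  qed
qed simp

context linear_process begin

text \<open>At lag 0 the convergence of truncated sums passes through the unsmoothed
  \<open>h\<close>, so \<open>Z 0\<close> has to avoid its discontinuities.\<close>

definition acont :: "(real \<Rightarrow> real) \<Rightarrow> bool" where
  "acont h \<longleftrightarrow> (AE \<omega> in M. isCont h (Z 0 \<omega>))"

lemma tail_cut_tendsto:
  assumes s: "(\<lambda>i. a i * eps (k - int i) \<omega>) sums Z k \<omega>"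
  shows "(\<lambda>i. tail (cutoff i) J (pst (k - int J) \<omega>)) \<longlonglongrightarrow> tail a J (pst (k - int J) \<omega>)"
proof -
  let ?f = "\<lambda>l. a (J + l) * pst (k - int J) \<omega> l"
  have "summable (\<lambda>l. a (l + J) * eps (k - int (l + J)) \<omega>)"
    using summable_ignore_initial_segment[OF sums_summable[OF s]] .
  then have "summable ?f" by (simp add: pst_def add.commute algebra_simps)
  then have "(\<lambda>n. \<Sum>l<n. ?f l) \<longlonglongrightarrow> suminf ?f" by (rule summable_LIMSEQ)
  moreover have "filterlim (\<lambda>i. i - J) sequentially sequentially"
    by (rule filterlim_minus_const_nat_at_top)
  ultimately have "(\<lambda>i. \<Sum>l<i - J. ?f l) \<longlonglongrightarrow> suminf ?f" by (rule filterlim_compose)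
  then show ?thesis unfolding tail_cut by (simp add: tail_def)
qed

text \<open>Truncated tails converge to the full tail almost surely, and \<open>avg h j\<close> is
  continuous at the limit: by the Lipschitz bound for \<open>j > 0\<close>, by \<open>acont\<close>
  for \<open>j = 0\<close>.\<close>

lemma cdif_tendsto:
  assumes h: "adm L h" and c: "acont h"
  shows "(\<lambda>i. l2norm Sq (cdif h i j)) \<longlonglongrightarrow> 0"
proof -
  let ?w = "pst (0 - int j)"
  note bd = mdiff_bdm[OF cdif_mdiff[OF h]]
  have lip_cont: "isCont (avg h (Suc i)) y" for i y
    using adm_lip[OF h, of i] unfolding lip_def
    by (intro lipschitz_on_continuous_within[OF lipschitz_onI, of UNIV _ L]) (auto simp: dist_real_def)
  have "(\<lambda>i. \<integral>\<omega>. (cdif h i j (?w \<omega>))\<^sup>2 \<partial>M) \<longlonglongrightarrow> (\<integral>\<omega>. 0 \<partial>M)"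
  proof (rule integral_dominated_convergence[where w="\<lambda>_. 16"])
    show "AE \<omega> in M. (\<lambda>i. (cdif h i j (?w \<omega>))\<^sup>2) \<longlonglongrightarrow> 0"
      using Z_sums[of 0] c[unfolded acont_def]
    proof eventually_elim
      case (elim \<omega>)
      have sh: "sh 1 (?w \<omega>) = pst (0 - int (Suc j)) \<omega>"
        unfolding pst_shift[symmetric] by (rule arg_cong[where f="\<lambda>l. pst l \<omega>"]) simp
      define y where "y = tail a (Suc j) (pst (0 - int (Suc j)) \<omega>)"
      have ty: "(\<lambda>i. tail (cutoff i) (Suc j) (sh 1 (?w \<omega>))) \<longlonglongrightarrow> y"
        unfolding sh y_def by (rule tail_cut_tendsto[OF elim(1)])
      have "isCont (avg h j) (a j * ?w \<omega> 0 + y)"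
      proof (cases j)
        case 0
        have "a j * ?w \<omega> 0 + y = Z 0 \<omega>"
          unfolding y_def tail_pst[OF elim(1)] 0 by (simp add: pst_def)
        then show ?thesis using elim(2) 0 by simp
      qed (use lip_cont in blast)
      then have "(\<lambda>i. dif h (cutoff i) j (?w \<omega>)) \<longlonglongrightarrow> avg h j (a j * ?w \<omega> 0 + y) - avg h (Suc j) y"
        unfolding dif_def
        by (intro tendsto_diff isCont_tendsto_compose[where g="avg h j"] isCont_tendsto_compose[OF lip_cont]
             tendsto_add tendsto_const ty)
      then have t: "(\<lambda>i. dif h (cutoff i) j (?w \<omega>)) \<longlonglongrightarrow> dif h a j (?w \<omega>)"
        unfolding dif_def y_def sh .
      have "(\<lambda>i. dif h a j (?w \<omega>) - dif h (cutoff i) j (?w \<omega>)) \<longlonglongrightarrow> 0"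
        using tendsto_diff[OF tendsto_const[of "dif h a j (?w \<omega>)"] t] by simp
      then have "(\<lambda>i. cdif h i j (?w \<omega>)) \<longlonglongrightarrow> 0"
      proof (rule Lim_transform_eventually)
        show "\<forall>\<^sub>F i in sequentially. dif h a j (?w \<omega>) - dif h (cutoff i) j (?w \<omega>) = cdif h i j (?w \<omega>)"
          using eventually_gt_at_top[of j] by eventually_elim (simp add: cdif_def)
      qed
      then show ?case using tendsto_power[of _ 0 sequentially 2] by simp
    qed
    show "AE \<omega> in M. norm ((cdif h i j (?w \<omega>))\<^sup>2) \<le> 16" for i
    proof (rule AE_I2)
      fix \<omega>
      have "\<bar>cdif h i j (?w \<omega>)\<bar> \<le> 4"
        using dif_bound[OF h, of a j "?w \<omega>"] dif_bound[OF h, of "cutoff i" j "?w \<omega>"] by (auto simp: cdif_def)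
      then show "norm ((cdif h i j (?w \<omega>))\<^sup>2) \<le> 16"
        using abs_le_square_iff[of "cdif h i j (?w \<omega>)" 4] by simp
    qed
    show "(\<lambda>\<omega>. (cdif h i j (?w \<omega>))\<^sup>2) \<in> borel_measurable M" for i
      by (intro bdm_measurable bdm_power2 bdm_pst bd)
  qed auto
  then have "(\<lambda>i. sqrt (\<integral>\<omega>. (cdif h i j (?w \<omega>))\<^sup>2 \<partial>M)) \<longlonglongrightarrow> sqrt 0" by (intro tendsto_real_sqrt) simp
  then show ?thesis unfolding l2norm_pst[OF bd, symmetric, of _ _ "0 - int j"] by (simp add: l2norm_def)
qed

text \<open>Bound for the L2 error of the block approximation per square root of the number of
  terms. Position \<open>m\<close> of a block keeps the \<open>Suc m\<close> innovations since the
  start of the block, so squared errors are averaged over the positions.\<close>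

definition err :: "(real \<Rightarrow> real) \<Rightarrow> nat \<Rightarrow> real" where
  "err h p = (\<Sum>j. sqrt ((\<Sum>m<p. (l2norm Sq (cdif h (Suc m) j))\<^sup>2) / real p))"

text \<open>At each lag the errors vanish as \<open>m\<close> grows, hence so do their Cesaro means;
  the majorant \<open>2 * wt L j\<close> is free of \<open>p\<close>, as Tannery's theorem
  requires.\<close>

lemma err_tendsto:
  assumes h: "adm L h" and c: "acont h"
  shows "err h \<longlonglongrightarrow> 0"
proof -
  let ?s = "\<lambda>j p. sqrt ((\<Sum>m<p. (l2norm Sq (cdif h (Suc m) j))\<^sup>2) / real p)"
  have lim: "?s j \<longlonglongrightarrow> 0" for j
  proof -
    have "(\<lambda>m. (l2norm Sq (cdif h (Suc m) j))\<^sup>2) \<longlonglongrightarrow> 0\<^sup>2"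
      by (intro tendsto_power LIMSEQ_Suc cdif_tendsto[OF h c])
    then have "(\<lambda>p. (\<Sum>m<p. (l2norm Sq (cdif h (Suc m) j))\<^sup>2) / real p) \<longlonglongrightarrow> 0"
      by (intro cesaro_zero) simp
    then show ?thesis using tendsto_real_sqrt by fastforce
  qed
  have bound: "norm (?s j p) \<le> 2 * wt L j" for j p
  proof (cases "p = 0")
    case False
    have "(\<Sum>m<p. (l2norm Sq (cdif h (Suc m) j))\<^sup>2) \<le> (\<Sum>m<p. (2 * wt L j)\<^sup>2)"
      by (intro sum_mono power_mono l2norm_cdif_le[OF h]) auto
    then have "(\<Sum>m<p. (l2norm Sq (cdif h (Suc m) j))\<^sup>2) / real p \<le> (2 * wt L j)\<^sup>2"
      using False by (simp add: field_simps)
    then have "?s j p \<le> 2 * wt L j" using wt_nonneg[of L j] by (intro real_le_lsqrt) (auto simp: sum_nonneg)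
    moreover have "0 \<le> ?s j p" by (simp add: sum_nonneg)
    ultimately show ?thesis by simp
  qed (use wt_nonneg in simp)
  have "(\<lambda>p. suminf (\<lambda>j. ?s j p)) \<longlonglongrightarrow> (\<Sum>j. 0)"
    using tannerys_theorem[of ?s "\<lambda>_. 0" sequentially "\<lambda>j. 2 * wt L j", OF lim] bound
      summable_mult[OF wt_summable, of 2 L]
    by (simp add: always_eventually split_beta')
  then show ?thesis by (simp add: err_def[abs_def])
qed

text \<open>A block sum whose moving averages are cutoff off at the beginning of the block, so that
  consecutive blocks are independent without any gaps.\<close>
definition blk :: "(real \<Rightarrow> real) \<Rightarrow> nat \<Rightarrow> (nat \<Rightarrow> real) \<Rightarrow> real" where
  "blk h p w = (\<Sum>m<p. h (tail (cutoff (Suc m)) 0 (sh (p - Suc m) w)) - avg h (Suc m) 0)"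

lemma blk_bdm: assumes h: "adm L h" shows "bdm Sq (blk h p)"
  unfolding blk_def[abs_def]
proof (intro bdm_sum bdm_diff bdm_const)
  fix m
  have "(\<lambda>w. tail (cutoff (Suc m)) 0 (sh (p - Suc m) w)) \<in> borel_measurable Sq" by measurable
  from adm_bdm[OF h this, of 0] show "bdm Sq (\<lambda>w. h (tail (cutoff (Suc m)) 0 (sh (p - Suc m) w)))" by simp
qed

text \<open>Position \<open>m\<close> reads \<open>Suc m\<close> coordinates starting at
  \<open>p - Suc m\<close>, never beyond the \<open>p\<close> newest ones. This brings
  \<open>indep_blocks\<close> into play.\<close>

lemma blk_trunc: "blk h p (trunc p w) = blk h p w"
  unfolding blk_def
proof (intro sum.cong refl arg_cong2[where f="(-)"] arg_cong[where f=h])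
  fix m assume "m \<in> {..<p}"
  then show "tail (cutoff (Suc m)) 0 (sh (p - Suc m) (trunc p w)) = tail (cutoff (Suc m)) 0 (sh (p - Suc m) w)"
    unfolding tail_cut by (intro sum.cong refl) (auto simp: sh_def trunc_def)
qed

abbreviation bk :: "(real \<Rightarrow> real) \<Rightarrow> nat \<Rightarrow> nat \<Rightarrow> 'a \<Rightarrow> real" where
  "bk h p q \<omega> \<equiv> blk h p (pst (int (Suc q * p)) \<omega>)"

lemma bk_eq:
  "bk h p q \<omega> = (\<Sum>m<p. h (tail (cutoff (Suc m)) 0 (pst (int (Suc (q * p + m))) \<omega>)) - avg h (Suc m) 0)"
  unfolding blk_def
proof (intro sum.cong refl)
  fix m assume "m \<in> {..<p}"
  then have "int (Suc q * p) - int (p - Suc m) = int (Suc (q * p + m))"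
    by (simp add: of_nat_diff)
  then have "sh (p - Suc m) (pst (int (Suc q * p)) \<omega>) = pst (int (Suc (q * p + m))) \<omega>"
    using pst_shift[of "int (Suc q * p)" "p - Suc m" \<omega>] by metis
  then show "h (tail (cutoff (Suc m)) 0 (sh (p - Suc m) (pst (int (Suc q * p)) \<omega>))) - avg h (Suc m) 0 =
    h (tail (cutoff (Suc m)) 0 (pst (int (Suc (q * p + m))) \<omega>)) - avg h (Suc m) 0" by simp
qed

lemma bk_bdm: "adm L h \<Longrightarrow> bdm M (bk h p q)"
  by (rule bdm_pst[OF blk_bdm])

lemma bk_indep: assumes "adm L h" shows "indep_vars (\<lambda>_. borel) (bk h p) UNIV"
  using indep_blocks[OF bdm_measurable[OF blk_bdm[OF assms, of p]], of p] unfolding blk_trunc .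

lemma bk_distr: assumes "adm L h" shows "distr M borel (bk h p q) = distr Sq borel (blk h p)"
  by (rule distr_block[OF bdm_measurable[OF blk_bdm[OF assms]]])

lemma bk_mean: assumes h: "adm L h" shows "expectation (bk h p q) = 0"
proof -
  have "expectation (bk h p q) = expectation (\<lambda>\<omega>. \<Sum>m<p. \<Sum>j<Suc m. dif h (cutoff (Suc m)) j (pst (int (Suc (q * p + m)) - int j) \<omega>))"
    unfolding bk_eq telescope_cut by simp
  also have "\<dots> = 0"
    using bdm_integrable[OF bdm_pst[OF dif_bdm[OF h]]] mdiff_mean[OF dif_mdiff[OF h]]
    by (simp del: sum.lessThan_Suc)
  finally show ?thesis .
qed

lemma bk_sum_l2norm:
  assumes h: "adm L h"
  shows "l2norm M (\<lambda>\<omega>. \<Sum>q<Q. bk h p q \<omega>) = sqrt (real Q) * l2norm Sq (blk h p)"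
proof -
  have "(l2norm M (\<lambda>\<omega>. \<Sum>q<Q. bk h p q \<omega>))\<^sup>2 = (\<Sum>q<Q. (l2norm M (bk h p q))\<^sup>2)"
  proof (rule l2norm_sum_orthogonal)
    fix q q' :: nat assume qq: "q \<noteq> q'"
    have "(\<integral>\<omega>. (\<Prod>i\<in>{q, q'}. bk h p i \<omega>) \<partial>M) = (\<Prod>i\<in>{q, q'}. \<integral>\<omega>. bk h p i \<omega> \<partial>M)"
      using bdm_integrable[OF bk_bdm[OF h]] indep_vars_subset[OF bk_indep[OF h, of p], of "{q, q'}"]
      by (intro indep_vars_lebesgue_integral) auto
    then show "(\<integral>\<omega>. bk h p q \<omega> * bk h p q' \<omega> \<partial>M) = 0"
      using qq bk_mean[OF h] by simp
  qed (use bk_bdm[OF h] in auto)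
  also have "\<dots> = real Q * (l2norm Sq (blk h p))\<^sup>2"
    using l2norm_pst[OF blk_bdm[OF h]] by simp
  finally show ?thesis
    by (metis l2norm_nonneg mult_nonneg_nonneg of_nat_0_le_iff real_sqrt_ge_zero real_sqrt_mult real_sqrt_unique abs_of_nonneg real_sqrt_abs)
qed

definition psum :: "(real \<Rightarrow> real) \<Rightarrow> nat \<Rightarrow> 'a \<Rightarrow> real" where
  "psum h n \<omega> = (\<Sum>m<n. h (Z (int (Suc m)) \<omega>) - mean h)"

lemma hZ_bdm: assumes "adm L h" shows "bdm M (\<lambda>\<omega>. h (Z k \<omega>))"
  using adm_bdm[OF assms Z_measurable, of 0] by simp

lemma psum_bdm: assumes "adm L h" shows "bdm M (psum h n)"
  unfolding psum_def[abs_def] by (intro bdm_sum bdm_diff bdm_const hZ_bdm[OF assms])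

lemma mean_bound: assumes h: "adm L h" shows "\<bar>mean h\<bar> \<le> 1"
proof -
  note [measurable] = adm_measurable[OF h]
  have "\<bar>mean h\<bar> = \<bar>expectation (\<lambda>\<omega>. h (Z 0 \<omega>))\<bar>" by (simp add: expectation_Z)
  also have "\<dots> \<le> l2norm M (\<lambda>\<omega>. h (Z 0 \<omega>))" by (rule abs_expectation_le_l2norm[OF hZ_bdm[OF h]])
  also have "\<dots> \<le> 1" using h by (intro l2norm_le_const hZ_bdm[OF h]) (simp add: adm_def)
  finally show ?thesis .
qed

lemma psum_block_error:
  assumes h: "adm L h" and p: "p > 0"
  shows "l2norm M (\<lambda>\<omega>. psum h (Q * p) \<omega> - (\<Sum>q<Q. bk h p q \<omega>)) \<le> sqrt (real (Q * p)) * err h p"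
proof -
  \<comment> \<open>Number of innovations from the start of the block up to and including time
    \<open>k\<close>; blocks start at times 1, p + 1, 2 * p + 1 and so on.\<close>
  define tr where "tr k = Suc (nat (k - 1) mod p)" for k :: int
  have re: "(\<Sum>k\<in>(\<lambda>m. int (Suc m)) ` {..<n}. F k) = (\<Sum>m<n. F (int (Suc m)))" for F :: "int \<Rightarrow> real" and n
    by (subst sum.reindex) (auto simp: inj_on_def)
  have trS: "tr (int (Suc m)) = Suc (m mod p)" for m by (simp add: tr_def)
  have grp: "(\<Sum>m<Q * p. F m (m mod p)) = (\<Sum>q<Q. \<Sum>m<p. F (q * p + m) m)" for F :: "nat \<Rightarrow> nat \<Rightarrow> real"
  proof -
    have "(\<Sum>m<Q * p. F m (m mod p)) = (\<Sum>q<Q. \<Sum>m\<in>{q * p..<q * p + p}. F m (m mod p))"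
      by (rule sum.nat_group[symmetric])
    also have "\<dots> = (\<Sum>q<Q. \<Sum>m<p. F (q * p + m) m)"
    proof (rule sum.cong[OF refl])
      fix q
      have "(\<Sum>m\<in>{q * p..<q * p + p}. F m (m mod p)) = (\<Sum>m\<in>{0..<p}. F (m + q * p) ((m + q * p) mod p))"
        using sum.shift_bounds_nat_ivl[of "\<lambda>m. F m (m mod p)" 0 "q * p" p] by (simp add: add.commute)
      then show "(\<Sum>m\<in>{q * p..<q * p + p}. F m (m mod p)) = (\<Sum>m<p. F (q * p + m) m)"
        by (simp add: atLeast0LessThan add.commute)
    qed
    finally show ?thesis .
  qed
  let ?A = "(\<lambda>m. int (Suc m)) ` {..<Q * p}"
  have 1: "(\<Sum>k\<in>?A. (h (Z k \<omega>) - mean h) - (h (tail (cutoff (tr k)) 0 (pst k \<omega>)) - avg h (tr k) 0))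
     = psum h (Q * p) \<omega> - (\<Sum>q<Q. bk h p q \<omega>)" for \<omega>
  proof -
    have "(\<Sum>m<Q * p. h (tail (cutoff (Suc (m mod p))) 0 (pst (int (Suc m)) \<omega>)) - avg h (Suc (m mod p)) 0)
      = (\<Sum>q<Q. bk h p q \<omega>)"
      unfolding bk_eq
      by (rule grp[of "\<lambda>m i. h (tail (cutoff (Suc i)) 0 (pst (int (Suc m)) \<omega>)) - avg h (Suc i) 0"])
    then show ?thesis unfolding re psum_def trS by (subst sum_subtractf) (simp del: of_nat_Suc)
  qed
  have 2: "sqrt (\<Sum>k\<in>?A. (l2norm Sq (cdif h (tr k) j))\<^sup>2)
    = sqrt (real (Q * p)) * sqrt ((\<Sum>m<p. (l2norm Sq (cdif h (Suc m) j))\<^sup>2) / real p)" for j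
  proof -
    have "(\<Sum>k\<in>?A. (l2norm Sq (cdif h (tr k) j))\<^sup>2) = real Q * (\<Sum>m<p. (l2norm Sq (cdif h (Suc m) j))\<^sup>2)"
      unfolding re trS by (subst grp[of "\<lambda>m i. (l2norm Sq (cdif h (Suc i) j))\<^sup>2"]) simp
    also have "\<dots> = real (Q * p) * ((\<Sum>m<p. (l2norm Sq (cdif h (Suc m) j))\<^sup>2) / real p)" using p by simp
    finally show ?thesis by (simp only: real_sqrt_mult)
  qed
  have "l2norm M (\<lambda>\<omega>. psum h (Q * p) \<omega> - (\<Sum>q<Q. bk h p q \<omega>))
    \<le> (\<Sum>j. sqrt (\<Sum>k\<in>?A. (l2norm Sq (cdif h (tr k) j))\<^sup>2))"
    unfolding 1[symmetric] by (rule l2norm_truncation(2)[OF h]) simp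
  also have "\<dots> = sqrt (real (Q * p)) * err h p"
    unfolding 2 err_def
  proof (cases "Q = 0")
    case False
    have "summable (\<lambda>j. sqrt (\<Sum>k\<in>?A. (l2norm Sq (cdif h (tr k) j))\<^sup>2))"
      by (rule l2norm_truncation(1)[OF h]) simp
    then have "summable (\<lambda>j. sqrt (real (Q * p)) * sqrt ((\<Sum>m<p. (l2norm Sq (cdif h (Suc m) j))\<^sup>2) / real p))"
      unfolding 2 .
    then have "summable (\<lambda>j. sqrt ((\<Sum>m<p. (l2norm Sq (cdif h (Suc m) j))\<^sup>2) / real p))"
      using False p by (subst (asm) summable_cmult_iff) auto
    then show "(\<Sum>j. sqrt (real (Q * p)) * sqrt ((\<Sum>m<p. (l2norm Sq (cdif h (Suc m) j))\<^sup>2) / real p))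
      = sqrt (real (Q * p)) * (\<Sum>j. sqrt ((\<Sum>m<p. (l2norm Sq (cdif h (Suc m) j))\<^sup>2) / real p))"
      by (rule suminf_mult)
  qed simp
  finally show ?thesis .
qed

end


section \<open>From blocks to the limit law\<close>

lemma isCont_std_normal_cdf: "isCont (cdf std_normal_distribution) t"
proof -
  interpret real_distribution std_normal_distribution by (rule real_dist_normal_dist)
  have "emeasure std_normal_distribution {t} = 0"
    by (subst emeasure_density) (auto intro!: AE_lborel_singleton nn_integral_zero' simp: AE_lborel_singleton split: split_indicator elim!: AE_mp[OF AE_lborel_singleton[of t]])
  then show ?thesis unfolding isCont_cdf by (simp add: measure_def)
qed

context linear_process begin

text \<open>With a single block, the approximation bound has a norm on its left side.\<close>

lemma err_nonneg: assumes h: "adm L h" shows "0 \<le> err h p"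
proof (cases "p = 0")
  case False
  have "0 \<le> l2norm M (\<lambda>\<omega>. psum h (1 * p) \<omega> - (\<Sum>q<1. bk h p q \<omega>))" by simp
  also have "\<dots> \<le> sqrt (real (1 * p)) * err h p" by (rule psum_block_error[OF h]) (use False in simp)
  finally show ?thesis using False by (simp add: zero_le_mult_iff)
qed (simp add: err_def)

text \<open>Fewer than \<open>p\<close> terms are left over after the last full block, each bounded
  by 2; they account for the second summand.\<close>

lemma block_approx:
  assumes h: "adm L h" and p: "p > 0" and n: "n > 0"
  shows "l2norm M (\<lambda>\<omega>. psum h n \<omega> / sqrt n - (\<Sum>q<n div p. bk h p q \<omega>) / sqrt n) \<le> err h p + 2 * real p / sqrt n"
proof -
  let ?Q = "n div p"
  let ?R = "\<lambda>\<omega>. \<Sum>m\<in>{?Q * p..<n}. h (Z (int (Suc m)) \<omega>) - mean h"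
  let ?E = "\<lambda>\<omega>. psum h (?Q * p) \<omega> - (\<Sum>q<?Q. bk h p q \<omega>)"
  have Qn: "?Q * p \<le> n" by simp
  have split: "psum h n \<omega> = psum h (?Q * p) \<omega> + ?R \<omega>" for \<omega>
    unfolding psum_def using sum.atLeastLessThan_concat[OF le0 Qn, of "\<lambda>m. h (Z (int (Suc m)) \<omega>) - mean h"]
    by (simp add: atLeast0LessThan)
  have bdR: "bdm M ?R" by (intro bdm_sum bdm_diff bdm_const hZ_bdm[OF h])
  have bdE: "bdm M ?E" by (intro bdm_sum bdm_diff psum_bdm[OF h] bk_bdm[OF h])
  have R: "l2norm M ?R \<le> 2 * real p"
  proof (rule l2norm_le_const[OF bdR])
    fix \<omega>
    have "\<bar>h (Z k \<omega>) - mean h\<bar> \<le> 2" for k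
      using adm_bound[OF h, of 0 "Z k \<omega>"] mean_bound[OF h] by simp
    then have "\<bar>?R \<omega>\<bar> \<le> (\<Sum>m\<in>{?Q * p..<n}. 2)"
      by (intro order_trans[OF sum_abs] sum_mono)
    also have "\<dots> = 2 * real (n mod p)" by (simp add: minus_div_mult_eq_mod of_nat_diff)
    also have "\<dots> \<le> 2 * real p" using p by (simp add: less_imp_le)
    finally show "\<bar>?R \<omega>\<bar> \<le> 2 * real p" .
  qed
  have "l2norm M (\<lambda>\<omega>. ?E \<omega> + ?R \<omega>) \<le> l2norm M ?E + l2norm M ?R"
    by (intro l2norm_triangle bdE bdR)
  also have "\<dots> \<le> sqrt (real (?Q * p)) * err h p + 2 * real p"
    by (intro add_mono psum_block_error[OF h p] R)
  also have "\<dots> \<le> sqrt (real n) * err h p + 2 * real p"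
    using Qn by (intro add_mono mult_right_mono err_nonneg[OF h]) (auto simp del: of_nat_mult)
  finally have le: "l2norm M (\<lambda>\<omega>. ?E \<omega> + ?R \<omega>) \<le> sqrt (real n) * err h p + 2 * real p" .
  have "l2norm M (\<lambda>\<omega>. psum h n \<omega> / sqrt n - (\<Sum>q<n div p. bk h p q \<omega>) / sqrt n)
    = l2norm M (\<lambda>\<omega>. (?E \<omega> + ?R \<omega>) / sqrt n)"
    unfolding split by (simp add: diff_divide_distrib add_divide_distrib algebra_simps)
  also have "\<dots> \<le> (sqrt (real n) * err h p + 2 * real p) / sqrt n"
    using le by (simp add: l2norm_divide divide_right_mono)
  also have "\<dots> = err h p + 2 * real p / sqrt n" using n by (simp add: add_divide_distrib)
  finally show ?thesis .
qed

text \<open>For fixed \<open>p\<close> the blocks obey the classical theorem with their own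
  variance. As \<open>p\<close> grows, the block variances per term settle, since all of them
  approximate the same norms of partial sums; \<open>lower\<close> excludes a degenerate
  limit.\<close>

theorem clt:
  assumes h: "adm L h" and ac: "acont h" and c: "c > 0"
    and lower: "\<And>n. n > 0 \<Longrightarrow> c \<le> l2norm M (psum h n) / sqrt n"
  shows "\<exists>\<sigma>>0. \<forall>t. (\<lambda>n. prob {\<omega> \<in> space M. psum h n \<omega> / sqrt n / \<sigma> \<le> t})
      \<longlonglongrightarrow> cdf std_normal_distribution t"
proof -
  define v where "v n = l2norm M (\<lambda>\<omega>. psum h n \<omega> / sqrt n)" for n
  define s where "s p = l2norm Sq (blk h p)" for p
  define S where "S p n \<omega> = (\<Sum>q<n div p. bk h p q \<omega>)" for p n \<omega>
  have bdS: "bdm M (S p n)" for p n unfolding S_def[abs_def] by (intro bdm_sum bk_bdm[OF h])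
  have nS: "l2norm M (S p n) = sqrt (real (n div p)) * s p" for p n
    unfolding S_def[abs_def] s_def by (rule bk_sum_l2norm[OF h])
  note bdP = psum_bdm[OF h]
  have ratio: "(\<lambda>n. sqrt (real (n div p) / real n) * s p) \<longlonglongrightarrow> s p / sqrt p" if "p > 0" for p
    using tendsto_mult[OF tendsto_real_sqrt[OF div_ratio_tendsto[OF that]] tendsto_const[of "s p"]]
    by (simp add: real_sqrt_divide)
  have small: "(\<lambda>n. e + 2 * real p / sqrt (real n)) \<longlonglongrightarrow> e" for e p
  proof -
    have "(\<lambda>n. e + 2 * real p * inverse (sqrt (real n))) \<longlonglongrightarrow> e + 2 * real p * 0"
      by (intro tendsto_intros tendsto_inverse_0_at_top filterlim_compose[OF sqrt_at_top filterlim_real_sequentially])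
    then show ?thesis by (simp add: divide_inverse)
  qed
  have v_approx: "\<bar>v n - sqrt (real (n div p) / real n) * s p\<bar> \<le> err h p + 2 * real p / sqrt n" if "p > 0" "n > 0" for p n
  proof -
    have "\<bar>v n - l2norm M (\<lambda>\<omega>. S p n \<omega> / sqrt n)\<bar> \<le> l2norm M (\<lambda>\<omega>. psum h n \<omega> / sqrt n - S p n \<omega> / sqrt n)"
      unfolding v_def by (intro l2norm_diff_le bdm_divide bdP bdS)
    also have "\<dots> \<le> err h p + 2 * real p / sqrt n" unfolding S_def by (rule block_approx[OF h that])
    finally show ?thesis by (simp add: l2norm_divide nS real_sqrt_divide)
  qed
  have ev: "\<exists>p>0. err h p < e" if "e > 0" for e
  proof -
    have "\<forall>\<^sub>F p in sequentially. err h p < e" using err_tendsto[OF h ac] that by (rule order_tendstoD)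
    then have "\<forall>\<^sub>F p in sequentially. err h p < e \<and> p > 0" using eventually_gt_at_top[of 0] by eventually_elim simp
    then show ?thesis using eventually_happens'[OF sequentially_bot] by blast
  qed
  \<comment> \<open>For every block length \<open>p\<close>, \<open>v\<close> is eventually within
    about \<open>err h p\<close> of the number \<open>s p / sqrt p\<close>, and
    \<open>err h p\<close> can be made small.\<close>
  have "Cauchy v"
  proof (rule CauchyI')
    fix e :: real assume e: "e > 0"
    obtain p where p: "p > 0" "err h p < e / 4" using ev[of "e / 4"] e by auto
    let ?\<tau> = "s p / sqrt p"
    have "\<forall>\<^sub>F n in sequentially. \<bar>sqrt (real (n div p) / real n) * s p - ?\<tau>\<bar> < e / 4"
      using ratio[OF p(1)] e unfolding tendsto_iff dist_real_def by (meson divide_pos_pos zero_less_numeral)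
    moreover have "\<forall>\<^sub>F n in sequentially. err h p + 2 * real p / sqrt n < e / 4"
      using small p(2) by (rule order_tendstoD)
    ultimately have "\<forall>\<^sub>F n in sequentially. \<bar>v n - ?\<tau>\<bar> < e / 2"
      using eventually_gt_at_top[of 0]
    proof eventually_elim
      case (elim n)
      then show ?case using v_approx[OF p(1), of n] by linarith
    qed
    then obtain N where N: "\<And>n. n \<ge> N \<Longrightarrow> \<bar>v n - ?\<tau>\<bar> < e / 2" by (auto simp: eventually_sequentially)
    have "dist (v m) (v n) < e" if "m \<ge> N" "n > m" for m n
      using N[of m] N[of n] that unfolding dist_real_def by linarith
    then show "\<exists>M. \<forall>m\<ge>M. \<forall>n>m. dist (v m) (v n) < e" by blast
  qed
  then obtain \<sigma> where \<sigma>: "v \<longlonglongrightarrow> \<sigma>" using Cauchy_convergent convergent_def by blast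
  have "c \<le> \<sigma>"
  proof (rule tendsto_lowerbound[OF \<sigma>])
    show "\<forall>\<^sub>F n in sequentially. c \<le> v n"
      using eventually_gt_at_top[of 0]
    proof eventually_elim
      case (elim n)
      then show ?case using lower[of n] by (simp add: v_def l2norm_divide)
    qed
  qed simp
  then have \<sigma>0: "\<sigma> > 0" using c by linarith
  have \<sigma>_approx: "\<bar>\<sigma> - s p / sqrt p\<bar> \<le> err h p" if p: "p > 0" for p
  proof (rule tendsto_le[OF _ small[of "err h p" p]])
    show "(\<lambda>n. \<bar>v n - sqrt (real (n div p) / real n) * s p\<bar>) \<longlonglongrightarrow> \<bar>\<sigma> - s p / sqrt p\<bar>"
      by (intro tendsto_intros \<sigma> ratio p)
    show "\<forall>\<^sub>F n in sequentially. \<bar>v n - sqrt (real (n div p) / real n) * s p\<bar> \<le> err h p + 2 * real p / sqrt n"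
      using eventually_gt_at_top[of 0] by eventually_elim (rule v_approx[OF p])
  qed simp
  have "(\<lambda>n. prob {\<omega> \<in> space M. psum h n \<omega> / sqrt n / \<sigma> \<le> t}) \<longlonglongrightarrow> cdf std_normal_distribution t" for t
  proof (rule cdf_tendsto_l2_approx)
    show "bdm M (\<lambda>\<omega>. psum h n \<omega> / sqrt n / \<sigma>)" for n by (intro bdm_divide bdP)
    show "isCont (cdf std_normal_distribution) t" by (rule isCont_std_normal_cdf)
    fix \<delta> :: real assume \<delta>: "\<delta> > 0"
    \<comment> \<open>The bound \<open>\<sigma> / 2\<close> forces \<open>s p > 0\<close>, which the
      classical theorem requires; the bound \<open>\<delta> * \<sigma> / 4\<close> leaves room for
      two errors of size at most \<open>e\<close>.\<close>
    define e where "e = min (\<delta> * \<sigma> / 4) (\<sigma> / 2)"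
    have e: "e > 0" "e \<le> \<delta> * \<sigma> / 4" "e \<le> \<sigma> / 2" using \<delta> \<sigma>0 by (auto simp: e_def)
    obtain p where p: "p > 0" "err h p < e" using ev[OF e(1)] by auto
    have "s p / sqrt p > 0" using \<sigma>_approx[OF p(1)] p(2) e \<sigma>0 by linarith
    then have sp: "s p > 0" using p(1) by (simp add: zero_less_divide_iff)
    define N where "N n \<omega> = S p n \<omega> / sqrt (real (n div p) * (s p)\<^sup>2)" for n \<omega>
    have bdN: "bdm M (N n)" for n unfolding N_def[abs_def] by (intro bdm_divide bdS)
    have "weak_conv_m (\<lambda>Q. distr M borel (\<lambda>\<omega>. (\<Sum>q<Q. bk h p q \<omega>) / sqrt (real Q * (s p)\<^sup>2))) std_normal_distribution"
    proof (rule central_limit_theorem_zero_mean[OF bk_indep[OF h] bk_mean[OF h] sp])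
      show "integrable M (\<lambda>\<omega>. (bk h p q \<omega>)\<^sup>2)" for q by (intro bdm_integrable bdm_power2 bk_bdm[OF h])
      show "variance (bk h p q) = (s p)\<^sup>2" for q
        unfolding bk_mean[OF h] using l2norm_pst[OF blk_bdm[OF h], of p "int (Suc q * p)"]
        by (simp add: s_def l2norm_sq[symmetric])
      show "distr M borel (bk h p q) = distr Sq borel (blk h p)" for q by (rule bk_distr[OF h])
    qed
    then have cl: "(\<lambda>Q. prob {\<omega> \<in> space M. (\<Sum>q<Q. bk h p q \<omega>) / sqrt (real Q * (s p)\<^sup>2) \<le> t}) \<longlonglongrightarrow> cdf std_normal_distribution t" for t
    proof -
      assume "weak_conv_m (\<lambda>Q. distr M borel (\<lambda>\<omega>. (\<Sum>q<Q. bk h p q \<omega>) / sqrt (real Q * (s p)\<^sup>2))) std_normal_distribution"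
      then have "(\<lambda>Q. cdf (distr M borel (\<lambda>\<omega>. (\<Sum>q<Q. bk h p q \<omega>) / sqrt (real Q * (s p)\<^sup>2))) t) \<longlonglongrightarrow> cdf std_normal_distribution t"
        unfolding weak_conv_m_def weak_conv_def using isCont_std_normal_cdf by blast
      moreover have "cdf (distr M borel (\<lambda>\<omega>. (\<Sum>q<Q. bk h p q \<omega>) / sqrt (real Q * (s p)\<^sup>2))) t
         = prob {\<omega> \<in> space M. (\<Sum>q<Q. bk h p q \<omega>) / sqrt (real Q * (s p)\<^sup>2) \<le> t}" for Q
      proof -
        note [measurable] = bdm_measurable[OF blk_bdm[OF h, of p]]
        show ?thesis unfolding cdf_def
          by (subst measure_distr) (auto intro!: arg_cong[where f=prob])
      qed
      ultimately show ?thesis by simp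
    qed
    have Nconv: "(\<lambda>n. prob {\<omega> \<in> space M. N n \<omega> \<le> t}) \<longlonglongrightarrow> cdf std_normal_distribution t" for t
      unfolding N_def S_def using filterlim_compose[OF cl filterlim_div_at_top[OF p(1)]] .
    have "(\<lambda>n. (err h p + 2 * real p / sqrt n) + \<bar>sqrt (real (n div p) / real n) * s p - \<sigma>\<bar>) \<longlonglongrightarrow> err h p + \<bar>s p / sqrt p - \<sigma>\<bar>"
      by (intro tendsto_intros small ratio p)
    moreover have "err h p + \<bar>s p / sqrt p - \<sigma>\<bar> < \<delta> * \<sigma>"
      using \<sigma>_approx[OF p(1)] p(2) e \<sigma>0 \<delta> by (simp add: abs_minus_commute)
    ultimately have "\<forall>\<^sub>F n in sequentially. (err h p + 2 * real p / sqrt n) + \<bar>sqrt (real (n div p) / real n) * s p - \<sigma>\<bar> < \<delta> * \<sigma>"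
      by (rule order_tendstoD)
    then have close: "\<forall>\<^sub>F n in sequentially. l2norm M (\<lambda>\<omega>. psum h n \<omega> / sqrt n / \<sigma> - N n \<omega>) \<le> \<delta>"
      using eventually_ge_at_top[of p]
    proof eventually_elim
      case (elim n)
      have n: "n > 0" "n div p > 0" using elim(2) p(1) by (auto simp: div_greater_zero_iff)
      have Nn: "l2norm M (N n) = 1"
        unfolding N_def[abs_def] l2norm_divide nS using n sp by (simp add: real_sqrt_mult)
      have SN: "S p n \<omega> / sqrt n = sqrt (real (n div p) / real n) * s p * N n \<omega>" for \<omega>
        unfolding N_def using n sp by (simp add: real_sqrt_mult real_sqrt_divide)
      have "l2norm M (\<lambda>\<omega>. psum h n \<omega> / sqrt n - \<sigma> * N n \<omega>)
        \<le> l2norm M (\<lambda>\<omega>. psum h n \<omega> / sqrt n - S p n \<omega> / sqrt n) + l2norm M (\<lambda>\<omega>. S p n \<omega> / sqrt n - \<sigma> * N n \<omega>)"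
        by (intro l2norm_triangle3 bdm_divide bdP bdS bdm_mult bdm_const bdN)
      also have "l2norm M (\<lambda>\<omega>. psum h n \<omega> / sqrt n - S p n \<omega> / sqrt n) \<le> err h p + 2 * real p / sqrt n"
        unfolding S_def by (rule block_approx[OF h p(1) n(1)])
      also have "l2norm M (\<lambda>\<omega>. S p n \<omega> / sqrt n - \<sigma> * N n \<omega>) = \<bar>sqrt (real (n div p) / real n) * s p - \<sigma>\<bar>"
        unfolding SN left_diff_distrib[symmetric] l2norm_cmult Nn by simp
      finally have "l2norm M (\<lambda>\<omega>. psum h n \<omega> / sqrt n - \<sigma> * N n \<omega>) \<le> \<delta> * \<sigma>" using elim(1) by linarith
      moreover have "l2norm M (\<lambda>\<omega>. psum h n \<omega> / sqrt n / \<sigma> - N n \<omega>) = l2norm M (\<lambda>\<omega>. (psum h n \<omega> / sqrt n - \<sigma> * N n \<omega>) / \<sigma>)"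
        using \<sigma>0 by (simp add: diff_divide_distrib)
      ultimately show ?case using \<sigma>0 by (simp only: l2norm_divide) (simp add: pos_divide_le_eq)
    qed
    show "\<exists>N. (\<forall>n. bdm M (N n)) \<and>
        (\<forall>t. (\<lambda>n. prob {\<omega> \<in> space M. N n \<omega> \<le> t}) \<longlonglongrightarrow> cdf std_normal_distribution t) \<and>
        (\<forall>\<^sub>F n in sequentially. l2norm M (\<lambda>\<omega>. psum h n \<omega> / sqrt n / \<sigma> - N n \<omega>) \<le> \<delta>)"
      using bdN Nconv close by blast
  qed
  then show ?thesis using \<sigma>0 by blast
qed

end

subsection \<open>Smoothness of the marginal distribution\<close>


context linear_process begin

sublocale mu: real_distribution mu
  by unfold_locales (auto simp: mu.emeasure_space_1)

lemma measure_mu_bounds: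
  assumes st: "s \<le> t" and l: "0 \<le> l" and f: "\<And>y. s < y \<Longrightarrow> y \<le> t \<Longrightarrow> l \<le> f0 y \<and> f0 y \<le> u"
  shows "l * (t - s) \<le> measure mu {s<..t}" "measure mu {s<..t} \<le> u * (t - s)"
proof -
  have em: "emeasure mu {s<..t} = (\<integral>\<^sup>+y. ennreal (f0 y) * indicator {s<..t} y \<partial>lborel)"
    unfolding mu_density by (subst emeasure_density) auto
  have "ennreal l * emeasure lborel {s<..t} = (\<integral>\<^sup>+y. ennreal l * indicator {s<..t} y \<partial>lborel)"
    by (simp add: nn_integral_cmult_indicator)
  also have "\<dots> \<le> emeasure mu {s<..t}" unfolding em
    using f by (intro nn_integral_mono) (auto split: split_indicator intro: ennreal_leI)
  finally have "ennreal (l * (t - s)) \<le> ennreal (measure mu {s<..t})"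
    using st l by (simp add: ennreal_mult' mu.emeasure_eq_measure)
  then show "l * (t - s) \<le> measure mu {s<..t}" by simp
  show "measure mu {s<..t} \<le> u * (t - s)"
  proof (cases "s = t")
    case False
    have u: "0 \<le> u" using f[of t] st False f0_nonneg[of t] by force
    have "emeasure mu {s<..t} \<le> (\<integral>\<^sup>+y. ennreal u * indicator {s<..t} y \<partial>lborel)" unfolding em
      using f by (intro nn_integral_mono) (auto split: split_indicator intro: ennreal_leI)
    also have "\<dots> = ennreal u * emeasure lborel {s<..t}" by (simp add: nn_integral_cmult_indicator)
    finally have "ennreal (measure mu {s<..t}) \<le> ennreal (u * (t - s))"
      using st u by (simp add: ennreal_mult' mu.emeasure_eq_measure)
    then show ?thesis using st u by (subst (asm) ennreal_le_iff) auto
  qed simp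
qed

lemma cdf_mu_bounds:
  assumes st: "s \<le> t" and l: "0 \<le> l" and f: "\<And>y. s < y \<Longrightarrow> y \<le> t \<Longrightarrow> l \<le> f0 y \<and> f0 y \<le> u"
  shows "l * (t - s) \<le> cdf mu t - cdf mu s" "cdf mu t - cdf mu s \<le> u * (t - s)"
  using measure_mu_bounds[OF assms] st mu.cdf_diff_eq[of s t] by (cases "s = t"; auto)+

lemma cdf_mu_lip: "\<bar>cdf mu s - cdf mu t\<bar> \<le> K * \<bar>s - t\<bar>"
proof -
  have *: "\<bar>cdf mu t - cdf mu s\<bar> \<le> K * (t - s)" if "s \<le> t" for s t
    using cdf_mu_bounds(2)[OF that order_refl, of K] mu.cdf_nondecreasing[OF that] f0_nonneg f0_le by auto
  show ?thesis using *[of s t] *[of t s] by (cases "s \<le> t") (auto simp: abs_minus_commute)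
qed

lemma cdf_mu_deriv: "(cdf mu has_real_derivative f0 s) (at s)"
  unfolding has_field_derivative_iff
proof (rule LIM_I)
  fix r :: real assume r: "r > 0"
  have "isCont f0 s" using f0_cont by (simp add: continuous_on_eq_continuous_at)
  then obtain d where d: "d > 0" "\<And>y. \<bar>y - s\<bar> < d \<Longrightarrow> \<bar>f0 y - f0 s\<bar> < r / 2"
    using r unfolding continuous_at_eps_delta dist_real_def by (metis half_gt_zero)
  have main: "\<bar>(cdf mu v - cdf mu u) - f0 s * (v - u)\<bar> \<le> r / 2 * (v - u)"
    if "u \<le> v" "s - d < u" "v < s + d" for u v
  proof -
    \<comment> \<open>The maximum with 0 meets the requirement of \<open>cdf_mu_bounds\<close> that
      the lower density bound be nonnegative.\<close>
    have b: "max 0 (f0 s - r / 2) \<le> f0 y \<and> f0 y \<le> f0 s + r / 2" if "u < y" "y \<le> v" for y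
    proof -
      have "\<bar>y - s\<bar> < d" using that \<open>s - d < u\<close> \<open>v < s + d\<close> by (simp add: abs_less_iff)
      then have "\<bar>f0 y - f0 s\<bar> < r / 2" by (rule d(2))
      then show ?thesis using f0_nonneg[of y] unfolding abs_less_iff max.bounded_iff by linarith
    qed
    have "max 0 (f0 s - r / 2) * (v - u) \<le> cdf mu v - cdf mu u"
      "cdf mu v - cdf mu u \<le> (f0 s + r / 2) * (v - u)"
      by (intro cdf_mu_bounds(1)[OF \<open>u \<le> v\<close> _ b] cdf_mu_bounds(2)[OF \<open>u \<le> v\<close> _ b]; simp)+
    moreover have "(f0 s - r / 2) * (v - u) \<le> max 0 (f0 s - r / 2) * (v - u)"
      using that by (intro mult_right_mono) auto
    ultimately have "(f0 s - r / 2) * (v - u) \<le> cdf mu v - cdf mu u"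
      "cdf mu v - cdf mu u \<le> (f0 s + r / 2) * (v - u)" by linarith+
    then show ?thesis unfolding abs_le_iff left_diff_distrib[of "f0 s"] distrib_right[of "f0 s"] by linarith
  qed
  show "\<exists>e>0. \<forall>y. y \<noteq> s \<and> norm (y - s) < e \<longrightarrow> norm ((cdf mu y - cdf mu s) / (y - s) - f0 s) < r"
  proof (intro exI conjI allI impI)
    fix y assume y: "y \<noteq> s \<and> norm (y - s) < d"
    have "\<bar>(cdf mu y - cdf mu s) - f0 s * (y - s)\<bar> \<le> r / 2 * \<bar>y - s\<bar>"
    proof (cases "s \<le> y")
      case True
      then show ?thesis using main[of s y] y d(1) by auto
    next
      case False
      then show ?thesis using main[of y s] y d(1) by (auto simp: abs_if algebra_simps split: if_splits)
    qed
    moreover have "(cdf mu y - cdf mu s) / (y - s) - f0 s = ((cdf mu y - cdf mu s) - f0 s * (y - s)) / (y - s)"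
      using y by (simp add: field_simps)
    moreover have "r / 2 * \<bar>y - s\<bar> < r * \<bar>y - s\<bar>" using r y by simp
    ultimately show "norm ((cdf mu y - cdf mu s) / (y - s) - f0 s) < r"
      using y by (simp add: abs_divide divide_less_eq)
  qed (rule d(1))
qed

text \<open>Using \<open>-1\<close> instead of \<open>1\<close> on \<open>{..x}\<close> turns \<open>count \<ge> n F x\<close> into an upper bound on the
  partial sums, which matches the form of the central limit theorem.\<close>
definition nst :: "real \<Rightarrow> real \<Rightarrow> real" where
  "nst x y = (if y \<le> x then -1 else 0)"

lemma nst_measurable [measurable]: "nst x \<in> borel_measurable borel"
  unfolding nst_def[abs_def] by measurable

text \<open>Because \<open>a 0 = 1\<close>, averaging the half line over the newest innovation
  reproduces the distribution function of \<open>mu\<close>, which is Lipschitz as the density is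
  bounded.\<close>

lemma avg_nst: "avg (nst x) 1 y = - cdf mu (x - y)"
proof -
  have "avg (nst x) 1 y = (\<integral>e. - indicator {..x - y} e \<partial>mu)"
    unfolding One_nat_def avg.simps a_0 by (intro Bochner_Integration.integral_cong) (auto simp: nst_def)
  also have "\<dots> = - cdf mu (x - y)" by (simp add: cdf_def)
  finally show ?thesis .
qed

lemma adm_nst: "adm K (nst x)"
  unfolding adm_def lip_def avg_nst using cdf_mu_lip[of "x - _" "x - _"] K_nonneg
  by (auto simp: nst_def abs_minus_commute)

lemma avg_nst_diff: "avg (\<lambda>y. nst x y - nst x' y) 1 y = cdf mu (x' - y) - cdf mu (x - y)"
proof -
  have "avg (\<lambda>y. nst x y - nst x' y) 1 y = (\<integral>e. nst x (e + y) - nst x' (e + y) \<partial>mu)"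
    by (simp add: a_0)
  also have "\<dots> = avg (nst x) 1 y - avg (nst x') 1 y"
    unfolding One_nat_def avg.simps a_0
    by (subst Bochner_Integration.integral_diff)
       (auto intro!: mu.bdm_integrable bdmI[where B=1] simp: nst_def[abs_def])
  finally show ?thesis by (simp only: avg_nst)
qed

text \<open>The constant does not depend on the thresholds, so one majorant
  \<open>wt (2 * K)\<close> serves a whole sequence of moving thresholds.\<close>

lemma adm_nst_diff: "adm (2 * K) (\<lambda>y. nst x y - nst x' y)"
  unfolding adm_def lip_def avg_nst_diff
proof (intro conjI allI)
  show "0 \<le> 2 * K" using K_nonneg by simp
  show "\<bar>nst x y - nst x' y\<bar> \<le> 1" for y by (auto simp: nst_def)
  show "\<bar>cdf mu (x' - y) - cdf mu (x - y) - (cdf mu (x' - y') - cdf mu (x - y'))\<bar> \<le> 2 * K * \<bar>y - y'\<bar>" for y y'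
    using cdf_mu_lip[of "x - y" "x - y'"] cdf_mu_lip[of "x' - y" "x' - y'"] by (auto simp: abs_minus_commute)
qed measurable

text \<open>The marginal distribution function with the newest innovation integrated out; in this
  form it can be differentiated under the integral.\<close>

definition FZ :: "real \<Rightarrow> real" where
  "FZ z = (\<integral>w. cdf mu (z - tail a 1 w) \<partial>Sq)"

lemma cdf_mu_measurable [measurable]: "cdf mu \<in> borel_measurable borel"
proof (rule borel_measurable_continuous_onI)
  show "continuous_on UNIV (cdf mu)"
    using cdf_mu_deriv by (meson DERIV_isCont continuous_at_imp_continuous_on)
qed

lemma cdf_mu_bdm: "u \<in> borel_measurable N \<Longrightarrow> bdm N (\<lambda>x. cdf mu (u x))"
  using mu.cdf_nonneg mu.cdf_bounded_prob by (intro bdmI[where B=1]) auto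

lemma mean_nst: "mean (nst z) = - FZ z"
proof -
  have "mean (nst z) = (\<integral>\<omega>. avg (nst z) 1 (tail a 1 (pst (0 - int 1) \<omega>)) \<partial>M)"
    by (rule expectation_avg_tail[OF adm_nst, symmetric])
  also have "\<dots> = - (\<integral>\<omega>. cdf mu (z - tail a 1 (pst (0 - int 1) \<omega>)) \<partial>M)"
    unfolding avg_nst by simp
  also have "\<dots> = - FZ z" unfolding FZ_def by (subst expectation_pst[of "\<lambda>w. cdf mu (z - tail a 1 w)"]) auto
  finally show ?thesis .
qed

lemma FZ_eq_prob: "FZ z = prob {\<omega> \<in> space M. Z k \<omega> \<le> z}"
proof -
  have "- FZ z = (\<integral>\<omega>. nst z (Z k \<omega>) \<partial>M)" by (simp add: mean_nst expectation_Z)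
  also have "\<dots> = (\<integral>\<omega>. - indicator {\<omega> \<in> space M. Z k \<omega> \<le> z} \<omega> \<partial>M)"
    by (intro Bochner_Integration.integral_cong) (auto simp: nst_def)
  also have "\<dots> = - prob {\<omega> \<in> space M. Z k \<omega> \<le> z}" by simp
  finally show ?thesis by simp
qed

lemma FZ_lip: "\<bar>FZ y - FZ z\<bar> \<le> K * \<bar>y - z\<bar>"
proof -
  have i: "integrable Sq (\<lambda>w. cdf mu (y - tail a 1 w))" for y by (intro Sq.bdm_integrable cdf_mu_bdm) measurable
  have "\<bar>FZ y - FZ z\<bar> = \<bar>\<integral>w. cdf mu (y - tail a 1 w) - cdf mu (z - tail a 1 w) \<partial>Sq\<bar>"
    unfolding FZ_def by (subst Bochner_Integration.integral_diff[OF i i]) (rule refl)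
  also have "\<dots> \<le> (\<integral>w. \<bar>cdf mu (y - tail a 1 w) - cdf mu (z - tail a 1 w)\<bar> \<partial>Sq)"
    by (rule integral_abs_bound)
  also have "\<dots> \<le> (\<integral>w. K * \<bar>y - z\<bar> \<partial>Sq)"
  proof (intro integral_mono integrable_abs Bochner_Integration.integrable_diff i)
    show "\<bar>cdf mu (y - tail a 1 w) - cdf mu (z - tail a 1 w)\<bar> \<le> K * \<bar>y - z\<bar>" for w
      using cdf_mu_lip[of "y - tail a 1 w" "z - tail a 1 w"] by simp
  qed simp
  finally show ?thesis using Sq.prob_space by simp
qed

text \<open>The version of the marginal density that is the derivative of \<open>FZ\<close> at every
  point, whereas a density is otherwise given only up to null sets.\<close>

definition fZ :: "real \<Rightarrow> real" where
  "fZ z = (\<integral>w. f0 (z - tail a 1 w) \<partial>Sq)"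

lemma FZ_deriv: "(FZ has_real_derivative fZ x) (at x)"
  unfolding DERIV_def
proof (subst tendsto_at_iff_sequentially, intro allI impI)
  fix X :: "nat \<Rightarrow> real" assume X: "\<forall>i. X i \<in> UNIV - {0}" "X \<longlonglongrightarrow> 0"
  have i: "integrable Sq (\<lambda>w. cdf mu (y - tail a 1 w))" for y by (intro Sq.bdm_integrable cdf_mu_bdm) measurable
  have "(\<lambda>n. \<integral>w. (cdf mu (x + X n - tail a 1 w) - cdf mu (x - tail a 1 w)) / X n \<partial>Sq) \<longlonglongrightarrow> fZ x"
    unfolding fZ_def
  proof (rule integral_dominated_convergence[where w="\<lambda>_. K"])
    show "AE w in Sq. (\<lambda>n. (cdf mu (x + X n - tail a 1 w) - cdf mu (x - tail a 1 w)) / X n) \<longlonglongrightarrow> f0 (x - tail a 1 w)"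
    proof (rule AE_I2)
      fix w
      have "((\<lambda>h. (cdf mu (x - tail a 1 w + h) - cdf mu (x - tail a 1 w)) / h) \<longlongrightarrow> f0 (x - tail a 1 w)) (at 0)"
        using cdf_mu_deriv unfolding DERIV_def by blast
      then have "((\<lambda>h. (cdf mu (x - tail a 1 w + h) - cdf mu (x - tail a 1 w)) / h) \<circ> X) \<longlonglongrightarrow> f0 (x - tail a 1 w)"
        using X by (subst (asm) tendsto_at_iff_sequentially) blast
      then show "(\<lambda>n. (cdf mu (x + X n - tail a 1 w) - cdf mu (x - tail a 1 w)) / X n) \<longlonglongrightarrow> f0 (x - tail a 1 w)"
        by (simp add: comp_def algebra_simps)
    qed
    show "AE w in Sq. norm ((cdf mu (x + X n - tail a 1 w) - cdf mu (x - tail a 1 w)) / X n) \<le> K" for n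
    proof (rule AE_I2)
      fix w
      show "norm ((cdf mu (x + X n - tail a 1 w) - cdf mu (x - tail a 1 w)) / X n) \<le> K"
        using X(1) cdf_mu_lip[of "x + X n - tail a 1 w" "x - tail a 1 w"]
        by (simp add: abs_divide divide_le_eq)
    qed
  qed auto
  moreover have eq: "(\<integral>w. (cdf mu (x + X n - tail a 1 w) - cdf mu (x - tail a 1 w)) / X n \<partial>Sq) = (FZ (x + X n) - FZ x) / X n" for n
    unfolding FZ_def by (simp only: integral_divide_zero Bochner_Integration.integral_diff[OF i i])
  ultimately show "((\<lambda>h. (FZ (x + h) - FZ x) / h) \<circ> X) \<longlonglongrightarrow> fZ x"
    by (simp only: comp_def)
qed

text \<open>The only discontinuity is at \<open>x\<close>, where \<open>Z 0\<close> has no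
  atom.\<close>

lemma acont_nst: "acont (nst x)"
proof -
  \<comment> \<open>The indicator of the point \<open>x\<close> is itself admissible with Lipschitz
    constant 0, because its first average vanishes; its mean can thus be computed after
    averaging.\<close>
  define h :: "real \<Rightarrow> real" where "h = indicator {x}"
  have av: "avg h 1 y = 0" for y
  proof -
    have "avg h 1 y = (\<integral>e. indicator {x - y} e \<partial>mu)"
      unfolding One_nat_def avg.simps a_0 h_def by (intro Bochner_Integration.integral_cong) (auto split: split_indicator)
    also have "\<dots> = measure mu {x - y}" by simp
    also have "\<dots> = 0" using mu.isCont_cdf DERIV_isCont[OF cdf_mu_deriv] by blast
    finally show ?thesis .
  qed
  have h: "adm 0 h" unfolding adm_def lip_def av by (auto simp: h_def split: split_indicator)
  have "mean h = 0" using expectation_avg_tail[OF h, of 1 0] unfolding av by simp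
  then have "(\<integral>\<omega>. h (Z 0 \<omega>) \<partial>M) = 0" using expectation_Z[of h 0] by (simp add: h_def)
  then have "AE \<omega> in M. h (Z 0 \<omega>) = 0"
    using hZ_bdm[OF h] by (subst (asm) integral_nonneg_eq_0_iff_AE) (auto simp: h_def intro: bdm_integrable)
  then show ?thesis unfolding acont_def
  proof eventually_elim
    case (elim \<omega>)
    then have ne: "Z 0 \<omega> \<noteq> x" by (auto simp: h_def)
    show "isCont (nst x) (Z 0 \<omega>)"
    proof (cases "Z 0 \<omega> < x")
      case True
      have "\<forall>\<^sub>F y in nhds (Z 0 \<omega>). nst x y = -1"
        using eventually_nhds_in_open[of "{..<x}" "Z 0 \<omega>"] True
        by (auto simp: nst_def elim!: eventually_mono)
      then show ?thesis using isCont_cong[of "nst x" "\<lambda>_. -1"] by simp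
    next
      case False
      then have "x < Z 0 \<omega>" using ne by simp
      then have "\<forall>\<^sub>F y in nhds (Z 0 \<omega>). nst x y = 0"
        using eventually_nhds_in_open[of "{x<..}" "Z 0 \<omega>"]
        by (auto simp: nst_def elim!: eventually_mono)
      then show ?thesis using isCont_cong[of "nst x" "\<lambda>_. 0"] by simp
    qed
  qed
qed

end

subsection \<open>Positivity of the limit variance\<close>


context linear_process begin

text \<open>As \<rho> <= 1, powers dominate absolute values below 1. The sum will control the
  Lipschitz part of the projections in the newest innovation.\<close>

lemma a_abs_summable: "summable (\<lambda>i. \<bar>a i\<bar>)"
proof (rule summable_comparison_test_ev[OF _ a_summable])
  have "\<forall>\<^sub>F i in sequentially. \<bar>a i\<bar> powr \<rho> < 1"
    using summable_LIMSEQ_zero[OF a_summable] by (rule order_tendstoD) simp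
  then show "\<forall>\<^sub>F i in sequentially. norm \<bar>a i\<bar> \<le> \<bar>a i\<bar> powr \<rho>"
  proof eventually_elim
    case (elim i)
    then have "\<bar>a i\<bar> \<le> 1" using ge_one_powr_ge_zero[of "\<bar>a i\<bar>" \<rho>] rho by fastforce
    then have "\<bar>a i\<bar> powr 1 \<le> \<bar>a i\<bar> powr \<rho>" using rho by (intro powr_mono') auto
    then show ?case by simp
  qed
qed

text \<open>All that a single innovation contributes to a partial sum through lags below
  \<open>N\<close>.\<close>

definition dsum :: "(real \<Rightarrow> real) \<Rightarrow> nat \<Rightarrow> (nat \<Rightarrow> real) \<Rightarrow> real" where
  "dsum h N w = (\<Sum>j<N. dif h a j w)"

lemma dsum_mdiff: "adm L h \<Longrightarrow> mdiff (dsum h N)"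
  unfolding dsum_def[abs_def] by (intro mdiff_sum dif_mdiff)

text \<open>Regrouping by innovations instead of summands: the innovation at time
  \<open>Suc i\<close> reaches the \<open>n - i\<close> terms from there up to \<open>n\<close>, and
  all innovations up to time 0 are lumped into one remainder.\<close>

lemma psum_decomp:
  assumes h: "adm L h"
  shows "AE \<omega> in M. psum h n \<omega> = (\<Sum>i<n. dsum h (n - i) (pst (int (Suc i)) \<omega>))
     + (\<Sum>m<n. avg h (Suc m) (tail a (Suc m) (pst 0 \<omega>)) - mean h)"
  using Z_sums_all
proof eventually_elim
  case (elim \<omega>)
  have eq: "h (Z (int (Suc m)) \<omega>) - mean h = (\<Sum>j\<le>m. dif h a j (pst (int (Suc (m - j))) \<omega>))
      + (avg h (Suc m) (tail a (Suc m) (pst 0 \<omega>)) - mean h)" for m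
  proof -
    have "h (Z (int (Suc m)) \<omega>) = (\<Sum>j<Suc m. dif h a j (pst (int (Suc m) - int j) \<omega>))
       + avg h (Suc m) (tail a (Suc m) (pst (int (Suc m) - int (Suc m)) \<omega>))"
      using elim by (intro telescope) blast
    moreover have "(\<Sum>j<Suc m. dif h a j (pst (int (Suc m) - int j) \<omega>)) = (\<Sum>j\<le>m. dif h a j (pst (int (Suc (m - j))) \<omega>))"
      unfolding lessThan_Suc_atMost by (intro sum.cong refl) (auto simp: of_nat_diff algebra_simps)
    ultimately show ?thesis by (simp del: avg.simps)
  qed
  have "(\<Sum>m<n. \<Sum>j\<le>m. dif h a j (pst (int (Suc (m - j))) \<omega>))
     = (\<Sum>(j, i)\<in>{(j, i). j + i < n}. dif h a j (pst (int (Suc i)) \<omega>))"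
    by (rule sum.triangle_reindex[symmetric])
  also have "\<dots> = (\<Sum>(i, j)\<in>Sigma {..<n} (\<lambda>i. {..<n - i}). dif h a j (pst (int (Suc i)) \<omega>))"
    by (rule sum.reindex_bij_witness[where i="\<lambda>(i, j). (j, i)" and j="\<lambda>(j, i). (i, j)"]) auto
  also have "\<dots> = (\<Sum>i<n. \<Sum>j<n - i. dif h a j (pst (int (Suc i)) \<omega>))"
    by (subst sum.Sigma) auto
  finally show ?case unfolding psum_def eq sum.distrib dsum_def by simp
qed

lemma psum_l2norm_ge:
  assumes h: "adm L h" and c: "\<And>N. N > 0 \<Longrightarrow> c \<le> (l2norm Sq (dsum h N))\<^sup>2"
  shows "real n * c \<le> (l2norm M (psum h n))\<^sup>2"
proof -
  \<comment> \<open>Index 0 holds the remainder from the past. It need not be a martingale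
    difference, but it is orthogonal to all later terms and is dropped in the lower bound.\<close>
  define F where "F i = (case i of 0 \<Rightarrow> (\<lambda>w. \<Sum>m<n. avg h (Suc m) (tail a (Suc m) w) - mean h)
     | Suc i \<Rightarrow> dsum h (n - i))" for i
  have bdF: "bdm Sq (F i)" for i
    unfolding F_def
    by (auto split: nat.split simp del: avg.simps intro!: bdm_sum bdm_diff adm_bdm[OF h] mdiff_bdm[OF dsum_mdiff[OF h]])
  have orth: "(\<integral>\<omega>. F i (pst (int i) \<omega>) * F j (pst (int j) \<omega>) \<partial>M) = 0" if ji: "j < i" for i j
  proof -
    obtain i' where "i = Suc i'" using ji by (cases i) auto
    then have "mdiff (F i)" using dsum_mdiff[OF h] by (simp add: F_def)
    then show ?thesis using bdF ji by (intro mdiff_orthogonal) auto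
  qed
  have bdFp: "bdm M (\<lambda>\<omega>. F i (pst (int i) \<omega>))" for i by (rule bdm_pst[OF bdF])
  have "AE \<omega> in M. psum h n \<omega> = (\<Sum>i\<in>{..n}. F i (pst (int i) \<omega>))"
    using psum_decomp[OF h, of n]
  proof eventually_elim
    case (elim \<omega>)
    have "(\<Sum>i\<in>{..n}. F i (pst (int i) \<omega>)) = F 0 (pst 0 \<omega>) + (\<Sum>i<n. F (Suc i) (pst (int (Suc i)) \<omega>))"
      by (simp only: lessThan_Suc_atMost[symmetric] sum.lessThan_Suc_shift of_nat_0)
    then show ?case using elim by (simp add: F_def del: avg.simps)
  qed
  then have "(l2norm M (psum h n))\<^sup>2 = (l2norm M (\<lambda>\<omega>. \<Sum>i\<in>{..n}. F i (pst (int i) \<omega>)))\<^sup>2"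
    by (subst l2norm_cong_AE[OF psum_bdm[OF h] bdm_sum[OF bdFp]]) auto
  also have "\<dots> = (\<Sum>i\<in>{..n}. (l2norm M (\<lambda>\<omega>. F i (pst (int i) \<omega>)))\<^sup>2)"
  proof (rule l2norm_sum_orthogonal)
    fix i j :: nat assume "i \<noteq> j"
    then show "(\<integral>\<omega>. F i (pst (int i) \<omega>) * F j (pst (int j) \<omega>) \<partial>M) = 0"
      using orth[of i j] orth[of j i] by (cases "i < j") (auto simp: mult.commute)
  qed (auto intro: bdFp)
  also have "\<dots> = (\<Sum>i\<in>{..n}. (l2norm Sq (F i))\<^sup>2)" by (simp only: l2norm_pst[OF bdF])
  also have "\<dots> = (l2norm Sq (F 0))\<^sup>2 + (\<Sum>i<n. (l2norm Sq (F (Suc i)))\<^sup>2)"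
    by (simp only: lessThan_Suc_atMost[symmetric] sum.lessThan_Suc_shift)
  also have "\<dots> \<ge> (\<Sum>i<n. (l2norm Sq (F (Suc i)))\<^sup>2)" by simp
  also have "(\<Sum>i<n. (l2norm Sq (F (Suc i)))\<^sup>2) \<ge> (\<Sum>i<n. c)"
    by (intro sum_mono) (auto simp: F_def intro: c)
  finally show ?thesis by simp
qed

text \<open>As a function of the newest innovation, the sum of the projections is a jump of height 1
  at \<open>x - tail a 1 w\<close> plus a Lipschitz function. It is therefore bounded away from 0
  on one of the two sides of the jump.\<close>
lemma dsum_nst_ge:
  assumes N: "N > 0" and \<delta>: "0 < \<delta>" "4 * \<delta> * (K * (\<Sum>i. \<bar>a i\<bar>)) \<le> 1"
  shows "(\<integral>e. (dsum (nst x) N (case_nat e w))\<^sup>2 \<partial>mu)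
     \<ge> min (cdf mu (x - tail a 1 w) - cdf mu (x - tail a 1 w - \<delta>))
           (cdf mu (x - tail a 1 w + \<delta>) - cdf mu (x - tail a 1 w)) / 16"
proof -
  define s where "s = x - tail a 1 w"
  define \<psi> where "\<psi> e = dsum (nst x) N (case_nat e w)" for e
  note ad = adm_nst[of x]
  have bd: "bdm mu (\<lambda>e. (\<psi> e)\<^sup>2)"
    unfolding \<psi>_def by (intro bdm_power2 mdiff_bdm_iter mdiff_bdm dsum_mdiff[OF ad])
  \<comment> \<open>The points are less than \<open>2 * \<delta>\<close> apart, so the Lipschitz
    part changes by at most 1 / 2, half the height of the jump.\<close>
  have jump: "\<bar>\<psi> e1 - \<psi> e2\<bar> \<ge> 1 / 2" if "s - \<delta> < e1" "e1 \<le> s" "s < e2" "e2 \<le> s + \<delta>" for e1 e2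
  proof -
    obtain N' where N': "N = Suc N'" using N by (cases N) auto
    let ?t = "\<lambda>j. tail a (Suc j) w"
    have ex: "\<psi> e = (nst x (e + tail a 1 w) + (\<Sum>j<N'. avg (nst x) (Suc j) (a (Suc j) * e + ?t (Suc j))))
       - (\<Sum>j<N. avg (nst x) (Suc j) (?t j))" for e
    proof -
      have "\<psi> e = (\<Sum>j<N. avg (nst x) j (a j * e + ?t j)) - (\<Sum>j<N. avg (nst x) (Suc j) (?t j))"
        unfolding \<psi>_def dsum_def dif_def by (simp del: avg.simps add: sum_subtractf)
      also have "(\<Sum>j<N. avg (nst x) j (a j * e + ?t j)) = nst x (e + tail a 1 w) + (\<Sum>j<N'. avg (nst x) (Suc j) (a (Suc j) * e + ?t (Suc j)))"
        unfolding N' by (subst sum.lessThan_Suc_shift) (simp del: avg.simps(2) add: a_0)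
      finally show ?thesis .
    qed
    have "\<bar>(\<Sum>j<N'. avg (nst x) (Suc j) (a (Suc j) * e1 + ?t (Suc j))) - (\<Sum>j<N'. avg (nst x) (Suc j) (a (Suc j) * e2 + ?t (Suc j)))\<bar>
      \<le> (\<Sum>j<N'. \<bar>avg (nst x) (Suc j) (a (Suc j) * e1 + ?t (Suc j)) - avg (nst x) (Suc j) (a (Suc j) * e2 + ?t (Suc j))\<bar>)"
      unfolding sum_subtractf[symmetric] by (rule sum_abs)
    also have "\<dots> \<le> (\<Sum>j<N'. K * (\<bar>a (Suc j)\<bar> * (2 * \<delta>)))"
    proof (intro sum_mono)
      fix j
      have "\<bar>avg (nst x) (Suc j) (a (Suc j) * e1 + ?t (Suc j)) - avg (nst x) (Suc j) (a (Suc j) * e2 + ?t (Suc j))\<bar>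
        \<le> K * \<bar>(a (Suc j) * e1 + ?t (Suc j)) - (a (Suc j) * e2 + ?t (Suc j))\<bar>"
        using adm_lip[OF ad, of j] unfolding lip_def by blast
      also have "\<dots> = K * (\<bar>a (Suc j)\<bar> * \<bar>e1 - e2\<bar>)" by (simp add: abs_mult[symmetric] algebra_simps)
      also have "\<dots> \<le> K * (\<bar>a (Suc j)\<bar> * (2 * \<delta>))"
        using that K_nonneg by (intro mult_left_mono) auto
      finally show "\<bar>avg (nst x) (Suc j) (a (Suc j) * e1 + ?t (Suc j)) - avg (nst x) (Suc j) (a (Suc j) * e2 + ?t (Suc j))\<bar>
        \<le> K * (\<bar>a (Suc j)\<bar> * (2 * \<delta>))" .
    qed
    also have "\<dots> = 2 * \<delta> * (K * (\<Sum>j<N'. \<bar>a (Suc j)\<bar>))"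
      by (simp add: sum_distrib_left sum_distrib_right algebra_simps)
    also have "\<dots> \<le> 2 * \<delta> * (K * (\<Sum>i. \<bar>a i\<bar>))"
    proof (intro mult_left_mono K_nonneg)
      have "(\<Sum>j<N'. \<bar>a (Suc j)\<bar>) \<le> (\<Sum>i<Suc N'. \<bar>a i\<bar>)" by (subst sum.lessThan_Suc_shift) simp
      also have "\<dots> \<le> (\<Sum>i. \<bar>a i\<bar>)" by (intro sum_le_suminf a_abs_summable) auto
      finally show "(\<Sum>j<N'. \<bar>a (Suc j)\<bar>) \<le> (\<Sum>i. \<bar>a i\<bar>)" .
    qed (use \<delta> in simp)
    also have "\<dots> \<le> 1 / 2" using \<delta> by simp
    finally have lip: "\<bar>(\<Sum>j<N'. avg (nst x) (Suc j) (a (Suc j) * e1 + ?t (Suc j))) - (\<Sum>j<N'. avg (nst x) (Suc j) (a (Suc j) * e2 + ?t (Suc j)))\<bar> \<le> 1 / 2" .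
    have "nst x (e1 + tail a 1 w) = -1" "nst x (e2 + tail a 1 w) = 0"
      using that by (auto simp: nst_def s_def)
    then show ?thesis using lip unfolding ex by linarith
  qed
  have lowb: "measure mu A / 16 \<le> (\<integral>e. (\<psi> e)\<^sup>2 \<partial>mu)" if A: "A \<in> sets borel" and big: "\<And>e. e \<in> A \<Longrightarrow> \<bar>\<psi> e\<bar> \<ge> 1 / 4" for A
  proof -
    have "measure mu A / 16 = (\<integral>e. indicator A e / 16 \<partial>mu)" by simp
    also have "\<dots> \<le> (\<integral>e. (\<psi> e)\<^sup>2 \<partial>mu)"
    proof (intro integral_mono mu.bdm_integrable bd)
      show "bdm mu (\<lambda>e. indicator A e / 16)" using A by (intro bdmI[where B=1]) (auto split: split_indicator)
      fix e
      show "indicator A e / 16 \<le> (\<psi> e)\<^sup>2"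
        using big[of e] abs_le_square_iff[of "1/4" "\<psi> e"] by (auto split: split_indicator simp: power2_eq_square)
    qed
    finally show ?thesis .
  qed
  have m1: "cdf mu s - cdf mu (s - \<delta>) = measure mu {s - \<delta><..s}"
    and m2: "cdf mu (s + \<delta>) - cdf mu s = measure mu {s<..s + \<delta>}"
    using \<delta> by (auto intro!: mu.cdf_diff_eq)
  have "min (cdf mu s - cdf mu (s - \<delta>)) (cdf mu (s + \<delta>) - cdf mu s) / 16 \<le> (\<integral>e. (\<psi> e)\<^sup>2 \<partial>mu)"
  \<comment> \<open>An absolute value below 1 / 4 at one point right of the jump forces at least 1 /
    4 everywhere on the left interval.\<close>
  proof (cases "\<forall>e\<in>{s<..s + \<delta>}. \<bar>\<psi> e\<bar> \<ge> 1 / 4")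
    case True
    then have "measure mu {s<..s + \<delta>} / 16 \<le> (\<integral>e. (\<psi> e)\<^sup>2 \<partial>mu)" by (intro lowb) auto
    then show ?thesis unfolding m1 m2 by linarith
  next
    case False
    then obtain e2 where e2: "s < e2" "e2 \<le> s + \<delta>" "\<bar>\<psi> e2\<bar> < 1 / 4" by force
    have "\<bar>\<psi> e\<bar> \<ge> 1 / 4" if "e \<in> {s - \<delta><..s}" for e
    proof -
      have "1 / 2 \<le> \<bar>\<psi> e - \<psi> e2\<bar>" using that e2 by (intro jump) auto
      then show ?thesis using e2(3) abs_triangle_ineq4[of "\<psi> e" "\<psi> e2"] by linarith
    qed
    then have "measure mu {s - \<delta><..s} / 16 \<le> (\<integral>e. (\<psi> e)\<^sup>2 \<partial>mu)" by (intro lowb) auto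
    then show ?thesis unfolding m1 m2 by linarith
  qed
  then show ?thesis unfolding s_def \<psi>_def .
qed

lemma psum_nst_lower:
  assumes pos: "fZ x > 0"
  shows "\<exists>c>0. \<forall>n>0. c \<le> l2norm M (psum (nst x) n) / sqrt n"
proof -
  let ?A = "\<Sum>i. \<bar>a i\<bar>"
  have A0: "0 \<le> K * ?A" using K_nonneg by (intro mult_nonneg_nonneg suminf_nonneg a_abs_summable) auto
  \<comment> \<open>Chosen for the smallness condition of \<open>dsum_nst_ge\<close>; the added 1
    keeps the denominator positive.\<close>
  define \<delta> where "\<delta> = 1 / (4 * (K * ?A + 1))"
  have \<delta>: "0 < \<delta>" using A0 by (simp add: \<delta>_def add_nonneg_pos)
  have "4 * \<delta> * (K * ?A) \<le> 4 * \<delta> * (K * ?A + 1)" using \<delta> by (intro mult_left_mono) auto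
  also have "\<dots> = 1" unfolding \<delta>_def using A0 by (simp add: add_nonneg_eq_0_iff)
  finally have \<delta>': "4 * \<delta> * (K * ?A) \<le> 1" .
  define G where "G y = min (cdf mu (x - y) - cdf mu (x - y - \<delta>)) (cdf mu (x - y + \<delta>) - cdf mu (x - y)) / 16" for y
  have [measurable]: "G \<in> borel_measurable borel" unfolding G_def[abs_def] by measurable
  have G0: "0 \<le> G y" for y
    using mu.cdf_nondecreasing[of "x - y - \<delta>" "x - y"] mu.cdf_nondecreasing[of "x - y" "x - y + \<delta>"] \<delta>
    by (simp add: G_def)
  have G1: "G y \<le> 1" for y
    using mu.cdf_bounded_prob[of "x - y"] mu.cdf_nonneg[of "x - y - \<delta>"] by (simp add: G_def min_def)
  have bdG: "bdm Sq (\<lambda>w. G (tail a 1 w))" using G0 G1 by (intro bdmI[where B=1]) auto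
  define c where "c = (\<integral>w. G (tail a 1 w) \<partial>Sq)"
  \<comment> \<open>If \<open>c\<close> were 0, then almost surely one side of
    \<open>x - tail a 1 w\<close> would carry no mass within distance \<delta>; by continuity
    \<open>f0\<close> would vanish at that point, and so would its average
    \<open>fZ x\<close>.\<close>
  have "c \<noteq> 0"
  proof
    assume "c = 0"
    then have "AE w in Sq. G (tail a 1 w) = 0"
      unfolding c_def using G0 Sq.bdm_integrable[OF bdG]
      by (subst (asm) integral_nonneg_eq_0_iff_AE) auto
    then have "AE w in Sq. f0 (x - tail a 1 w) = 0"
    proof eventually_elim
      case (elim w)
      let ?s = "x - tail a 1 w"
      show "f0 ?s = 0"
      proof (rule ccontr)
        assume "f0 ?s \<noteq> 0"
        then have f: "f0 ?s > 0" using f0_nonneg[of ?s] by linarith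
        have "isCont f0 ?s" using f0_cont by (simp add: continuous_on_eq_continuous_at)
        then obtain d where d: "d > 0" "\<And>y. \<bar>y - ?s\<bar> < d \<Longrightarrow> \<bar>f0 y - f0 ?s\<bar> < f0 ?s / 2"
          using f unfolding continuous_at_eps_delta dist_real_def by (metis half_gt_zero)
        define m where "m = min (d / 2) \<delta>"
        have m: "0 < m" "m < d" "m \<le> \<delta>" using d \<delta> by (auto simp: m_def)
        have fy: "f0 ?s / 2 \<le> f0 y \<and> f0 y \<le> K" if "\<bar>y - ?s\<bar> < d" for y
          using d(2)[OF that] f0_le[of y] unfolding abs_less_iff by linarith
        have "f0 ?s / 2 * (?s - (?s - m)) \<le> cdf mu ?s - cdf mu (?s - m)"
          using m f by (intro cdf_mu_bounds(1)[OF _ _ fy]) auto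
        moreover have "f0 ?s / 2 * ((?s + m) - ?s) \<le> cdf mu (?s + m) - cdf mu ?s"
          using m f by (intro cdf_mu_bounds(1)[OF _ _ fy]) auto
        moreover have "cdf mu (?s - \<delta>) \<le> cdf mu (?s - m)" "cdf mu (?s + m) \<le> cdf mu (?s + \<delta>)"
          using m by (auto intro!: mu.cdf_nondecreasing)
        moreover have "f0 ?s / 2 * m > 0" using f m by simp
        ultimately have "G (tail a 1 w) > 0" by (simp add: G_def)
        then show False using elim by simp
      qed
    qed
    then have "fZ x = 0" unfolding fZ_def by (subst integral_eq_zero_AE) auto
    then show False using pos by simp
  qed
  moreover have "c \<ge> 0" unfolding c_def using G0 by (intro integral_nonneg_AE) auto
  ultimately have c: "c > 0" by simp
  note ad = adm_nst[of x]
  have low: "c \<le> (l2norm Sq (dsum (nst x) N))\<^sup>2" if N: "N > 0" for N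
  proof -
    have bd: "bdm Sq (\<lambda>w. (dsum (nst x) N w)\<^sup>2)" by (intro bdm_power2 mdiff_bdm dsum_mdiff[OF ad])
    obtain B where B: "\<And>w. \<bar>(dsum (nst x) N w)\<^sup>2\<bar> \<le> B" using bd by (auto simp: bdm_def)
    note [measurable] = bdm_measurable[OF bd]
    have "(\<lambda>z. (dsum (nst x) N (case_nat (snd z) (fst z)))\<^sup>2) \<in> borel_measurable (Sq \<Otimes>\<^sub>M mu)"
    proof -
      have "(\<lambda>z. (snd z, fst z)) \<in> measurable (Sq \<Otimes>\<^sub>M mu) (mu \<Otimes>\<^sub>M Sq)" by measurable
      from measurable_compose[OF measurable_compose[OF this case_nat_measurable] bdm_measurable[OF bd]]
      show ?thesis by simp
    qed
    then have [measurable]: "(\<lambda>w. \<integral>e. (dsum (nst x) N (case_nat e w))\<^sup>2 \<partial>mu) \<in> borel_measurable Sq"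
      by (intro mu.borel_measurable_lebesgue_integral) (simp add: split_beta')
    have bdi: "bdm Sq (\<lambda>w. \<integral>e. (dsum (nst x) N (case_nat e w))\<^sup>2 \<partial>mu)"
    proof (rule bdmI[where B=B])
      fix w
      have "\<bar>\<integral>e. (dsum (nst x) N (case_nat e w))\<^sup>2 \<partial>mu\<bar> \<le> (\<integral>e. \<bar>(dsum (nst x) N (case_nat e w))\<^sup>2\<bar> \<partial>mu)"
        by (rule integral_abs_bound)
      also have "\<dots> \<le> (\<integral>e. B \<partial>mu)"
        using B mu.bdm_integrable[OF mdiff_bdm_iter[OF bd]] by (intro integral_mono) auto
      finally show "\<bar>\<integral>e. (dsum (nst x) N (case_nat e w))\<^sup>2 \<partial>mu\<bar> \<le> B" using mu.prob_space by simp
    qed simp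
    have "c \<le> (\<integral>w. \<integral>e. (dsum (nst x) N (case_nat e w))\<^sup>2 \<partial>mu \<partial>Sq)"
      unfolding c_def
    proof (intro integral_mono Sq.bdm_integrable bdG bdi)
      show "G (tail a 1 w) \<le> (\<integral>e. (dsum (nst x) N (case_nat e w))\<^sup>2 \<partial>mu)" for w
        unfolding G_def by (rule dsum_nst_ge[OF N \<delta> \<delta>'])
    qed
    also have "\<dots> = (l2norm Sq (dsum (nst x) N))\<^sup>2"
      unfolding l2norm_sq by (rule integral_Sq_iter[OF bd, symmetric])
    finally show ?thesis .
  qed
  have "sqrt c \<le> l2norm M (psum (nst x) n) / sqrt n" if "n > 0" for n
  proof -
    have "real n * c \<le> (l2norm M (psum (nst x) n))\<^sup>2" by (rule psum_l2norm_ge[OF ad low])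
    then have "sqrt (real n * c) \<le> l2norm M (psum (nst x) n)" by (intro real_le_lsqrt) (use c in auto)
    then show ?thesis using that by (simp add: real_sqrt_mult field_simps)
  qed
  then show ?thesis using c by (intro exI[of _ "sqrt c"]) auto
qed

end

subsection \<open>Central limit theorem for empirical counts\<close>


context linear_process begin

lemma avg_Suc_bound:
  assumes h: "adm L h" and B: "\<And>y. \<bar>avg h 1 y\<bar> \<le> B"
  shows "\<bar>avg h (Suc j) y\<bar> \<le> B"
proof (induction j arbitrary: y)
  case (Suc j)
  have bd: "bdm mu (\<lambda>e. avg h (Suc j) (a (Suc j) * e + y))" by (rule adm_bdm[OF h]) measurable
  have "\<bar>avg h (Suc (Suc j)) y\<bar> \<le> (\<integral>e. \<bar>avg h (Suc j) (a (Suc j) * e + y)\<bar> \<partial>mu)"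
    unfolding avg.simps(2)[of h "Suc j"] by (rule integral_abs_bound)
  also have "\<dots> \<le> (\<integral>e. B \<partial>mu)"
    by (intro integral_mono mu.bdm_integrable integrable_abs bd Suc) auto
  finally show ?case using mu.prob_space by simp
qed (use B in simp)

text \<open>At lag 0 the difference of indicators is, up to sign, the indicator of an interval of
  probability at most \<open>B\<close>, which has L2 norm at most \<open>sqrt B\<close>; the
  smoothed lags are of order \<open>B\<close>.\<close>

lemma l2norm_dif_nst_diff:
  assumes B: "B = K * \<bar>x' - x\<bar>"
  shows "l2norm Sq (dif (\<lambda>y. nst x' y - nst x y) a j) \<le> sqrt B + 2 * B"
proof -
  let ?h = "\<lambda>y. nst x' y - nst x y"
  note ad = adm_nst_diff[of x' x]
  have B0: "0 \<le> B" using B K_nonneg by simp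
  have av1: "\<bar>avg ?h 1 y\<bar> \<le> B" for y
    unfolding avg_nst_diff using cdf_mu_lip[of "x - y" "x' - y"] by (simp add: B abs_minus_commute)
  note av = avg_Suc_bound[OF ad av1]
  show ?thesis
  proof (cases j)
    case 0
    let ?A = "\<lambda>\<omega>. avg ?h 1 (tail a 1 (pst (0 - int 1) \<omega>))"
    have bdh: "bdm M (\<lambda>\<omega>. ?h (Z 0 \<omega>))" by (rule hZ_bdm[OF ad])
    have bdA: "bdm M ?A" by (rule avg_tail_bdm[OF ad])
    have "l2norm Sq (dif ?h a 0) = l2norm M (\<lambda>\<omega>. dif ?h a 0 (pst 0 \<omega>))"
      by (rule l2norm_pst[OF dif_bdm[OF ad], symmetric])
    also have "\<dots> = l2norm M (\<lambda>\<omega>. ?h (Z 0 \<omega>) - ?A \<omega>)"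
    proof (rule l2norm_cong_AE[OF bdm_pst[OF dif_bdm[OF ad]] bdm_diff[OF bdh bdA]])
      show "AE \<omega> in M. dif ?h a 0 (pst 0 \<omega>) = ?h (Z 0 \<omega>) - ?A \<omega>"
        using Z_sums[of 0]
      proof eventually_elim
        case (elim \<omega>)
        show ?case using telescope[OF elim, of ?h 1] by (simp del: avg.simps)
      qed
    qed
    also have "\<dots> \<le> l2norm M (\<lambda>\<omega>. ?h (Z 0 \<omega>)) + l2norm M ?A"
      by (rule l2norm_triangle_diff[OF bdh bdA])
    also have "l2norm M ?A \<le> B" by (intro l2norm_le_const bdA av1)
    also have "l2norm M (\<lambda>\<omega>. ?h (Z 0 \<omega>)) \<le> sqrt B"
    proof -
      have "(?h z)\<^sup>2 = nst (min x' x) z - nst (max x' x) z" for z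
        by (auto simp: nst_def min_def max_def)
      then have "(\<integral>\<omega>. (?h (Z 0 \<omega>))\<^sup>2 \<partial>M) = (\<integral>\<omega>. nst (min x' x) (Z 0 \<omega>) - nst (max x' x) (Z 0 \<omega>) \<partial>M)"
        by simp
      also have "\<dots> = FZ (max x' x) - FZ (min x' x)"
        by (subst Bochner_Integration.integral_diff)
           (auto intro!: bdm_integrable hZ_bdm[OF adm_nst] simp: expectation_Z mean_nst)
      also have "\<dots> \<le> B" using FZ_lip[of "max x' x" "min x' x"] by (auto simp: B max_def min_def abs_if split: if_splits)
      finally show ?thesis unfolding l2norm_def by simp
    qed
    finally show ?thesis using 0 B0 by simp
  next
    case (Suc i)
    have "l2norm Sq (dif ?h a j) \<le> 2 * B"
    proof (rule Sq.l2norm_le_const[OF dif_bdm[OF ad]])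
      fix w
      show "\<bar>dif ?h a j w\<bar> \<le> 2 * B" unfolding dif_def Suc
        using av[of i "a (Suc i) * w 0 + tail a (Suc (Suc i)) (sh 1 w)"] av[of "Suc i" "tail a (Suc (Suc i)) (sh 1 w)"]
        by linarith
    qed
    then show ?thesis using real_sqrt_ge_zero[OF B0] by linarith
  qed
qed

text \<open>Asymptotic equicontinuity of the empirical process at \<open>x\<close>: each lag
  vanishes as the thresholds approach \<open>x\<close>, and \<open>wt (2 * K)\<close> dominates
  uniformly in \<open>n\<close>.\<close>

lemma psum_nst_shift:
  assumes xs: "xs \<longlonglongrightarrow> x"
  shows "(\<lambda>n. l2norm M (\<lambda>\<omega>. psum (nst (xs n)) n \<omega> / sqrt n - psum (nst x) n \<omega> / sqrt n)) \<longlonglongrightarrow> 0"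
proof -
  let ?h = "\<lambda>n y. nst (xs n) y - nst x y"
  note ad = adm_nst_diff
  let ?s = "\<lambda>j n. l2norm Sq (dif (?h n) a j)"
  have lim: "?s j \<longlonglongrightarrow> 0" for j
  proof (rule Lim_null_comparison)
    let ?B = "\<lambda>n. K * \<bar>xs n - x\<bar>"
    show "\<forall>\<^sub>F n in sequentially. norm (?s j n) \<le> sqrt (?B n) + 2 * ?B n"
      using l2norm_dif_nst_diff[OF refl, of _ x j] by (intro always_eventually allI) simp
    have "(\<lambda>n. sqrt (?B n) + 2 * ?B n) \<longlonglongrightarrow> sqrt (K * \<bar>x - x\<bar>) + 2 * (K * \<bar>x - x\<bar>)"
      by (intro tendsto_intros xs)
    then show "(\<lambda>n. sqrt (?B n) + 2 * ?B n) \<longlonglongrightarrow> 0" by simp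
  qed
  have tan: "(\<lambda>n. suminf (\<lambda>j. ?s j n)) \<longlonglongrightarrow> (\<Sum>j. 0)"
    using tannerys_theorem[of ?s "\<lambda>_. 0" sequentially "wt (2 * K)", OF lim] wt_summable[of "2 * K"]
      l2norm_dif_le[OF ad]
    by (simp add: always_eventually split_beta')
  have le: "l2norm M (\<lambda>\<omega>. psum (nst (xs n)) n \<omega> / sqrt n - psum (nst x) n \<omega> / sqrt n) \<le> suminf (\<lambda>j. ?s j n)" if n: "n > 0" for n
  proof -
    let ?A = "(\<lambda>m. int (Suc m)) ` {..<n}"
    have re: "(\<Sum>k\<in>?A. F k) = (\<Sum>m<n. F (int (Suc m)))" for F :: "int \<Rightarrow> real"
      by (subst sum.reindex) (auto simp: inj_on_def)
    have c0: "cdif (?h n) 0 j = dif (?h n) a j" for j by (auto simp: cdif_def)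
    have mn: "mean (?h n) = mean (nst (xs n)) - mean (nst x)"
      unfolding expectation_Z[symmetric, of _ 0, OF nst_measurable] expectation_Z[symmetric, of "?h n" 0, OF adm_measurable[OF ad]]
      by (intro Bochner_Integration.integral_diff bdm_integrable hZ_bdm[OF adm_nst])
    have ps: "psum (?h n) n \<omega> = psum (nst (xs n)) n \<omega> - psum (nst x) n \<omega>" for \<omega>
      unfolding psum_def mn sum_subtractf[symmetric] by (intro sum.cong) auto
    have "l2norm M (\<lambda>\<omega>. \<Sum>k\<in>?A. (?h n (Z k \<omega>) - mean (?h n)) - (?h n (tail (cutoff 0) 0 (pst k \<omega>)) - avg (?h n) 0 0))
      \<le> (\<Sum>j. sqrt (\<Sum>k\<in>?A. (l2norm Sq (cdif (?h n) 0 j))\<^sup>2))"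
      by (rule l2norm_truncation(2)[OF ad]) simp
    also have "(\<lambda>\<omega>. \<Sum>k\<in>?A. (?h n (Z k \<omega>) - mean (?h n)) - (?h n (tail (cutoff 0) 0 (pst k \<omega>)) - avg (?h n) 0 0)) = psum (?h n) n"
      unfolding re psum_def by (auto simp: tail_cut fun_eq_iff)
    also have "(\<Sum>j. sqrt (\<Sum>k\<in>?A. (l2norm Sq (cdif (?h n) 0 j))\<^sup>2)) = (\<Sum>j. sqrt n * ?s j n)"
      unfolding re c0 by (simp add: real_sqrt_mult)
    also have "\<dots> = sqrt n * suminf (\<lambda>j. ?s j n)"
    proof (rule suminf_mult)
      show "summable (\<lambda>j. ?s j n)"
        by (rule summable_comparison_test'[OF wt_summable[of "2 * K"]]) (use l2norm_dif_le[OF ad] in simp)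
    qed
    finally have "l2norm M (psum (?h n) n) \<le> sqrt n * suminf (\<lambda>j. ?s j n)" .
    moreover have "l2norm M (\<lambda>\<omega>. psum (nst (xs n)) n \<omega> / sqrt n - psum (nst x) n \<omega> / sqrt n) = l2norm M (psum (?h n) n) / sqrt n"
      unfolding diff_divide_distrib[symmetric] ps[symmetric] l2norm_divide by simp
    ultimately show ?thesis using n by (simp add: pos_divide_le_eq mult.commute)
  qed
  show ?thesis
  proof (rule Lim_null_comparison)
    show "\<forall>\<^sub>F n in sequentially. norm (l2norm M (\<lambda>\<omega>. psum (nst (xs n)) n \<omega> / sqrt n - psum (nst x) n \<omega> / sqrt n)) \<le> suminf (\<lambda>j. ?s j n)"
      using eventually_gt_at_top[of 0] by eventually_elim (use le in simp)
    show "(\<lambda>n. suminf (\<lambda>j. ?s j n)) \<longlonglongrightarrow> 0" using tan by simp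
  qed
qed

text \<open>Thresholds may drift towards \<open>x\<close> at the rate 1 / sqrt n, as inverting the
  distribution function demands; \<sigma> belongs to the fixed threshold \<open>x\<close> and is the
  same for all sequences.\<close>

theorem empirical_clt:
  assumes pos: "fZ x > 0"
  shows "\<exists>\<sigma>>0. \<forall>xs u. xs \<longlonglongrightarrow> x \<longrightarrow> (\<lambda>n. sqrt n * (FZ (xs n) - FZ x)) \<longlonglongrightarrow> u \<longrightarrow>
    (\<lambda>n. prob {\<omega> \<in> space M. real n * FZ x \<le> real (card {m. m < n \<and> Z (int (Suc m)) \<omega> \<le> xs n})})
      \<longlonglongrightarrow> cdf std_normal_distribution (u / \<sigma>)"
proof -
  obtain c where c: "c > 0" "\<And>n. n > 0 \<Longrightarrow> c \<le> l2norm M (psum (nst x) n) / sqrt n"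
    using psum_nst_lower[OF pos] by auto
  obtain \<sigma> where \<sigma>: "\<sigma> > 0" and lim: "\<And>t. (\<lambda>n. prob {\<omega> \<in> space M. psum (nst x) n \<omega> / sqrt n / \<sigma> \<le> t})
      \<longlonglongrightarrow> cdf std_normal_distribution t"
    using clt[OF adm_nst acont_nst c] by blast
  have "(\<lambda>n. prob {\<omega> \<in> space M. real n * FZ x \<le> real (card {m. m < n \<and> Z (int (Suc m)) \<omega> \<le> xs n})})
      \<longlonglongrightarrow> cdf std_normal_distribution (u / \<sigma>)"
    if xs: "xs \<longlonglongrightarrow> x" and u: "(\<lambda>n. sqrt n * (FZ (xs n) - FZ x)) \<longlonglongrightarrow> u" for xs u
  proof -
    let ?\<Delta> = "\<lambda>n. sqrt n * (FZ (xs n) - FZ x)"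
    \<comment> \<open>Correcting by the deterministic drift turns the counting event into
      \<open>T n \<omega> \<le> u / \<sigma>\<close>, with a right side free of
      \<open>n\<close>.\<close>
    define T where "T n \<omega> = psum (nst (xs n)) n \<omega> / sqrt n / \<sigma> - (?\<Delta> n - u) / \<sigma>" for n \<omega>
    have bdT: "bdm M (T n)" for n unfolding T_def[abs_def] by (intro bdm_diff bdm_divide psum_bdm[OF adm_nst] bdm_const)
    have "(\<lambda>n. prob {\<omega> \<in> space M. T n \<omega> \<le> u / \<sigma>}) \<longlonglongrightarrow> cdf std_normal_distribution (u / \<sigma>)"
    proof (rule cdf_tendsto_l2_approx[OF bdT _ isCont_std_normal_cdf])
      fix \<delta> :: real assume \<delta>: "\<delta> > 0"
      let ?N = "\<lambda>n \<omega>. psum (nst x) n \<omega> / sqrt n / \<sigma>"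
      have bdN: "bdm M (?N n)" for n by (intro bdm_divide psum_bdm[OF adm_nst])
      let ?D = "\<lambda>n. l2norm M (\<lambda>\<omega>. psum (nst (xs n)) n \<omega> / sqrt n - psum (nst x) n \<omega> / sqrt n)"
      have le: "l2norm M (\<lambda>\<omega>. T n \<omega> - ?N n \<omega>) \<le> ?D n / \<sigma> + \<bar>?\<Delta> n - u\<bar> / \<sigma>" for n
      proof -
        have "l2norm M (\<lambda>\<omega>. T n \<omega> - ?N n \<omega>)
          = l2norm M (\<lambda>\<omega>. (psum (nst (xs n)) n \<omega> / sqrt n - psum (nst x) n \<omega> / sqrt n) / \<sigma> - (?\<Delta> n - u) / \<sigma>)"
          by (simp add: T_def diff_divide_distrib algebra_simps)
        also have "\<dots> \<le> l2norm M (\<lambda>\<omega>. (psum (nst (xs n)) n \<omega> / sqrt n - psum (nst x) n \<omega> / sqrt n) / \<sigma>) + l2norm M (\<lambda>\<omega>. (?\<Delta> n - u) / \<sigma>)"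
          by (intro l2norm_triangle_diff bdm_divide bdm_diff psum_bdm[OF adm_nst] bdm_const)
        also have "\<dots> = ?D n / \<sigma> + \<bar>?\<Delta> n - u\<bar> / \<sigma>"
          unfolding l2norm_divide using \<sigma> by (simp add: l2norm_def prob_space)
        finally show ?thesis .
      qed
      have "(\<lambda>n. ?D n / \<sigma> + \<bar>?\<Delta> n - u\<bar> / \<sigma>) \<longlonglongrightarrow> 0 / \<sigma> + \<bar>u - u\<bar> / \<sigma>"
        using \<sigma> by (intro tendsto_intros psum_nst_shift[OF xs] u) auto
      then have "\<forall>\<^sub>F n in sequentially. ?D n / \<sigma> + \<bar>?\<Delta> n - u\<bar> / \<sigma> < \<delta>"
        by (rule order_tendstoD) (use \<delta> in simp)
      then have "\<forall>\<^sub>F n in sequentially. l2norm M (\<lambda>\<omega>. T n \<omega> - ?N n \<omega>) \<le> \<delta>"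
        by eventually_elim (use le in \<open>meson less_imp_le order_trans\<close>)
      then show "\<exists>N. (\<forall>n. bdm M (N n)) \<and>
          (\<forall>t. (\<lambda>n. prob {\<omega> \<in> space M. N n \<omega> \<le> t}) \<longlonglongrightarrow> cdf std_normal_distribution t) \<and>
          (\<forall>\<^sub>F n in sequentially. l2norm M (\<lambda>\<omega>. T n \<omega> - N n \<omega>) \<le> \<delta>)"
        using bdN lim by (intro exI[of _ ?N]) blast
    qed
    moreover have "\<forall>\<^sub>F n in sequentially. prob {\<omega> \<in> space M. T n \<omega> \<le> u / \<sigma>}
       = prob {\<omega> \<in> space M. real n * FZ x \<le> real (card {m. m < n \<and> Z (int (Suc m)) \<omega> \<le> xs n})}"
      using eventually_gt_at_top[of 0]
    proof eventually_elim
      case (elim n)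
      have "T n \<omega> \<le> u / \<sigma> \<longleftrightarrow> real n * FZ x \<le> real (card {m. m < n \<and> Z (int (Suc m)) \<omega> \<le> xs n})" for \<omega>
      proof -
        let ?C = "{m. m < n \<and> Z (int (Suc m)) \<omega> \<le> xs n}"
        have "(\<Sum>m<n. nst (xs n) (Z (int (Suc m)) \<omega>)) = (\<Sum>m<n. - indicator ?C m)"
          by (intro sum.cong) (auto simp: nst_def)
        also have "\<dots> = - real (card ?C)"
          by (simp add: sum_negf sum_indicator_eq_card Int_absorb1 subset_eq indicator_def[abs_def] Int_def flip: sum.inter_filter)
        finally have p: "psum (nst (xs n)) n \<omega> = real n * FZ (xs n) - real (card ?C)"
          by (simp add: psum_def mean_nst sum.distrib)
        have "T n \<omega> \<le> u / \<sigma> \<longleftrightarrow> psum (nst (xs n)) n \<omega> / sqrt n / \<sigma> \<le> ?\<Delta> n / \<sigma>"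
          unfolding T_def diff_divide_distrib by linarith
        also have "\<dots> \<longleftrightarrow> psum (nst (xs n)) n \<omega> / sqrt n \<le> ?\<Delta> n" using \<sigma> by (simp only: divide_le_cancel) auto
        also have "\<dots> \<longleftrightarrow> psum (nst (xs n)) n \<omega> \<le> ?\<Delta> n * sqrt n" using elim by (simp add: pos_divide_le_eq)
        also have "?\<Delta> n * sqrt n = real n * (FZ (xs n) - FZ x)" by simp
        finally show ?thesis unfolding p by (simp add: algebra_simps)
      qed
      then show ?case by simp
    qed
    ultimately show ?thesis by (rule Lim_transform_eventually)
  qed
  then show ?thesis using \<sigma> by blast
qed

end

subsection \<open>Sample quantiles\<close>


text \<open>The empirical distribution function is a right-continuous step function, so the infimum
  is attained; \<open>0 < p\<close> bounds the set below and \<open>p \<le> 1\<close> makes it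
  nonempty. Statements on quantiles thereby become statements on counts.\<close>

lemma emp_quantile_le_iff:
  assumes xs: "xs \<noteq> []" and p: "0 < p" "p \<le> 1"
  shows "emp_quantile xs p \<le> y \<longleftrightarrow> p * real (length xs) \<le> real (length (filter (\<lambda>v. v \<le> y) xs))"
proof -
  define cnt where "cnt y = length (filter (\<lambda>v. v \<le> y) xs)" for y
  define A where "A = {y. p \<le> real (cnt y) / real (length xs)}"
  have len: "0 < real (length xs)" using xs by simp
  have cnt_mono: "cnt u \<le> cnt v" if "u \<le> v" for u v
  proof -
    have "filter (\<lambda>x. x \<le> u) xs = filter (\<lambda>x. x \<le> u) (filter (\<lambda>x. x \<le> v) xs)"
      using that by (auto intro!: filter_cong)
    then show ?thesis unfolding cnt_def by (metis length_filter_le)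
  qed
  have up: "v \<in> A" if "u \<in> A" "u \<le> v" for u v
  proof -
    have "real (cnt u) / real (length xs) \<le> real (cnt v) / real (length xs)"
      using cnt_mono[OF that(2)] by (intro divide_right_mono) auto
    then show ?thesis using that(1) unfolding A_def by simp
  qed
  have "cnt (Max (set xs)) = length xs" unfolding cnt_def using xs by (simp add: filter_True)
  then have "Max (set xs) \<in> A" using p len by (simp add: A_def)
  then have ne: "A \<noteq> {}" by blast
  have low: "Min (set xs) \<le> y" if "y \<in> A" for y
  proof (rule ccontr)
    assume "\<not> Min (set xs) \<le> y"
    then have "\<forall>v\<in>set xs. \<not> v \<le> y" using xs by (meson List.finite_set Min_le order_trans)
    then have "cnt y = 0" unfolding cnt_def by (simp add: filter_False)
    then show False using that p by (simp add: A_def)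
  qed
  have bdd: "bdd_below A" using low by (intro bdd_belowI)
  define z where "z = Inf A"
  have zA: "z \<in> A"
  proof -
    \<comment> \<open>No data point lies strictly between \<open>z\<close> and \<open>Min B\<close>,
      so counts are constant from \<open>z\<close> up to there; \<open>z + 1\<close> keeps the set
      nonempty when no data point exceeds \<open>z\<close>.\<close>
    define B where "B = insert (z + 1) {v \<in> set xs. v > z}"
    have B: "finite B" "B \<noteq> {}" "\<forall>v\<in>B. v > z" by (auto simp: B_def)
    then have "z < Min B" by simp
    then obtain u where u: "u \<in> A" "u < Min B" using cInf_lessD[OF ne] unfolding z_def by blast
    define t where "t = max u z"
    have t: "t \<in> A" "t < Min B" "z \<le> t" using up[OF u(1), of t] u(2) \<open>z < Min B\<close> by (auto simp: t_def)
    have "v \<le> t \<longleftrightarrow> v \<le> z" if "v \<in> set xs" for v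
    proof -
      have "Min B \<le> v" if "v > z" using B(1) that \<open>v \<in> set xs\<close> by (intro Min_le) (auto simp: B_def)
      then show ?thesis using t by linarith
    qed
    then have "cnt t = cnt z" unfolding cnt_def by (auto intro!: arg_cong[where f=length] filter_cong)
    then show ?thesis using t(1) by (simp add: A_def)
  qed
  have "emp_quantile xs p = z" unfolding emp_quantile_def z_def A_def cnt_def by simp
  moreover have "z \<le> y \<longleftrightarrow> y \<in> A"
    using up[OF zA] cInf_lower[OF _ bdd] unfolding z_def by blast
  ultimately show ?thesis using len by (simp add: A_def cnt_def pos_le_divide_eq)
qed

lemma length_filter_map_measurable:
  assumes "\<And>k. k \<in> set ks \<Longrightarrow> X k \<in> borel_measurable N"
  shows "(\<lambda>\<omega>. real (length (filter (\<lambda>v. v \<le> (y::real)) (map (\<lambda>k. X k \<omega>) ks)))) \<in> borel_measurable N"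
  using assms
proof (induction ks)
  case (Cons k ks)
  have [measurable]: "X k \<in> borel_measurable N"
    "(\<lambda>\<omega>. real (length (filter (\<lambda>v. v \<le> y) (map (\<lambda>k. X k \<omega>) ks)))) \<in> borel_measurable N"
    using Cons by auto
  have "(\<lambda>\<omega>. real (length (filter (\<lambda>v. v \<le> y) (map (\<lambda>k. X k \<omega>) (k # ks)))))
    = (\<lambda>\<omega>. (if X k \<omega> \<le> y then 1 else 0) + real (length (filter (\<lambda>v. v \<le> y) (map (\<lambda>k. X k \<omega>) ks))))"
    by (auto simp: fun_eq_iff)
  also have "\<dots> \<in> borel_measurable N" by measurable
  finally show ?case .
qed simp

lemma emp_quantile_measurable:
  assumes X: "\<And>k. k \<in> set ks \<Longrightarrow> X k \<in> borel_measurable N" and p: "0 < p" "p \<le> 1"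
  shows "(\<lambda>\<omega>. emp_quantile (map (\<lambda>k. X k \<omega>) ks) p) \<in> borel_measurable N"
proof (cases "ks = []")
  case False
  note [measurable] = length_filter_map_measurable[OF X]
  show ?thesis
  proof (rule borel_measurableI_le)
    fix y
    have "{\<omega> \<in> space N. emp_quantile (map (\<lambda>k. X k \<omega>) ks) p \<le> y}
      = {\<omega> \<in> space N. p * real (length ks) \<le> real (length (filter (\<lambda>v. v \<le> y) (map (\<lambda>k. X k \<omega>) ks)))}"
      using emp_quantile_le_iff[OF _ p] False by auto
    also have "\<dots> \<in> sets N" by measurable
    finally show "{\<omega> \<in> space N. emp_quantile (map (\<lambda>k. X k \<omega>) ks) p \<le> y} \<in> sets N" .
  qed
qed simp

context prob_space begin

text \<open>Covariances of pairs closer than \<open>d\<close> are bounded by 1, with at most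
  \<open>2 * d\<close> such pairs per row; all others contribute at most \<epsilon>. Chebyshev's
  inequality then applies to the average.\<close>

lemma average_concentration:
  assumes N: "N > 0" and E: "\<And>i. i \<in> {1..N} \<Longrightarrow> E i \<in> events" "\<And>i. i \<in> {1..N} \<Longrightarrow> prob (E i) = \<pi>"
    and mix: "\<And>i j. i \<in> {1..N} \<Longrightarrow> j \<in> {1..N} \<Longrightarrow> i + d \<le> j \<Longrightarrow> \<bar>prob (E i \<inter> E j) - \<pi> * \<pi>\<bar> \<le> \<epsilon>"
    and "\<epsilon> \<ge> 0" and e: "e > 0"
  shows "prob {\<omega> \<in> space M. \<bar>(1 / real N) * (\<Sum>i=1..N. indicator (E i) \<omega>) - \<pi>\<bar> \<ge> e}
    \<le> (2 * real d / real N + \<epsilon>) / e\<^sup>2"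
proof -
  let ?X = "\<lambda>i \<omega>. indicator (E i) \<omega> - \<pi> :: real"
  have bdX: "bdm M (?X i)" if "i \<in> {1..N}" for i
    by (intro bdm_diff bdm_const bdmI[where B=1]) (use E(1)[OF that] in \<open>auto split: split_indicator\<close>)
  have cov: "(\<integral>\<omega>. ?X i \<omega> * ?X j \<omega> \<partial>M) = prob (E i \<inter> E j) - \<pi> * \<pi>" if "i \<in> {1..N}" "j \<in> {1..N}" for i j
  proof -
    have "(\<integral>\<omega>. ?X i \<omega> * ?X j \<omega> \<partial>M) = (\<integral>\<omega>. indicator (E i \<inter> E j) \<omega> - \<pi> * indicator (E i) \<omega> - \<pi> * indicator (E j) \<omega> + \<pi> * \<pi> \<partial>M)"
      by (intro Bochner_Integration.integral_cong) (auto simp: indicator_inter_arith algebra_simps)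
    also have "\<dots> = prob (E i \<inter> E j) - \<pi> * prob (E i) - \<pi> * prob (E j) + \<pi> * \<pi>"
      using E(1)[OF that(1)] E(1)[OF that(2)] by (simp add: prob_space integrable_indicator_iff emeasure_eq_measure)
    finally show ?thesis using E(2) that by simp
  qed
  have \<pi>: "0 \<le> \<pi>" "\<pi> \<le> 1" using E(2)[of 1] N measure_nonneg[of M "E 1"] prob_le_1[of "E 1"] by auto
  have le1: "\<bar>prob (E i \<inter> E j) - \<pi> * \<pi>\<bar> \<le> 1" for i j
    using \<pi> measure_nonneg[of M "E i \<inter> E j"] prob_le_1[of "E i \<inter> E j"] mult_le_one[OF \<pi>(2) \<pi>(1) \<pi>(2)] mult_nonneg_nonneg[OF \<pi>(1) \<pi>(1)]
    unfolding abs_le_iff by linarith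
  have row: "(\<Sum>j\<in>{1..N}. \<bar>prob (E i \<inter> E j) - \<pi> * \<pi>\<bar>) \<le> 2 * real d + real N * \<epsilon>" if i: "i \<in> {1..N}" for i
  proof -
    let ?near = "{j \<in> {1..N}. i < j + d \<and> j < i + d}"
    have "(\<Sum>j\<in>{1..N}. \<bar>prob (E i \<inter> E j) - \<pi> * \<pi>\<bar>) \<le> (\<Sum>j\<in>{1..N}. indicator ?near j + \<epsilon>)"
    proof (intro sum_mono)
      fix j assume j: "j \<in> {1..N}"
      show "\<bar>prob (E i \<inter> E j) - \<pi> * \<pi>\<bar> \<le> indicator ?near j + \<epsilon>"
      proof (cases "j \<in> ?near")
        case True
        then show ?thesis using le1[of i j] \<open>\<epsilon> \<ge> 0\<close> by simp
      next
        case False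
        then have "i + d \<le> j \<or> j + d \<le> i" using j by auto
        then have "\<bar>prob (E i \<inter> E j) - \<pi> * \<pi>\<bar> \<le> \<epsilon>"
          using mix[of i j] mix[of j i] i j by (auto simp: Int_commute)
        then show ?thesis using False by simp
      qed
    qed
    also have "\<dots> = real (card ({1..N} \<inter> ?near)) + real N * \<epsilon>"
      by (simp add: sum.distrib indicator_def flip: sum.inter_filter) (simp add: Int_def conj_ac)
    also have "card ({1..N} \<inter> ?near) \<le> card {i - d<..<i + d}" by (rule card_mono) auto
    finally have "(\<Sum>j\<in>{1..N}. \<bar>prob (E i \<inter> E j) - \<pi> * \<pi>\<bar>) \<le> real (card {i - d<..<i + d}) + real N * \<epsilon>"
      by simp
    moreover have "card {i - d<..<i + d} \<le> 2 * d" by simp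
    ultimately show ?thesis by linarith
  qed
  define A where "A \<omega> = (\<Sum>i\<in>{1..N}. ?X i \<omega>)" for \<omega>
  have bdA: "bdm M (\<lambda>\<omega>. A \<omega> / real N)" unfolding A_def[abs_def] by (intro bdm_divide bdm_sum bdX)
  have "(\<integral>\<omega>. (A \<omega>)\<^sup>2 \<partial>M) = (\<integral>\<omega>. (\<Sum>i\<in>{1..N}. \<Sum>j\<in>{1..N}. ?X i \<omega> * ?X j \<omega>) \<partial>M)"
    unfolding A_def power2_eq_square sum_product ..
  also have "\<dots> = (\<Sum>i\<in>{1..N}. \<Sum>j\<in>{1..N}. \<integral>\<omega>. ?X i \<omega> * ?X j \<omega> \<partial>M)"
    using bdm_integrable[OF bdm_mult[OF bdX bdX]] by (subst Bochner_Integration.integral_sum) (auto intro!: sum.cong Bochner_Integration.integral_sum)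
  also have "\<dots> \<le> (\<Sum>i\<in>{1..N}. \<Sum>j\<in>{1..N}. \<bar>prob (E i \<inter> E j) - \<pi> * \<pi>\<bar>)"
    by (intro sum_mono) (auto simp: cov)
  also have "\<dots> \<le> (\<Sum>i\<in>{1..N}. 2 * real d + real N * \<epsilon>)" by (intro sum_mono row)
  also have "\<dots> = real N * (2 * real d + real N * \<epsilon>)" by simp
  finally have sq: "(\<integral>\<omega>. (A \<omega>)\<^sup>2 \<partial>M) \<le> real N * (2 * real d + real N * \<epsilon>)" .
  have "(1 / real N) * (\<Sum>i=1..N. indicator (E i) \<omega>) - \<pi> = A \<omega> / real N" for \<omega>
    unfolding A_def using N by (simp add: sum_subtractf diff_divide_distrib)
  then have "prob {\<omega> \<in> space M. \<bar>(1 / real N) * (\<Sum>i=1..N. indicator (E i) \<omega>) - \<pi>\<bar> \<ge> e}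
    = prob {\<omega> \<in> space M. \<bar>A \<omega> / real N\<bar> \<ge> e}" by (simp only:)
  also have "\<dots> \<le> (l2norm M (\<lambda>\<omega>. A \<omega> / real N))\<^sup>2 / e\<^sup>2" by (rule chebyshev_l2norm[OF bdA e])
  also have "(l2norm M (\<lambda>\<omega>. A \<omega> / real N))\<^sup>2 = (\<integral>\<omega>. (A \<omega>)\<^sup>2 \<partial>M) / (real N)\<^sup>2"
    unfolding l2norm_sq by (simp add: power_divide)
  also have "\<dots> \<le> real N * (2 * real d + real N * \<epsilon>) / (real N)\<^sup>2"
    using sq by (intro divide_right_mono) auto
  also have "\<dots> = 2 * real d / real N + \<epsilon>" using N by (simp add: power2_eq_square field_simps)
  finally show ?thesis using e by (simp add: divide_right_mono)
qed

end

subsection \<open>Subsampling\<close>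


lemma prob_tendsto_zero_le:
  assumes "\<forall>\<^sub>F n in sequentially. measure M (A n) \<le> f n" "f \<longlonglongrightarrow> 0"
  shows "(\<lambda>n. measure M (A n)) \<longlonglongrightarrow> 0"
  using assms by (intro Lim_null_comparison[OF _ assms(2)]) (auto elim: eventually_mono)

definition root_event :: "'a measure \<Rightarrow> nat \<Rightarrow> ('a \<Rightarrow> real) \<Rightarrow> real \<Rightarrow> real \<Rightarrow> 'a set" where
  "root_event M l T c t = {\<omega> \<in> space M. sqrt (real l) * \<bar>T \<omega> - c\<bar> \<le> t}"

text \<open>Subsampling freed from the particular process. In \<open>mixing\<close> the gap
  \<open>m\<close> is chosen before \<open>n\<close>, so that \<open>b n + m\<close> stays
  negligible against \<open>n\<close>; events of equal radius suffice because only the variance of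
  one average is estimated.\<close>

locale subsampling = prob_space M for M :: "'a measure" +
  fixes \<theta> :: "nat \<Rightarrow> 'a \<Rightarrow> real" and \<Theta> :: "nat \<Rightarrow> nat \<Rightarrow> 'a \<Rightarrow> real"
    and \<theta>0 :: real and J :: "real \<Rightarrow> real" and b :: "nat \<Rightarrow> nat"
  assumes theta_measurable [measurable]: "\<And>n. \<theta> n \<in> borel_measurable M"
    and Theta_measurable [measurable]: "\<And>n i. \<Theta> n i \<in> borel_measurable M"
    and limit_law: "\<And>t. t > 0 \<Longrightarrow> (\<lambda>n. prob {\<omega> \<in> space M. sqrt (real n) * \<bar>\<theta> n \<omega> - \<theta>0\<bar> \<le> t}) \<longlonglongrightarrow> J t"
    and stationary: "\<forall>\<^sub>F n in sequentially. \<forall>i t. prob (root_event M (b n) (\<Theta> n i) \<theta>0 t)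
        = prob (root_event M (b n) (\<theta> (b n)) \<theta>0 t)"
    and mixing: "\<And>e. e > 0 \<Longrightarrow> \<exists>m. \<forall>\<^sub>F n in sequentially. \<forall>i j t. i + b n + m \<le> j \<longrightarrow>
        \<bar>prob (root_event M (b n) (\<Theta> n i) \<theta>0 t \<inter> root_event M (b n) (\<Theta> n j) \<theta>0 t)
         - prob (root_event M (b n) (\<Theta> n i) \<theta>0 t) * prob (root_event M (b n) (\<Theta> n j) \<theta>0 t)\<bar> \<le> e"
    and J_cont: "\<And>t. t > 0 \<Longrightarrow> isCont J t"
    and J_mono: "\<And>s t. 0 \<le> s \<Longrightarrow> s < t \<Longrightarrow> J s < J t"
    and J_zero: "(J \<longlongrightarrow> 0) (at_right 0)"
    and J_top: "(J \<longlongrightarrow> 1) at_top"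
    and b_inf: "filterlim b at_top sequentially"
    and b_rate: "(\<lambda>n. real (b n) / real n) \<longlonglongrightarrow> 0"
begin

text \<open>Natural subtraction gives 1 if \<open>b n\<close> exceeds \<open>n\<close>; by
  \<open>b_rate\<close> this concerns only finitely many \<open>n\<close>.\<close>

definition N :: "nat \<Rightarrow> nat" where
  "N n = n - b n + 1"

definition S :: "nat \<Rightarrow> real \<Rightarrow> 'a \<Rightarrow> real" where
  "S n \<eta> \<omega> = (1 / real (N n)) * (\<Sum>i=1..N n. if sqrt (real (b n)) * \<bar>\<Theta> n i \<omega> - \<theta> n \<omega>\<bar> \<le> \<eta> then 1 else 0)"

definition E :: "nat \<Rightarrow> real \<Rightarrow> nat \<Rightarrow> 'a set" where
  "E n t i = root_event M (b n) (\<Theta> n i) \<theta>0 t"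

text \<open>Centred at the true value, so that each summand involves the statistic of one block
  only; the centre of \<open>S\<close> uses the whole sample.\<close>

definition U :: "nat \<Rightarrow> real \<Rightarrow> 'a \<Rightarrow> real" where
  "U n t \<omega> = (1 / real (N n)) * (\<Sum>i=1..N n. indicator (E n t i) \<omega>)"

lemma E_events [measurable]: "E n t i \<in> events"
  unfolding E_def root_event_def by measurable

lemma U_measurable [measurable]: "U n t \<in> borel_measurable M"
  unfolding U_def[abs_def] by measurable

lemma S_measurable [measurable]: "S n t \<in> borel_measurable M"
  unfolding S_def[abs_def] by measurable

text \<open>The root at rate sqrt n is tight because \<open>J\<close> tends to 1 at infinity, and
  passing to rate sqrt b multiplies it by sqrt (b / n), which tends to 0.\<close>

lemma centering_negligible:
  assumes \<delta>: "\<delta> > 0"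
  shows "(\<lambda>n. prob {\<omega> \<in> space M. sqrt (real (b n)) * \<bar>\<theta> n \<omega> - \<theta>0\<bar> > \<delta>}) \<longlonglongrightarrow> 0"
proof (rule LIMSEQ_I)
  fix r :: real assume r: "r > 0"
  have "\<forall>\<^sub>F T in at_top. J T > 1 - r" using J_top by (rule order_tendstoD) (use r in simp)
  then have "\<forall>\<^sub>F T in at_top. J T > 1 - r \<and> T > 0" using eventually_gt_at_top[of 0] by eventually_elim simp
  then obtain T where T: "J T > 1 - r" "T > 0" using eventually_happens'[OF trivial_limit_at_top_linorder] by blast
  have "\<forall>\<^sub>F n in sequentially. prob {\<omega> \<in> space M. sqrt (real n) * \<bar>\<theta> n \<omega> - \<theta>0\<bar> \<le> T} > 1 - r"
    using limit_law[OF T(2)] T(1) by (rule order_tendstoD)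
  moreover have "\<forall>\<^sub>F n in sequentially. sqrt (real (b n) / real n) < \<delta> / T"
  proof -
    have "(\<lambda>n. sqrt (real (b n) / real n)) \<longlonglongrightarrow> sqrt 0" by (intro tendsto_real_sqrt b_rate)
    then show ?thesis by (rule order_tendstoD) (use \<delta> T in simp)
  qed
  ultimately have "\<forall>\<^sub>F n in sequentially. prob {\<omega> \<in> space M. sqrt (real (b n)) * \<bar>\<theta> n \<omega> - \<theta>0\<bar> > \<delta>} < r"
    using eventually_gt_at_top[of 0]
  proof eventually_elim
    case (elim n)
    have sub: "sqrt (real (b n)) * \<bar>\<theta> n \<omega> - \<theta>0\<bar> \<le> \<delta>" if "sqrt (real n) * \<bar>\<theta> n \<omega> - \<theta>0\<bar> \<le> T" for \<omega>
    proof -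
      have "sqrt (real (b n)) * \<bar>\<theta> n \<omega> - \<theta>0\<bar> = sqrt (real (b n) / real n) * (sqrt (real n) * \<bar>\<theta> n \<omega> - \<theta>0\<bar>)"
        using elim(3) by (simp add: real_sqrt_divide)
      also have "\<dots> \<le> (\<delta> / T) * T" using elim(2) that \<delta> T by (intro mult_mono) auto
      finally show ?thesis using T by simp
    qed
    have "prob {\<omega> \<in> space M. sqrt (real (b n)) * \<bar>\<theta> n \<omega> - \<theta>0\<bar> > \<delta>}
      \<le> prob (space M - {\<omega> \<in> space M. sqrt (real n) * \<bar>\<theta> n \<omega> - \<theta>0\<bar> \<le> T})"
      using sub by (intro finite_measure_mono) force+
    also have "\<dots> = 1 - prob {\<omega> \<in> space M. sqrt (real n) * \<bar>\<theta> n \<omega> - \<theta>0\<bar> \<le> T}"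
      by (rule prob_compl) measurable
    finally show ?case using elim(1) by linarith
  qed
  then show "\<exists>no. \<forall>n\<ge>no. norm (prob {\<omega> \<in> space M. sqrt (real (b n)) * \<bar>\<theta> n \<omega> - \<theta>0\<bar> > \<delta>} - 0) < r"
    by (simp add: eventually_sequentially)
qed

lemma block_ratio: "(\<lambda>n. 2 * real (b n + m) / real (N n)) \<longlonglongrightarrow> 0"
proof (rule Lim_null_comparison)
  have "(\<lambda>n. 4 * (real (b n) / real n + real m * (1 / real n))) \<longlonglongrightarrow> 4 * (0 + real m * 0)"
    by (intro tendsto_intros b_rate lim_1_over_n)
  then show "(\<lambda>n. 4 * (real (b n) / real n + real m * (1 / real n))) \<longlonglongrightarrow> 0" by simp
  have "\<forall>\<^sub>F n in sequentially. real (b n) / real n < 1 / 2" using b_rate by (rule order_tendstoD) simp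
  then show "\<forall>\<^sub>F n in sequentially. norm (2 * real (b n + m) / real (N n)) \<le> 4 * (real (b n) / real n + real m * (1 / real n))"
    using eventually_gt_at_top[of 0]
  proof eventually_elim
    case (elim n)
    have "real (b n) < real n / 2" using elim by (simp add: field_simps)
    then have "real (N n) \<ge> real n / 2" unfolding N_def by (simp add: of_nat_diff)
    then have "2 * real (b n + m) / real (N n) \<le> 2 * real (b n + m) / (real n / 2)"
      using elim by (intro divide_left_mono) auto
    also have "\<dots> = 4 * (real (b n) / real n + real m * (1 / real n))" using elim by (simp add: field_simps)
    finally show ?case by simp
  qed
qed

lemma U_tendsto:
  assumes t: "t > 0" and e: "e > 0"
  shows "(\<lambda>n. prob {\<omega> \<in> space M. \<bar>U n t \<omega> - J t\<bar> \<ge> e}) \<longlonglongrightarrow> 0"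
proof (rule LIMSEQ_I)
  fix r :: real assume r: "r > 0"
  \<comment> \<open>After division by \<open>(e / 2)\<^sup>2\<close> in the concentration bound, two
    contributions of size \<epsilon> add up to \<open>r\<close>.\<close>
  define \<epsilon> where "\<epsilon> = r * (e / 2)\<^sup>2 / 2"
  have \<epsilon>: "\<epsilon> > 0" using r e by (simp add: \<epsilon>_def)
  define \<pi> where "\<pi> n = prob (root_event M (b n) (\<theta> (b n)) \<theta>0 t)" for n
  obtain m where m: "\<forall>\<^sub>F n in sequentially. \<forall>i j t. i + b n + m \<le> j \<longrightarrow>
      \<bar>prob (E n t i \<inter> E n t j) - prob (E n t i) * prob (E n t j)\<bar> \<le> \<epsilon>"
    using mixing[OF \<epsilon>] unfolding E_def by blast
  have "\<pi> \<longlonglongrightarrow> J t" unfolding \<pi>_def root_event_def using filterlim_compose[OF limit_law[OF t] b_inf] .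
  then have "\<forall>\<^sub>F n in sequentially. dist (\<pi> n) (J t) < e / 2" by (rule tendstoD) (use e in simp)
  moreover have "\<forall>\<^sub>F n in sequentially. 2 * real (b n + m) / real (N n) < \<epsilon>"
    using block_ratio \<epsilon> by (rule order_tendstoD)
  ultimately have "\<forall>\<^sub>F n in sequentially. prob {\<omega> \<in> space M. \<bar>U n t \<omega> - J t\<bar> \<ge> e} < r"
    using m stationary
  proof eventually_elim
    case (elim n)
    have pi: "prob (E n t i) = \<pi> n" for i using elim(4) unfolding E_def \<pi>_def by blast
    have mixE: "\<bar>prob (E n t i \<inter> E n t j) - \<pi> n * \<pi> n\<bar> \<le> \<epsilon>" if "i + (b n + m) \<le> j" for i j
      using elim(3) that unfolding pi[symmetric] by (metis add.assoc pi)
    have "prob {\<omega> \<in> space M. \<bar>U n t \<omega> - J t\<bar> \<ge> e} \<le> prob {\<omega> \<in> space M. \<bar>U n t \<omega> - \<pi> n\<bar> \<ge> e / 2}"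
    proof (intro finite_measure_mono subsetI)
      fix \<omega> assume "\<omega> \<in> {\<omega> \<in> space M. \<bar>U n t \<omega> - J t\<bar> \<ge> e}"
      then show "\<omega> \<in> {\<omega> \<in> space M. \<bar>U n t \<omega> - \<pi> n\<bar> \<ge> e / 2}"
        using elim(1) abs_triangle_ineq[of "U n t \<omega> - \<pi> n" "\<pi> n - J t"] by (simp add: dist_real_def)
    qed measurable
    also have "\<dots> \<le> (2 * real (b n + m) / real (N n) + \<epsilon>) / (e / 2)\<^sup>2"
      unfolding U_def using e \<epsilon> mixE by (intro average_concentration) (auto simp: pi N_def)
    also have "\<dots> < (\<epsilon> + \<epsilon>) / (e / 2)\<^sup>2"
      using elim(2) e by (intro divide_strict_right_mono) auto
    also have "\<dots> = r" unfolding \<epsilon>_def using e by simp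
    finally show ?case .
  qed
  then show "\<exists>no. \<forall>n\<ge>no. norm (prob {\<omega> \<in> space M. \<bar>U n t \<omega> - J t\<bar> \<ge> e} - 0) < r"
    by (simp add: eventually_sequentially)
qed

text \<open>Moving the centre by at most \<delta> on the root scale changes each root by at most
  \<delta>; hence the sandwich between averages with fixed centre.\<close>

lemma U_le_S:
  assumes "\<omega> \<in> space M" "sqrt (real (b n)) * \<bar>\<theta> n \<omega> - \<theta>0\<bar> \<le> \<delta>"
  shows "U n (\<eta> - \<delta>) \<omega> \<le> S n \<eta> \<omega>" "S n \<eta> \<omega> \<le> U n (\<eta> + \<delta>) \<omega>"
proof -
  have tri: "sqrt (real (b n)) * \<bar>u - v\<bar> \<le> sqrt (real (b n)) * \<bar>u - w\<bar> + sqrt (real (b n)) * \<bar>w - v\<bar>" for u v w :: real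
    unfolding distrib_left[symmetric] by (intro mult_left_mono) auto
  have "sqrt (real (b n)) * \<bar>\<theta>0 - \<theta> n \<omega>\<bar> \<le> \<delta>" using assms(2) by (simp add: abs_minus_commute)
  note d = assms(2) this
  have "indicator (E n (\<eta> - \<delta>) i) \<omega> \<le> (if sqrt (real (b n)) * \<bar>\<Theta> n i \<omega> - \<theta> n \<omega>\<bar> \<le> \<eta> then 1 else 0 :: real)" for i
    using tri[of "\<Theta> n i \<omega>" "\<theta> n \<omega>" \<theta>0] d assms(1) by (auto simp: E_def root_event_def split: split_indicator)
  then show "U n (\<eta> - \<delta>) \<omega> \<le> S n \<eta> \<omega>"
    unfolding U_def S_def by (intro mult_left_mono sum_mono) auto
  have "(if sqrt (real (b n)) * \<bar>\<Theta> n i \<omega> - \<theta> n \<omega>\<bar> \<le> \<eta> then 1 else 0 :: real) \<le> indicator (E n (\<eta> + \<delta>) i) \<omega>" for i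
    using tri[of "\<Theta> n i \<omega>" \<theta>0 "\<theta> n \<omega>"] d assms(1) by (auto simp: E_def root_event_def split: split_indicator)
  then show "S n \<eta> \<omega> \<le> U n (\<eta> + \<delta>) \<omega>"
    unfolding U_def S_def by (intro mult_left_mono sum_mono) auto
qed

lemma S_tendsto:
  assumes \<eta>: "\<eta> > 0" and e: "e > 0"
  shows "(\<lambda>n. prob {\<omega> \<in> space M. \<bar>S n \<eta> \<omega> - J \<eta>\<bar> \<ge> e}) \<longlonglongrightarrow> 0"
proof -
  obtain d where d: "d > 0" "\<And>s. \<bar>s - \<eta>\<bar> < d \<Longrightarrow> \<bar>J s - J \<eta>\<bar> < e / 2"
    using J_cont[OF \<eta>] e unfolding continuous_at_eps_delta dist_real_def by (metis half_gt_zero)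
  define \<delta> where "\<delta> = min (d / 2) (\<eta> / 2)"
  have \<delta>: "0 < \<delta>" "\<delta> < d" "\<delta> < \<eta>" using d \<eta> by (auto simp: \<delta>_def)
  have J1: "J (\<eta> + \<delta>) < J \<eta> + e / 2" "J (\<eta> - \<delta>) > J \<eta> - e / 2"
    using d(2)[of "\<eta> + \<delta>"] d(2)[of "\<eta> - \<delta>"] \<delta> unfolding abs_less_iff by auto
  let ?A = "\<lambda>n. {\<omega> \<in> space M. sqrt (real (b n)) * \<bar>\<theta> n \<omega> - \<theta>0\<bar> > \<delta>}"
  let ?B = "\<lambda>n. {\<omega> \<in> space M. \<bar>U n (\<eta> - \<delta>) \<omega> - J (\<eta> - \<delta>)\<bar> \<ge> e / 2}"
  let ?C = "\<lambda>n. {\<omega> \<in> space M. \<bar>U n (\<eta> + \<delta>) \<omega> - J (\<eta> + \<delta>)\<bar> \<ge> e / 2}"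
  show ?thesis
  proof (rule prob_tendsto_zero_le)
    show "\<forall>\<^sub>F n in sequentially. prob {\<omega> \<in> space M. \<bar>S n \<eta> \<omega> - J \<eta>\<bar> \<ge> e} \<le> prob (?A n) + prob (?B n) + prob (?C n)"
    proof (intro always_eventually allI)
      fix n
      have "{\<omega> \<in> space M. \<bar>S n \<eta> \<omega> - J \<eta>\<bar> \<ge> e} \<subseteq> (?A n \<union> ?B n) \<union> ?C n"
      proof (intro subsetI, rule ccontr)
        fix \<omega> assume w: "\<omega> \<in> {\<omega> \<in> space M. \<bar>S n \<eta> \<omega> - J \<eta>\<bar> \<ge> e}" "\<omega> \<notin> (?A n \<union> ?B n) \<union> ?C n"
        then have "sqrt (real (b n)) * \<bar>\<theta> n \<omega> - \<theta>0\<bar> \<le> \<delta>" "\<bar>U n (\<eta> - \<delta>) \<omega> - J (\<eta> - \<delta>)\<bar> < e / 2"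
          "\<bar>U n (\<eta> + \<delta>) \<omega> - J (\<eta> + \<delta>)\<bar> < e / 2" by auto
        moreover have "U n (\<eta> - \<delta>) \<omega> \<le> S n \<eta> \<omega>" "S n \<eta> \<omega> \<le> U n (\<eta> + \<delta>) \<omega>"
          using w calculation(1) U_le_S[of \<omega> n \<delta> \<eta>] by auto
        ultimately have "\<bar>S n \<eta> \<omega> - J \<eta>\<bar> < e" using J1 unfolding abs_less_iff by linarith
        then show False using w by simp
      qed
      then have "prob {\<omega> \<in> space M. \<bar>S n \<eta> \<omega> - J \<eta>\<bar> \<ge> e} \<le> prob ((?A n \<union> ?B n) \<union> ?C n)"
        by (intro finite_measure_mono) measurable
      also have "\<dots> \<le> prob (?A n \<union> ?B n) + prob (?C n)" by (intro measure_Un_le) measurable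
      also have "prob (?A n \<union> ?B n) \<le> prob (?A n) + prob (?B n)" by (intro measure_Un_le) measurable
      finally show "prob {\<omega> \<in> space M. \<bar>S n \<eta> \<omega> - J \<eta>\<bar> \<ge> e} \<le> prob (?A n) + prob (?B n) + prob (?C n)" by simp
    qed
    have "(\<lambda>n. prob (?A n) + prob (?B n) + prob (?C n)) \<longlonglongrightarrow> 0 + 0 + 0"
      using \<delta> \<eta> e by (intro tendsto_add centering_negligible U_tendsto) auto
    then show "(\<lambda>n. prob (?A n) + prob (?B n) + prob (?C n)) \<longlonglongrightarrow> 0" by simp
  qed
qed

theorem subsampling_consistent:
  assumes \<eta>: "\<eta> > 0"
  shows "conv_prob_zero M (\<lambda>n \<omega>. S n \<eta> \<omega> - prob {\<omega>' \<in> space M. sqrt (real n) * \<bar>\<theta> n \<omega>' - \<theta>0\<bar> \<le> \<eta>})"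
  unfolding conv_prob_zero_def
proof (intro allI impI)
  fix e :: real assume e: "e > 0"
  let ?p = "\<lambda>n. prob {\<omega>' \<in> space M. sqrt (real n) * \<bar>\<theta> n \<omega>' - \<theta>0\<bar> \<le> \<eta>}"
  show "(\<lambda>n. prob {\<omega> \<in> space M. e < \<bar>S n \<eta> \<omega> - ?p n\<bar>}) \<longlonglongrightarrow> 0"
  proof (rule prob_tendsto_zero_le)
    have "\<forall>\<^sub>F n in sequentially. dist (?p n) (J \<eta>) < e / 2"
      using limit_law[OF \<eta>] by (rule tendstoD) (use e in simp)
    then show "\<forall>\<^sub>F n in sequentially. prob {\<omega> \<in> space M. e < \<bar>S n \<eta> \<omega> - ?p n\<bar>} \<le> prob {\<omega> \<in> space M. \<bar>S n \<eta> \<omega> - J \<eta>\<bar> \<ge> e / 2}"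
    proof eventually_elim
      case (elim n)
      show ?case
      proof (intro finite_measure_mono subsetI)
        fix \<omega> assume "\<omega> \<in> {\<omega> \<in> space M. e < \<bar>S n \<eta> \<omega> - ?p n\<bar>}"
        then show "\<omega> \<in> {\<omega> \<in> space M. \<bar>S n \<eta> \<omega> - J \<eta>\<bar> \<ge> e / 2}"
          using elim abs_triangle_ineq[of "S n \<eta> \<omega> - J \<eta>" "J \<eta> - ?p n"]
          by (simp add: dist_real_def abs_minus_commute)
      qed measurable
    qed
    show "(\<lambda>n. prob {\<omega> \<in> space M. \<bar>S n \<eta> \<omega> - J \<eta>\<bar> \<ge> e / 2}) \<longlonglongrightarrow> 0"
      using \<eta> e by (intro S_tendsto) auto
  qed
qed

definition crit :: "nat \<Rightarrow> real \<Rightarrow> 'a \<Rightarrow> real" where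
  "crit n \<beta> \<omega> = Inf {\<eta>. \<beta> \<le> S n \<eta> \<omega>}"

definition roots :: "nat \<Rightarrow> 'a \<Rightarrow> real list" where
  "roots n \<omega> = map (\<lambda>i. sqrt (real (b n)) * \<bar>\<Theta> n i \<omega> - \<theta> n \<omega>\<bar>) [1..<N n + 1]"

lemma S_eq_count: "S n \<eta> \<omega> = real (length (filter (\<lambda>v. v \<le> \<eta>) (roots n \<omega>))) / real (length (roots n \<omega>))"
proof -
  let ?T = "\<lambda>i. sqrt (real (b n)) * \<bar>\<Theta> n i \<omega> - \<theta> n \<omega>\<bar>"
  have "length (filter (\<lambda>v. v \<le> \<eta>) (roots n \<omega>)) = length (filter (\<lambda>i. ?T i \<le> \<eta>) [1..<N n + 1])"
    unfolding roots_def by (simp add: filter_map comp_def del: upt_Suc)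
  also have "\<dots> = card {i \<in> {1..N n}. ?T i \<le> \<eta>}"
    by (subst distinct_length_filter) (auto intro!: arg_cong[where f=card] simp del: upt_Suc)
  also have "real \<dots> = (\<Sum>i=1..N n. if ?T i \<le> \<eta> then 1 else 0)"
    by (simp add: sum.inter_filter[symmetric])
  finally show ?thesis unfolding S_def by (simp add: roots_def del: upt_Suc)
qed

text \<open>The critical value is itself a sample quantile, namely of the subsampling roots, which
  makes the quantile lemmas available for it.\<close>

lemma crit_eq: "crit n \<beta> \<omega> = emp_quantile (roots n \<omega>) \<beta>"
  unfolding crit_def emp_quantile_def S_eq_count ..

lemma crit_le_iff: assumes "0 < \<beta>" "\<beta> \<le> 1" shows "crit n \<beta> \<omega> \<le> t \<longleftrightarrow> \<beta> \<le> S n t \<omega>"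
  unfolding crit_eq S_eq_count
  by (subst emp_quantile_le_iff) (use assms in \<open>auto simp: roots_def N_def pos_le_divide_eq simp del: upt_Suc\<close>)

text \<open>\<open>J\<close> is strictly increasing around its quantile \<open>c\<close>, so
  convergence of \<open>S\<close> at \<open>c - \<delta>\<close> and \<open>c + \<delta>\<close>
  confines the critical value to that interval with probability tending to 1; continuity of
  \<open>J\<close> at \<open>c\<close> then gives the coverage.\<close>

theorem subsampling_coverage:
  assumes \<beta>: "0 < \<beta>" "\<beta> < 1"
  shows "(\<lambda>n. prob {\<omega> \<in> space M. sqrt (real n) * \<bar>\<theta> n \<omega> - \<theta>0\<bar> \<le> crit n \<beta> \<omega>}) \<longlonglongrightarrow> \<beta>"
proof -
  have crit_measurable [measurable]: "crit n \<beta> \<in> borel_measurable M" for n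
    unfolding crit_eq[abs_def] roots_def by (rule emp_quantile_measurable) (use \<beta> in auto)
  \<comment> \<open>\<open>J_zero\<close> and \<open>J_top\<close> supply values of \<open>J\<close>
    on both sides of \<beta> for the intermediate value theorem.\<close>
  obtain c where c: "c > 0" "J c = \<beta>"
  proof -
    have "\<forall>\<^sub>F s in at_right 0. J s < \<beta>" using J_zero \<beta>(1) by (rule order_tendstoD)
    then have "\<forall>\<^sub>F s in at_right 0. J s < \<beta> \<and> s > 0" using eventually_at_right_less[of 0] by eventually_elim simp
    then obtain s where s: "J s < \<beta>" "s > 0" using eventually_happens'[OF trivial_limit_at_right_real] by blast
    have "\<forall>\<^sub>F T in at_top. J T > \<beta>" using J_top \<beta>(2) by (rule order_tendstoD)
    then have "\<forall>\<^sub>F T in at_top. J T > \<beta> \<and> T > s" using eventually_gt_at_top[of s] by eventually_elim simp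
    then obtain T where T: "J T > \<beta>" "T > s" using eventually_happens'[OF trivial_limit_at_top_linorder] by blast
    have "\<exists>x\<ge>s. x \<le> T \<and> J x = \<beta>" using s T J_cont by (intro IVT) auto
    then obtain y where "s \<le> y" "J y = \<beta>" by blast
    then show thesis using s(2) by (intro that[of y]) auto
  qed
  let ?X = "\<lambda>n \<omega>. sqrt (real n) * \<bar>\<theta> n \<omega> - \<theta>0\<bar>"
  let ?P = "\<lambda>n. prob {\<omega> \<in> space M. ?X n \<omega> \<le> crit n \<beta> \<omega>}"
  show ?thesis
  proof (rule LIMSEQ_I)
    fix r :: real assume r: "r > 0"
    obtain d where d: "d > 0" "\<And>s. \<bar>s - c\<bar> < d \<Longrightarrow> \<bar>J s - J c\<bar> < r / 2"
      using J_cont[OF c(1)] r unfolding continuous_at_eps_delta dist_real_def by (metis half_gt_zero)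
    define \<delta> where "\<delta> = min (d / 2) (c / 2)"
    have \<delta>: "0 < \<delta>" "\<delta> < d" "\<delta> < c" using d c by (auto simp: \<delta>_def)
    have J1: "J (c + \<delta>) < \<beta> + r / 2" "J (c - \<delta>) > \<beta> - r / 2"
      using d(2)[of "c + \<delta>"] d(2)[of "c - \<delta>"] \<delta> c unfolding abs_less_iff by auto
    have J2: "J (c - \<delta>) < \<beta>" "\<beta> < J (c + \<delta>)"
      using J_mono[of "c - \<delta>" c] J_mono[of c "c + \<delta>"] \<delta> c by auto
    have hi: "(\<lambda>n. prob {\<omega> \<in> space M. crit n \<beta> \<omega> > c + \<delta>}) \<longlonglongrightarrow> 0"
    proof (rule prob_tendsto_zero_le)
      show "(\<lambda>n. prob {\<omega> \<in> space M. \<bar>S n (c + \<delta>) \<omega> - J (c + \<delta>)\<bar> \<ge> J (c + \<delta>) - \<beta>}) \<longlonglongrightarrow> 0"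
        using c \<delta> J2 by (intro S_tendsto) auto
      show "\<forall>\<^sub>F n in sequentially. prob {\<omega> \<in> space M. crit n \<beta> \<omega> > c + \<delta>}
        \<le> prob {\<omega> \<in> space M. \<bar>S n (c + \<delta>) \<omega> - J (c + \<delta>)\<bar> \<ge> J (c + \<delta>) - \<beta>}"
      proof (intro always_eventually allI finite_measure_mono subsetI)
        fix n \<omega> assume "\<omega> \<in> {\<omega> \<in> space M. crit n \<beta> \<omega> > c + \<delta>}"
        then have "S n (c + \<delta>) \<omega> < \<beta>" "\<omega> \<in> space M" using crit_le_iff[of \<beta> n \<omega> "c + \<delta>"] \<beta> by auto
        then show "\<omega> \<in> {\<omega> \<in> space M. \<bar>S n (c + \<delta>) \<omega> - J (c + \<delta>)\<bar> \<ge> J (c + \<delta>) - \<beta>}"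
          using abs_ge_minus_self[of "S n (c + \<delta>) \<omega> - J (c + \<delta>)"] by simp
      qed measurable
    qed
    have lo: "(\<lambda>n. prob {\<omega> \<in> space M. crit n \<beta> \<omega> \<le> c - \<delta>}) \<longlonglongrightarrow> 0"
    proof (rule prob_tendsto_zero_le)
      show "(\<lambda>n. prob {\<omega> \<in> space M. \<bar>S n (c - \<delta>) \<omega> - J (c - \<delta>)\<bar> \<ge> \<beta> - J (c - \<delta>)}) \<longlonglongrightarrow> 0"
        using c \<delta> J2 by (intro S_tendsto) auto
      show "\<forall>\<^sub>F n in sequentially. prob {\<omega> \<in> space M. crit n \<beta> \<omega> \<le> c - \<delta>}
        \<le> prob {\<omega> \<in> space M. \<bar>S n (c - \<delta>) \<omega> - J (c - \<delta>)\<bar> \<ge> \<beta> - J (c - \<delta>)}"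
      proof (intro always_eventually allI finite_measure_mono subsetI)
        fix n \<omega> assume "\<omega> \<in> {\<omega> \<in> space M. crit n \<beta> \<omega> \<le> c - \<delta>}"
        then have "\<beta> \<le> S n (c - \<delta>) \<omega>" "\<omega> \<in> space M" using crit_le_iff[of \<beta> n \<omega> "c - \<delta>"] \<beta> by auto
        then show "\<omega> \<in> {\<omega> \<in> space M. \<bar>S n (c - \<delta>) \<omega> - J (c - \<delta>)\<bar> \<ge> \<beta> - J (c - \<delta>)}"
          using abs_ge_self[of "S n (c - \<delta>) \<omega> - J (c - \<delta>)"] by simp
      qed measurable
    qed
    have "(\<lambda>n. prob {\<omega> \<in> space M. ?X n \<omega> \<le> c + \<delta>} + prob {\<omega> \<in> space M. crit n \<beta> \<omega> > c + \<delta>}) \<longlonglongrightarrow> J (c + \<delta>) + 0"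
      using c \<delta> by (intro tendsto_add limit_law hi) auto
    then have 1: "\<forall>\<^sub>F n in sequentially. prob {\<omega> \<in> space M. ?X n \<omega> \<le> c + \<delta>} + prob {\<omega> \<in> space M. crit n \<beta> \<omega> > c + \<delta>} < \<beta> + r"
      by (rule order_tendstoD) (use J1 r in simp)
    have "(\<lambda>n. prob {\<omega> \<in> space M. ?X n \<omega> \<le> c - \<delta>} - prob {\<omega> \<in> space M. crit n \<beta> \<omega> \<le> c - \<delta>}) \<longlonglongrightarrow> J (c - \<delta>) - 0"
      using c \<delta> by (intro tendsto_diff limit_law lo) auto
    then have 2: "\<forall>\<^sub>F n in sequentially. \<beta> - r < prob {\<omega> \<in> space M. ?X n \<omega> \<le> c - \<delta>} - prob {\<omega> \<in> space M. crit n \<beta> \<omega> \<le> c - \<delta>}"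
      by (rule order_tendstoD) (use J1 r in simp)
    from 1 2 have "\<forall>\<^sub>F n in sequentially. \<bar>?P n - \<beta>\<bar> < r"
    proof eventually_elim
      case (elim n)
      have "?P n \<le> prob ({\<omega> \<in> space M. ?X n \<omega> \<le> c + \<delta>} \<union> {\<omega> \<in> space M. crit n \<beta> \<omega> > c + \<delta>})"
        by (intro finite_measure_mono) auto
      also have "\<dots> \<le> prob {\<omega> \<in> space M. ?X n \<omega> \<le> c + \<delta>} + prob {\<omega> \<in> space M. crit n \<beta> \<omega> > c + \<delta>}"
        by (intro measure_Un_le) measurable
      finally have u: "?P n < \<beta> + r" using elim by linarith
      have "prob {\<omega> \<in> space M. ?X n \<omega> \<le> c - \<delta>} \<le> prob ({\<omega> \<in> space M. ?X n \<omega> \<le> crit n \<beta> \<omega>} \<union> {\<omega> \<in> space M. crit n \<beta> \<omega> \<le> c - \<delta>})"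
        by (intro finite_measure_mono) auto
      also have "\<dots> \<le> ?P n + prob {\<omega> \<in> space M. crit n \<beta> \<omega> \<le> c - \<delta>}"
        by (intro measure_Un_le) measurable
      finally have l: "?P n > \<beta> - r" using elim by linarith
      show ?case using u l unfolding abs_less_iff by linarith
    qed
    then show "\<exists>no. \<forall>n\<ge>no. norm (?P n - \<beta>) < r" by (simp add: eventually_sequentially)
  qed
qed

end

subsection \<open>Sample quantiles of a transformed linear process\<close>


lemma std_normal_cdf_strict_mono:
  assumes "s < t"
  shows "cdf std_normal_distribution s < cdf std_normal_distribution t"
proof -
  interpret real_distribution std_normal_distribution by (rule real_dist_normal_dist)
  have "measure std_normal_distribution {s<..t} \<noteq> 0"
  proof
    assume "measure std_normal_distribution {s<..t} = 0"
    then have "emeasure std_normal_distribution {s<..t} = 0" by (simp add: emeasure_eq_measure)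
    then have "(\<integral>\<^sup>+y. ennreal (std_normal_density y) * indicator {s<..t} y \<partial>lborel) = 0"
      by (subst (asm) emeasure_density) auto
    then have "AE y in lborel. ennreal (std_normal_density y) * indicator {s<..t} y = 0"
      by (subst (asm) nn_integral_0_iff_AE) auto
    then have "AE y in lborel. y \<notin> {s<..t}"
    proof eventually_elim
      case (elim y)
      have "std_normal_density y > 0" by (rule normal_density_pos) simp
      then show ?case using elim by (auto split: split_indicator_asm simp del: std_normal_density_def)
    qed
    then have "emeasure lborel {s<..t} = 0" by (subst (asm) AE_iff_measurable[of "{s<..t}"]) auto
    then show False using assms by simp
  qed
  then have "measure std_normal_distribution {s<..t} > 0"
    using measure_nonneg[of std_normal_distribution "{s<..t}"] by linarith
  then show ?thesis using cdf_diff_eq[OF assms] by linarith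
qed

text \<open>The event that an absolute value is at most t is a closed half line minus an open one,
  so the lower end calls for the strict inequality.\<close>

lemma (in prob_space) strict_cdf_tendsto:
  fixes X :: "nat \<Rightarrow> 'a \<Rightarrow> real" and F :: "real \<Rightarrow> real"
  assumes [measurable]: "\<And>n. X n \<in> borel_measurable M"
    and lim: "\<And>t. (\<lambda>n. prob {\<omega> \<in> space M. X n \<omega> \<le> t}) \<longlonglongrightarrow> F t" and F: "isCont F t"
  shows "(\<lambda>n. prob {\<omega> \<in> space M. X n \<omega> < t}) \<longlonglongrightarrow> F t"
proof (rule LIMSEQ_I)
  fix r :: real assume r: "r > 0"
  obtain d where d: "d > 0" "\<And>s. \<bar>s - t\<bar> < d \<Longrightarrow> \<bar>F s - F t\<bar> < r"
    using F r unfolding continuous_at_eps_delta dist_real_def by metis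
  define u where "u = t - d / 2"
  have "\<bar>F u - F t\<bar> < r" using d by (intro d(2)) (auto simp: u_def)
  then have "F t - r < F u" unfolding abs_less_iff by linarith
  with lim[of u] have "\<forall>\<^sub>F n in sequentially. F t - r < prob {\<omega> \<in> space M. X n \<omega> \<le> u}"
    by (rule order_tendstoD)
  moreover have "\<forall>\<^sub>F n in sequentially. prob {\<omega> \<in> space M. X n \<omega> \<le> t} < F t + r"
    using lim[of t] by (rule order_tendstoD) (use r in simp)
  ultimately have "\<forall>\<^sub>F n in sequentially. \<bar>prob {\<omega> \<in> space M. X n \<omega> < t} - F t\<bar> < r"
  proof eventually_elim
    case (elim n)
    have "prob {\<omega> \<in> space M. X n \<omega> \<le> u} \<le> prob {\<omega> \<in> space M. X n \<omega> < t}"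
      "prob {\<omega> \<in> space M. X n \<omega> < t} \<le> prob {\<omega> \<in> space M. X n \<omega> \<le> t}"
      using d by (auto intro!: finite_measure_mono simp: u_def)
    then show ?case using elim unfolding abs_less_iff by linarith
  qed
  then show "\<exists>no. \<forall>n\<ge>no. norm (prob {\<omega> \<in> space M. X n \<omega> < t} - F t) < r"
    by (simp add: eventually_sequentially)
qed

section \<open>Stationarity and mixing of block quantiles\<close>

lemma (in prob_space) alpha_coef_upper:
  assumes "A \<in> gen_sigma M X {..0}" "B \<in> gen_sigma M X {m..}"
  shows "\<bar>prob (A \<inter> B) - prob A * prob B\<bar> \<le> alpha_coef M X m"
  unfolding alpha_coef_def
proof (rule cSup_upper)
  show "\<bar>prob (A \<inter> B) - prob A * prob B\<bar> \<in> {\<bar>prob (A \<inter> B) - prob A * prob B\<bar> | A B.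
      A \<in> gen_sigma M X {..0} \<and> B \<in> gen_sigma M X {m..}}" using assms by blast
  show "bdd_above {\<bar>prob (A \<inter> B) - prob A * prob B\<bar> | A B.
      A \<in> gen_sigma M X {..0} \<and> B \<in> gen_sigma M X {m..}}"
  proof (rule bdd_aboveI[where M=1])
    fix y assume "y \<in> {\<bar>prob (A \<inter> B) - prob A * prob B\<bar> | A B.
      A \<in> gen_sigma M X {..0} \<and> B \<in> gen_sigma M X {m..}}"
    then obtain A B where y: "y = \<bar>prob (A \<inter> B) - prob A * prob B\<bar>" by blast
    have "0 \<le> prob A * prob B" "prob A * prob B \<le> 1" by (auto intro!: mult_le_one)
    then show "y \<le> 1" unfolding y abs_le_iff
      using prob_le_1[of "A \<inter> B"] measure_nonneg[of M "A \<inter> B"] by linarith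
  qed
qed

text \<open>The generated sigma algebra packed as a measure space, so that measurability over a time
  window can be stated for functions.\<close>

definition gen_measure :: "'a measure \<Rightarrow> (int \<Rightarrow> 'a \<Rightarrow> real) \<Rightarrow> int set \<Rightarrow> 'a measure" where
  "gen_measure M X I = sigma (space M) (\<Union>i\<in>I. {X i -` A \<inter> space M | A. A \<in> sets borel})"

lemma space_gen_measure [simp]: "space (gen_measure M X I) = space M"
  unfolding gen_measure_def by (auto intro!: space_measure_of)

lemma sets_gen_measure: "sets (gen_measure M X I) = gen_sigma M X I"
  unfolding gen_measure_def gen_sigma_def by (rule sets_measure_of) auto

lemma gen_measure_measurable: "i \<in> I \<Longrightarrow> X i \<in> borel_measurable (gen_measure M X I)"
  by (rule measurableI) (auto simp: sets_gen_measure gen_sigma_def intro!: sigma_sets.Basic)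

context linear_process begin

text \<open>The right side is free of \<open>s\<close>: almost surely the past of \<open>Z\<close>
  is one fixed function of \<open>pst s\<close>, whose law is always \<open>Sq\<close>. Strict
  stationarity of \<open>Z\<close> thus follows from the i.i.d. innovations.\<close>

lemma past_law:
  assumes C: "C \<in> sets (PiM UNIV (\<lambda>_::nat. borel))"
  shows "prob {\<omega> \<in> space M. (\<lambda>i. Z (s - int i) \<omega>) \<in> C} = measure Sq {w. (\<lambda>i. tail a 0 (sh i w)) \<in> C}"
proof -
  define zs where "zs w = (\<lambda>i. tail a 0 (sh i w))" for w
  have zs [measurable]: "zs \<in> measurable Sq (PiM UNIV (\<lambda>_. borel))"
    unfolding zs_def[abs_def] by (rule measurable_PiM_single') auto
  have Zm [measurable]: "(\<lambda>\<omega> i. Z (s - int i) \<omega>) \<in> measurable M (PiM UNIV (\<lambda>_. borel))"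
    by (rule measurable_PiM_single') auto
  have "AE \<omega> in M. \<forall>i. Z (s - int i) \<omega> = tail a 0 (pst (s - int i) \<omega>)"
    by (subst AE_all_countable) (use Z_eq_tail in blast)
  then have ae: "AE \<omega> in M. (\<lambda>i. Z (s - int i) \<omega>) = zs (pst s \<omega>)"
    by eventually_elim (simp add: zs_def pst_shift)
  have "prob {\<omega> \<in> space M. (\<lambda>i. Z (s - int i) \<omega>) \<in> C} = prob {\<omega> \<in> space M. zs (pst s \<omega>) \<in> C}"
  proof (rule finite_measure_eq_AE)
    show "AE \<omega> in M. \<omega> \<in> {\<omega> \<in> space M. (\<lambda>i. Z (s - int i) \<omega>) \<in> C} \<longleftrightarrow> \<omega> \<in> {\<omega> \<in> space M. zs (pst s \<omega>) \<in> C}"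
      using ae by eventually_elim simp
  qed (use C in measurable)
  also have "\<dots> = measure (distr M Sq (pst s)) {w. zs w \<in> C}"
    using measurable_sets[OF zs C] by (subst measure_distr) (auto intro!: arg_cong[where f=prob] simp: vimage_def)
  also have "\<dots> = measure Sq {w. zs w \<in> C}" by (simp add: distr_pst)
  finally show ?thesis unfolding zs_def .
qed

definition bq :: "(real \<Rightarrow> real) \<Rightarrow> real \<Rightarrow> nat \<Rightarrow> int \<Rightarrow> 'a \<Rightarrow> real" where
  "bq g p l k \<omega> = emp_quantile (map (\<lambda>j. g (Z (k + int j) \<omega>)) [0..<l]) p"

text \<open>The block quantile as a functional of the reversed past, the block starting
  \<open>d\<close> steps before the observer. The condition \<open>l \<le> Suc d\<close> in
  \<open>bq_eq_pq\<close> keeps the natural subtraction from being cut at 0.\<close>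

definition pq :: "(real \<Rightarrow> real) \<Rightarrow> real \<Rightarrow> nat \<Rightarrow> nat \<Rightarrow> (nat \<Rightarrow> real) \<Rightarrow> real" where
  "pq g p l d w = emp_quantile (map (\<lambda>j. g (w (d - j))) [0..<l]) p"

lemma bq_eq_pq: "l \<le> Suc d \<Longrightarrow> bq g p l (s - int d) \<omega> = pq g p l d (\<lambda>i. Z (s - int i) \<omega>)"
  unfolding bq_def pq_def
  by (intro arg_cong2[where f=emp_quantile] map_cong refl) (auto simp: of_nat_diff algebra_simps)

context
  fixes g :: "real \<Rightarrow> real" and p :: real
  assumes g [measurable]: "g \<in> borel_measurable borel" and p: "0 < p" "p \<le> 1"
begin

lemma pq_measurable [measurable]: "pq g p l d \<in> borel_measurable (PiM UNIV (\<lambda>_. borel))"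
  unfolding pq_def[abs_def] by (rule emp_quantile_measurable) (use p in measurable)

lemma bq_measurable_gen:
  assumes "{k..<k + int l} \<subseteq> I"
  shows "bq g p l k \<in> borel_measurable (gen_measure M Z I)"
  unfolding bq_def[abs_def]
proof (rule emp_quantile_measurable)
  fix j assume "j \<in> set [0..<l]"
  then have "Z (k + int j) \<in> borel_measurable (gen_measure M Z I)"
    using assms by (intro gen_measure_measurable) auto
  then show "(\<lambda>\<omega>. g (Z (k + int j) \<omega>)) \<in> borel_measurable (gen_measure M Z I)" by measurable
qed (use p in auto)

lemma bq_measurable [measurable]: "bq g p l k \<in> borel_measurable M"
  unfolding bq_def[abs_def] by (rule emp_quantile_measurable) (use p in measurable)

lemma bq_shift:
  assumes B: "B \<in> sets borel"
  shows "prob {\<omega> \<in> space M. bq g p l k \<omega> \<in> B} = prob {\<omega> \<in> space M. bq g p l k' \<omega> \<in> B}"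
proof -
  let ?C = "{w. pq g p l l w \<in> B}"
  have C: "?C \<in> sets (PiM UNIV (\<lambda>_. borel))"
    using measurable_sets[OF pq_measurable B, of l l] by (simp add: space_PiM vimage_def)
  have *: "prob {\<omega> \<in> space M. bq g p l k \<omega> \<in> B} = measure Sq {w. (\<lambda>i. tail a 0 (sh i w)) \<in> ?C}" for k
    using past_law[OF C, of "k + int l"] bq_eq_pq[of l l g p "k + int l"] by simp
  show ?thesis by (rule trans[OF * *[symmetric]])
qed

text \<open>Both blocks are read off one past, observed at time \<open>k' + int l\<close>, so their
  joint law inherits its stationarity.\<close>

lemma bq_shift2:
  assumes B: "B \<in> sets borel" and k: "k \<le> k'"
  shows "prob ({\<omega> \<in> space M. bq g p l k \<omega> \<in> B} \<inter> {\<omega> \<in> space M. bq g p l k' \<omega> \<in> B})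
    = prob ({\<omega> \<in> space M. bq g p l (k + u) \<omega> \<in> B} \<inter> {\<omega> \<in> space M. bq g p l (k' + u) \<omega> \<in> B})"
proof -
  obtain d where d: "k' = k + int d" using k zle_iff_zadd by blast
  let ?C = "{w. pq g p l (l + d) w \<in> B} \<inter> {w. pq g p l l w \<in> B}"
  have C: "?C \<in> sets (PiM UNIV (\<lambda>_. borel))"
    using measurable_sets[OF pq_measurable B, of l l] measurable_sets[OF pq_measurable B, of l "l + d"]
    by (intro sets.Int) (simp_all add: space_PiM vimage_def)
  have "prob ({\<omega> \<in> space M. bq g p l k \<omega> \<in> B} \<inter> {\<omega> \<in> space M. bq g p l (k + int d) \<omega> \<in> B})
    = measure Sq {w. (\<lambda>i. tail a 0 (sh i w)) \<in> ?C}" for k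
  proof -
    have 1: "bq g p l k \<omega> = pq g p l (l + d) (\<lambda>i. Z (k + int (l + d) - int i) \<omega>)" for \<omega>
      using bq_eq_pq[of l "l + d" g p "k + int (l + d)" \<omega>] by simp
    have 2: "bq g p l (k + int d) \<omega> = pq g p l l (\<lambda>i. Z (k + int (l + d) - int i) \<omega>)" for \<omega>
      using bq_eq_pq[of l l g p "k + int (l + d)" \<omega>] by (simp add: algebra_simps)
    show ?thesis unfolding past_law[OF C, of "k + int (l + d)", symmetric] 1 2
      by (rule arg_cong[where f=prob]) auto
  qed
  from this[of k] this[of "k + u"] show ?thesis unfolding d by (simp add: algebra_simps)
qed

lemma bq_mixing:
  assumes B: "B \<in> sets borel" and k: "k + int l + int m \<le> k' + 1"
  shows "\<bar>prob ({\<omega> \<in> space M. bq g p l k \<omega> \<in> B} \<inter> {\<omega> \<in> space M. bq g p l k' \<omega> \<in> B})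
    - prob {\<omega> \<in> space M. bq g p l k \<omega> \<in> B} * prob {\<omega> \<in> space M. bq g p l k' \<omega> \<in> B}\<bar> \<le> alpha_coef M Z (int m)"
proof (cases "k \<le> k'")
  case True
  \<comment> \<open>The shift that makes the first block end at time 0, as \<open>alpha_coef\<close>
    demands.\<close>
  define u where "u = 1 - int l - k"
  let ?E = "\<lambda>k. {\<omega> \<in> space M. bq g p l k \<omega> \<in> B}"
  have E: "?E k \<in> gen_sigma M Z I" if "{k..<k + int l} \<subseteq> I" for k I
    using measurable_sets[OF bq_measurable_gen[OF that] B]
    by (simp add: sets_gen_measure vimage_def Int_def conj_commute)
  have "prob (?E k \<inter> ?E k') = prob (?E (k + u) \<inter> ?E (k' + u))" by (rule bq_shift2[OF B True])
  moreover have "prob (?E k) = prob (?E (k + u))" "prob (?E k') = prob (?E (k' + u))"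
    by (rule bq_shift[OF B])+
  moreover have "\<bar>prob (?E (k + u) \<inter> ?E (k' + u)) - prob (?E (k + u)) * prob (?E (k' + u))\<bar> \<le> alpha_coef M Z (int m)"
  proof (rule alpha_coef_upper)
    show "?E (k + u) \<in> gen_sigma M Z {..0}" by (rule E) (auto simp: u_def)
    show "?E (k' + u) \<in> gen_sigma M Z {int m..}" using k by (intro E) (auto simp: u_def)
  qed
  ultimately show ?thesis by simp
next
  case False
  \<comment> \<open>Only empty blocks with gap 0 remain; their events are measurable over every time
    window.\<close>
  then have "l = 0" "m = 0" using k by auto
  let ?E = "\<lambda>k. {\<omega> \<in> space M. bq g p l k \<omega> \<in> B}"
  have E: "?E k \<in> gen_sigma M Z I" for k I
    using measurable_sets[OF bq_measurable_gen[of k l I] B] \<open>l = 0\<close>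
    by (simp add: sets_gen_measure vimage_def Int_def conj_commute)
  show ?thesis by (rule alpha_coef_upper) (rule E)+
qed

end

text \<open>The sample quantile is at most \<open>y n\<close>, which is
  \<open>g x + t / sqrt n\<close>, exactly when at least \<open>n * p\<close> of the
  \<open>Z\<close> values are at or below the preimage of \<open>y n\<close>. Near \<open>x\<close>
  the inverse of \<open>g\<close> has slope \<open>1 / g'\<close> and \<open>FZ\<close> has slope
  \<open>fZ x\<close>, whence the value of \<kappa>.\<close>

theorem quantile_clt:
  assumes pos: "fZ x > 0" and p: "p = FZ x" "0 < p"
    and g_mono: "strict_mono g" and g_cont: "\<And>t. isCont g t" and g_deriv: "(g has_real_derivative g') (at x)" "g' > 0"
  shows "\<exists>\<kappa>>0. \<forall>t. (\<lambda>n. prob {\<omega> \<in> space M. sqrt (real n) * (bq g p n 1 \<omega> - g x) \<le> t})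
     \<longlonglongrightarrow> cdf std_normal_distribution (\<kappa> * t)"
proof -
  obtain \<sigma> where \<sigma>: "\<sigma> > 0" and clt: "\<And>xs u. xs \<longlonglongrightarrow> x \<Longrightarrow> (\<lambda>n. sqrt n * (FZ (xs n) - FZ x)) \<longlonglongrightarrow> u \<Longrightarrow>
    (\<lambda>n. prob {\<omega> \<in> space M. real n * FZ x \<le> real (card {m. m < n \<and> Z (int (Suc m)) \<omega> \<le> xs n})})
      \<longlonglongrightarrow> cdf std_normal_distribution (u / \<sigma>)"
    using empirical_clt[OF pos] by blast
  have p1: "p \<le> 1" unfolding p(1) FZ_eq_prob[of _ 0] by simp
  \<comment> \<open>Caratheodory's form of the derivative avoids dividing by
    \<open>xs n - x\<close>, which is 0 when \<open>t = 0\<close>.\<close>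
  obtain q where q: "\<And>z. g z - g x = q z * (z - x)" "isCont q x" "q x = g'"
    using g_deriv(1) unfolding CARAT_DERIV by blast
  obtain r where r: "\<And>z. FZ z - FZ x = r z * (z - x)" "isCont r x" "r x = fZ x"
    using FZ_deriv[of x] unfolding CARAT_DERIV by blast
  define \<kappa> where "\<kappa> = fZ x / (g' * \<sigma>)"
  have "\<kappa> > 0" using pos g_deriv \<sigma> by (simp add: \<kappa>_def)
  moreover have "(\<lambda>n. prob {\<omega> \<in> space M. sqrt (real n) * (bq g p n 1 \<omega> - g x) \<le> t})
     \<longlonglongrightarrow> cdf std_normal_distribution (\<kappa> * t)" for t
  proof -
    define y where "y n = g x + t / sqrt (real n)" for n :: nat
    have y: "y \<longlonglongrightarrow> g x"
    proof -
      have "(\<lambda>n. g x + t * inverse (sqrt (real n))) \<longlonglongrightarrow> g x + t * 0"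
        by (intro tendsto_intros tendsto_inverse_0_at_top filterlim_compose[OF sqrt_at_top filterlim_real_sequentially])
      then show ?thesis by (simp add: y_def[abs_def] divide_inverse)
    qed
    \<comment> \<open>For large \<open>n\<close> a preimage exists by the intermediate value
      theorem; \<open>x\<close> is a default for the remaining \<open>n\<close>.\<close>
    define xs where "xs n = (if \<exists>z. g z = y n then SOME z. g z = y n else x)" for n
    have bracket: "\<forall>\<^sub>F n in sequentially. g (xs n) = y n \<and> \<bar>xs n - x\<bar> < e" if e: "e > 0" for e
    proof -
      have "\<forall>\<^sub>F n in sequentially. g (x - e) < y n" "\<forall>\<^sub>F n in sequentially. y n < g (x + e)"
        using y e strict_monoD[OF g_mono] by (auto intro!: order_tendstoD)
      then show ?thesis
      proof eventually_elim
        case (elim n)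
        have "\<exists>z\<ge>x - e. z \<le> x + e \<and> g z = y n"
          using elim e g_cont by (intro IVT) auto
        then have ex: "\<exists>z. g z = y n" by blast
        then have gx: "g (xs n) = y n" unfolding xs_def using someI_ex[OF ex] by simp
        then have "x - e < xs n" "xs n < x + e" using elim strict_mono_less[OF g_mono] by metis+
        then show ?case using gx unfolding abs_less_iff by simp
      qed
    qed
    have xs: "xs \<longlonglongrightarrow> x"
    proof (rule tendstoI)
      fix e :: real assume "e > 0"
      from bracket[OF this] show "\<forall>\<^sub>F n in sequentially. dist (xs n) x < e"
        by eventually_elim (simp add: dist_real_def)
    qed
    have gxs: "\<forall>\<^sub>F n in sequentially. g (xs n) = y n"
      using bracket[of 1] by (auto elim: eventually_mono)
    have qx: "(\<lambda>n. q (xs n)) \<longlonglongrightarrow> g'" using isCont_tendsto_compose[OF q(2) xs] q(3) by simp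
    have rx: "(\<lambda>n. r (xs n)) \<longlonglongrightarrow> fZ x" using isCont_tendsto_compose[OF r(2) xs] r(3) by simp
    have u: "(\<lambda>n. sqrt n * (FZ (xs n) - FZ x)) \<longlonglongrightarrow> fZ x * (t / g')"
    proof (rule Lim_transform_eventually)
      show "(\<lambda>n. r (xs n) * (t / q (xs n))) \<longlonglongrightarrow> fZ x * (t / g')"
        using g_deriv by (intro tendsto_intros rx qx) auto
      have "\<forall>\<^sub>F n in sequentially. q (xs n) > 0" using qx g_deriv(2) by (rule order_tendstoD)
      then show "\<forall>\<^sub>F n in sequentially. r (xs n) * (t / q (xs n)) = sqrt n * (FZ (xs n) - FZ x)"
        using gxs eventually_gt_at_top[of 0]
      proof eventually_elim
        case (elim n)
        have "q (xs n) * (xs n - x) = t / sqrt n" using q(1)[of "xs n"] elim by (simp add: y_def)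
        then have "t = sqrt n * (q (xs n) * (xs n - x))" using elim by simp
        then have "t / q (xs n) = sqrt n * (xs n - x)" using elim by simp
        then show ?case unfolding r(1) by simp
      qed
    qed
    have "(\<lambda>n. prob {\<omega> \<in> space M. real n * FZ x \<le> real (card {m. m < n \<and> Z (int (Suc m)) \<omega> \<le> xs n})})
      \<longlonglongrightarrow> cdf std_normal_distribution (\<kappa> * t)"
      using clt[OF xs u] by (simp add: \<kappa>_def mult.commute)
    then show ?thesis
    proof (rule Lim_transform_eventually)
      show "\<forall>\<^sub>F n in sequentially. prob {\<omega> \<in> space M. real n * FZ x \<le> real (card {m. m < n \<and> Z (int (Suc m)) \<omega> \<le> xs n})}
        = prob {\<omega> \<in> space M. sqrt (real n) * (bq g p n 1 \<omega> - g x) \<le> t}"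
        using gxs eventually_gt_at_top[of 0]
      proof eventually_elim
        case (elim n)
        have "sqrt (real n) * (bq g p n 1 \<omega> - g x) \<le> t \<longleftrightarrow> real n * FZ x \<le> real (card {m. m < n \<and> Z (int (Suc m)) \<omega> \<le> xs n})" for \<omega>
        proof -
          let ?l = "map (\<lambda>j. g (Z (1 + int j) \<omega>)) [0..<n]"
          have "sqrt (real n) * (bq g p n 1 \<omega> - g x) \<le> t \<longleftrightarrow> bq g p n 1 \<omega> \<le> y n"
            using elim(2) by (simp add: y_def field_simps)
          also have "\<dots> \<longleftrightarrow> p * real n \<le> real (length (filter (\<lambda>v. v \<le> y n) ?l))"
            unfolding bq_def using elim(2) p p1 by (subst emp_quantile_le_iff) auto
          also have "length (filter (\<lambda>v. v \<le> y n) ?l) = length (filter (\<lambda>j. g (Z (1 + int j) \<omega>) \<le> g (xs n)) [0..<n])"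
            using elim(1) by (simp add: filter_map comp_def)
          also have "\<dots> = card {m. m < n \<and> Z (int (Suc m)) \<omega> \<le> xs n}"
            by (subst distinct_length_filter)
               (auto intro!: arg_cong[where f=card] simp: strict_mono_less_eq[OF g_mono])
          finally show ?thesis by (simp add: p(1) mult.commute)
        qed
        then show ?case by simp
      qed
    qed
  qed
  ultimately show ?thesis by blast
qed

end


section \<open>Verification of the subsampling conditions\<close>

context linear_process begin

theorem quantile_subsampling:
  assumes pos: "fZ x > 0" and p: "p = FZ x" "0 < p"
    and g_mono: "strict_mono g" and g_cont: "\<And>t. isCont g t" and g_deriv: "(g has_real_derivative g') (at x)" "g' > 0"
    and mix: "alpha_mixing M Z"
    and b: "filterlim b at_top sequentially" "(\<lambda>n. real (b n) / real n) \<longlonglongrightarrow> 0"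
  shows "\<exists>J. subsampling M (\<lambda>n. bq g p n 1) (\<lambda>n i. bq g p (b n) (int i)) (g x) J b"
proof -
  let ?\<Phi> = "cdf std_normal_distribution"
  interpret std: real_distribution std_normal_distribution by (rule real_dist_normal_dist)
  have gm [measurable]: "g \<in> borel_measurable borel"
    using g_cont by (intro borel_measurable_continuous_onI continuous_at_imp_continuous_on) auto
  have p1: "p \<le> 1" unfolding p(1) FZ_eq_prob[of _ 0] by simp
  note bqm [measurable] = bq_measurable[OF gm p(2) p1]
  obtain \<kappa> where \<kappa>: "\<kappa> > 0" and lim: "\<And>t. (\<lambda>n. prob {\<omega> \<in> space M. sqrt (real n) * (bq g p n 1 \<omega> - g x) \<le> t}) \<longlonglongrightarrow> ?\<Phi> (\<kappa> * t)"
    using quantile_clt[OF pos p g_mono g_cont g_deriv] by blast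
  \<comment> \<open>Distribution function, on the positive half line, of the absolute value of a
    centred normal variable with standard deviation 1 / \<kappa>.\<close>
  define J where "J t = ?\<Phi> (\<kappa> * t) - ?\<Phi> (- (\<kappa> * t))" for t
  have cont: "isCont (\<lambda>t. ?\<Phi> (\<kappa> * t)) t" "isCont (\<lambda>t. ?\<Phi> (- (\<kappa> * t))) t" for t
    by (rule isCont_o2[OF _ isCont_std_normal_cdf], intro continuous_intros)+
  have J_cont: "isCont J t" for t unfolding J_def[abs_def] by (intro continuous_diff cont)
  have set: "{v. sqrt (real l) * \<bar>v - g x\<bar> \<le> t} \<in> sets borel" for l t by measurable
  have "subsampling M (\<lambda>n. bq g p n 1) (\<lambda>n i. bq g p (b n) (int i)) (g x) J b"
  proof unfold_locales
    show "(\<lambda>n. prob {\<omega> \<in> space M. sqrt (real n) * \<bar>bq g p n 1 \<omega> - g x\<bar> \<le> t}) \<longlonglongrightarrow> J t" if t: "t > 0" for t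
    proof -
      let ?X = "\<lambda>n \<omega>. sqrt (real n) * (bq g p n 1 \<omega> - g x)"
      have "(\<lambda>n. prob {\<omega> \<in> space M. ?X n \<omega> < - t}) \<longlonglongrightarrow> ?\<Phi> (\<kappa> * - t)"
        by (rule strict_cdf_tendsto[OF _ lim cont(1)]) measurable
      then have "(\<lambda>n. prob {\<omega> \<in> space M. ?X n \<omega> \<le> t} - prob {\<omega> \<in> space M. ?X n \<omega> < - t}) \<longlonglongrightarrow> J t"
        unfolding J_def by (intro tendsto_diff lim) simp
      moreover have "prob {\<omega> \<in> space M. ?X n \<omega> \<le> t} - prob {\<omega> \<in> space M. ?X n \<omega> < - t}
        = prob {\<omega> \<in> space M. sqrt (real n) * \<bar>bq g p n 1 \<omega> - g x\<bar> \<le> t}" for n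
      proof -
        have abs: "sqrt (real n) * \<bar>v\<bar> = \<bar>sqrt (real n) * v\<bar>" for v by (simp add: abs_mult)
        have "prob ({\<omega> \<in> space M. ?X n \<omega> \<le> t} - {\<omega> \<in> space M. ?X n \<omega> < - t})
          = prob {\<omega> \<in> space M. ?X n \<omega> \<le> t} - prob {\<omega> \<in> space M. ?X n \<omega> < - t}"
          using t by (intro finite_measure_Diff) (measurable, auto)
        moreover have "{\<omega> \<in> space M. ?X n \<omega> \<le> t} - {\<omega> \<in> space M. ?X n \<omega> < - t} = {\<omega> \<in> space M. \<bar>?X n \<omega>\<bar> \<le> t}"
          by (auto simp: abs_le_iff)
        ultimately show ?thesis unfolding abs by simp
      qed
      ultimately show ?thesis by simp
    qed
    show "\<forall>\<^sub>F n in sequentially. \<forall>i t. prob (root_event M (b n) (bq g p (b n) (int i)) (g x) t)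
        = prob (root_event M (b n) (bq g p (b n) 1) (g x) t)"
      using bq_shift[OF gm p(2) p1 set] by (simp add: root_event_def)
    show "\<exists>m. \<forall>\<^sub>F n in sequentially. \<forall>i j t. i + b n + m \<le> j \<longrightarrow>
        \<bar>prob ((root_event M (b n) (bq g p (b n) (int i)) (g x) t) \<inter> (root_event M (b n) (bq g p (b n) (int j)) (g x) t))
         - prob (root_event M (b n) (bq g p (b n) (int i)) (g x) t) * prob (root_event M (b n) (bq g p (b n) (int j)) (g x) t)\<bar> \<le> e"
      if e: "e > 0" for e
    proof -
      have "\<forall>\<^sub>F m in sequentially. alpha_coef M Z (int m) < e"
        using mix unfolding alpha_mixing_def by (rule order_tendstoD) (use e in simp)
      then obtain m where m: "alpha_coef M Z (int m) < e"
        using eventually_happens'[OF sequentially_bot] by blast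
      show ?thesis
      proof (intro exI[of _ m] always_eventually allI impI)
        fix n i j t assume "i + b n + m \<le> j"
        \<comment> \<open>One step of slack: a block of length \<open>b n\<close> starting at
          \<open>i\<close> already ends at \<open>i + b n - 1\<close>.\<close>
        then have "int i + int (b n) + int m \<le> int j + 1" by linarith
        from bq_mixing[OF gm p(2) p1 set[of "b n" t] this] m
        show "\<bar>prob ((root_event M (b n) (bq g p (b n) (int i)) (g x) t) \<inter> (root_event M (b n) (bq g p (b n) (int j)) (g x) t))
         - prob (root_event M (b n) (bq g p (b n) (int i)) (g x) t) * prob (root_event M (b n) (bq g p (b n) (int j)) (g x) t)\<bar> \<le> e"
          by (simp add: root_event_def)
      qed
    qed
    show "isCont J t" if "t > 0" for t by (rule J_cont)
    show "J s < J t" if "0 \<le> s" "s < t" for s t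
    proof -
      have "\<kappa> * s < \<kappa> * t" using that \<kappa> by simp
      then have "?\<Phi> (\<kappa> * s) < ?\<Phi> (\<kappa> * t)" "?\<Phi> (- (\<kappa> * t)) < ?\<Phi> (- (\<kappa> * s))"
        by (simp_all add: std_normal_cdf_strict_mono del: mult_less_cancel_left_pos)
      then show ?thesis unfolding J_def by linarith
    qed
    show "(J \<longlongrightarrow> 0) (at_right 0)"
    proof -
      have "(J \<longlongrightarrow> J 0) (at 0)" using J_cont by (simp add: isCont_def)
      then have "(J \<longlongrightarrow> J 0) (at_right 0)" by (rule tendsto_within_subset) simp
      moreover have "J 0 = 0" by (simp add: J_def)
      ultimately show ?thesis by (simp only:)
    qed
    show "(J \<longlongrightarrow> 1) at_top"
    proof -
      have k: "filterlim (\<lambda>t. \<kappa> * t) at_top at_top"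
        by (rule filterlim_tendsto_pos_mult_at_top[OF tendsto_const \<kappa> filterlim_ident])
      have "(J \<longlongrightarrow> 1 - 0) at_top"
        unfolding J_def[abs_def]
      proof (intro tendsto_diff)
        show "((\<lambda>t. ?\<Phi> (\<kappa> * t)) \<longlongrightarrow> 1) at_top" by (rule filterlim_compose[OF std.cdf_lim_at_top_prob k])
        show "((\<lambda>t. ?\<Phi> (- (\<kappa> * t))) \<longlongrightarrow> 0) at_top"
          by (rule filterlim_compose[OF std.cdf_lim_at_bot filterlim_compose[OF filterlim_uminus_at_bot_at_top k]])
      qed
      then show ?thesis by simp
    qed
  qed (use b in auto)
  then show ?thesis by blast
qed

end

section \<open>From the stated hypotheses to the normalised process\<close>

lemma density_bounded:
  fixes f f1 f2 :: "real \<Rightarrow> real"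
  assumes X: "prob_space M" "distributed M lborel X (\<lambda>t. ennreal (f t))" and f: "\<And>t. 0 \<le> f t"
    and d1: "\<And>t. (f has_real_derivative f1 t) (at t)" and d2: "\<And>t. (f1 has_real_derivative f2 t) (at t)"
    and C: "\<And>t. \<bar>f2 t\<bar> \<le> C"
  shows "f t \<le> C + 1"
proof -
  interpret prob_space M by fact
  have C0: "0 \<le> C" using C[of 0] by linarith
  have lip: "\<bar>f1 u - f1 v\<bar> \<le> C * \<bar>u - v\<bar>" for u v
  proof -
    have *: "\<bar>f1 v - f1 u\<bar> \<le> C * \<bar>v - u\<bar>" if uv: "u < v" for u v
    proof -
      obtain z where "f1 v - f1 u = (v - u) * f2 z" using MVT2[OF uv, of f1 f2] d2 by blast
      then show ?thesis using C[of z] by (simp add: abs_mult mult.commute[of C] mult_left_mono)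
    qed
    show ?thesis using *[of u v] *[of v u] by (cases u v rule: linorder_cases) (auto simp: abs_minus_commute)
  qed
  have mass: "c \<le> 1" if c: "\<And>y. s < y \<Longrightarrow> y \<le> s + 1 \<Longrightarrow> c \<le> f y" for c s
  proof (cases "c \<ge> 0")
    case True
    have "ennreal c = (\<integral>\<^sup>+y. ennreal c * indicator {s<..s+1} y \<partial>lborel)"
      by (simp add: nn_integral_cmult_indicator)
    also have "\<dots> \<le> (\<integral>\<^sup>+y. ennreal (f y) * indicator {s<..s+1} y \<partial>lborel)"
      using c by (intro nn_integral_mono) (auto split: split_indicator intro: ennreal_leI)
    also have "\<dots> = emeasure M (X -` {s<..s+1} \<inter> space M)"
      by (rule distributed_emeasure[OF X(2), symmetric]) auto
    also have "\<dots> \<le> 1" by (rule emeasure_le_1)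
    finally show ?thesis using True by simp
  qed simp
  \<comment> \<open>On the side of \<open>t\<close> where \<open>f\<close> does not decrease to
    first order, the derivative worsens by at most \<open>C\<close> within distance 1, so
    \<open>f\<close> stays above \<open>f t - C\<close> on a unit interval; total mass 1 then bounds
    \<open>f t\<close>.\<close>
  show ?thesis
  proof (cases "f1 t \<ge> 0")
    case True
    have "f t - C \<le> 1"
    proof (rule mass[of t])
      fix y assume y: "t < y" "y \<le> t + 1"
      obtain z where z: "t < z" "z < y" "f y - f t = (y - t) * f1 z" using MVT2[OF y(1), of f f1] d1 by blast
      have "f1 z \<ge> - C"
      proof -
        have "\<bar>f1 z - f1 t\<bar> \<le> C * 1" using z y C0 by (intro order_trans[OF lip] mult_left_mono) auto
        then show ?thesis using True by linarith
      qed
      then have "(y - t) * f1 z \<ge> (y - t) * - C" using y by (intro mult_left_mono) auto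
      moreover have "(y - t) * C \<le> 1 * C" using y C0 by (intro mult_right_mono) auto
      ultimately show "f t - C \<le> f y" using z by simp
    qed
    then show ?thesis by simp
  next
    case False
    have "f t - C \<le> 1"
    proof (rule mass[of "t - 1"])
      fix y assume y: "t - 1 < y" "y \<le> t - 1 + 1"
      show "f t - C \<le> f y"
      proof (cases "y = t")
        case False
        then have yt: "y < t" using y by simp
        obtain z where z: "y < z" "z < t" "f t - f y = (t - y) * f1 z" using MVT2[OF yt, of f f1] d1 by blast
        have "f1 z \<le> C"
        proof -
          have "\<bar>f1 z - f1 t\<bar> \<le> C * 1" using z y C0 by (intro order_trans[OF lip] mult_left_mono) auto
          then show ?thesis using \<open>\<not> f1 t \<ge> 0\<close> by linarith
        qed
        then have "(t - y) * f1 z \<le> (t - y) * C" using yt by (intro mult_left_mono) auto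
        moreover have "(t - y) * C \<le> 1 * C" using y C0 by (intro mult_right_mono) auto
        ultimately show ?thesis using z(3) by linarith
      qed (use C0 in simp)
    qed
    then show ?thesis by simp
  qed
qed

lemma map_upt_shift: "map (\<lambda>k. f (int k)) [i..<i + l] = map (\<lambda>j. f (int i + int j)) [0..<l]"
  by (rule nth_equalityI) auto


text \<open>Shifting the time index and rescaling the innovations makes the first coefficient 1.\<close>
lemma linear_process_normalise:
  fixes M :: "'a measure"
  assumes M: "prob_space M"
    and eps_indep: "prob_space.indep_vars M (\<lambda>_. borel) eps UNIV"
    and eps_ident: "\<And>i. distr M borel (eps i) = distr M borel (eps 0)"
    and eps_dens: "distributed M lborel (eps 0) (\<lambda>t. ennreal (fe t))"
    and fe: "\<And>t. 0 \<le> fe t" "\<And>t. fe t \<le> B" "continuous_on UNIV fe"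
    and rho: "0 < \<rho>" "\<rho> \<le> 1" and moment: "integrable M (\<lambda>\<omega>. \<bar>eps 0 \<omega>\<bar> powr (2 * \<rho>))"
    and a_summ: "summable (\<lambda>i. \<bar>a i\<bar> powr \<rho>)" and a_nz: "a i \<noteq> (0::real)"
    and Z_rv: "\<And>k. Z k \<in> borel_measurable M"
    and Z_lin: "\<And>k. AE \<omega> in M. (\<lambda>i. a i * eps (k - int i) \<omega>) sums Z k \<omega>"
  shows "\<exists>eps' mu f0 K a'. linear_process M eps' mu f0 K \<rho> a' Z"
proof -
  interpret prob_space M by (rule M)
  interpret I: iid_seq M eps "distr M borel (eps 0)"
    by unfold_locales (fact eps_indep, fact eps_ident)
  define i0 where "i0 = (LEAST i. a i \<noteq> 0)"
  define A where "A = a i0"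
  have A: "A \<noteq> 0" unfolding A_def i0_def using a_nz by (rule LeastI)
  have below: "a i = 0" if "i < i0" for i using not_less_Least[of i "\<lambda>i. a i \<noteq> 0"] that by (auto simp: i0_def)
  define eps' where "eps' k \<omega> = A * eps (k - int i0) \<omega>" for k \<omega>
  define a' where "a' i = a (i + i0) / A" for i
  define f0 where "f0 s = fe (s / A) / \<bar>A\<bar>" for s
  define mu where "mu = distr M borel (eps' 0)"
  have "indep_vars (\<lambda>_. borel) (\<lambda>k::int. eps (k - int i0)) UNIV"
    by (rule I.indep_eps_reindex) (auto simp: inj_def)
  then have indep: "indep_vars (\<lambda>_. borel) eps' UNIV"
    unfolding eps'_def[abs_def] by (rule indep_vars_compose2) auto
  have scale: "distr M borel (\<lambda>\<omega>. A * eps k \<omega>) = distr (distr M borel (eps 0)) borel (\<lambda>u. A * u)" for k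
    unfolding eps_ident[of k, symmetric] by (subst distr_distr) (auto simp: comp_def)
  have ident: "distr M borel (eps' k) = mu" for k
    unfolding mu_def eps'_def[abs_def] scale ..
  have mu: "mu = distr M borel (\<lambda>\<omega>. A * eps 0 \<omega>)" unfolding mu_def eps'_def[abs_def] scale ..
  have dens: "mu = density lborel (\<lambda>t. ennreal (f0 t))"
  proof -
    have "distributed M lborel (\<lambda>\<omega>. 0 + A * eps 0 \<omega>) (\<lambda>s. ennreal (fe ((s - 0) / A)) / ennreal \<bar>A\<bar>)"
      by (rule distributed_affine[OF eps_dens A])
    then have "distr M lborel (\<lambda>\<omega>. A * eps 0 \<omega>) = density lborel (\<lambda>s. ennreal (fe (s / A)) / ennreal \<bar>A\<bar>)"
      by (simp add: distributed_def)
    also have "(\<lambda>s. ennreal (fe (s / A)) / ennreal \<bar>A\<bar>) = (\<lambda>s. ennreal (f0 s))"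
      unfolding f0_def using fe(1) A by (simp add: divide_ennreal)
    also have "distr M lborel (\<lambda>\<omega>. A * eps 0 \<omega>) = mu" unfolding mu by (rule distr_cong) auto
    finally show ?thesis .
  qed
  have "linear_process M eps' mu f0 (B / \<bar>A\<bar>) \<rho> a' Z"
  proof unfold_locales
    show "indep_vars (\<lambda>_. borel) eps' UNIV" by (rule indep)
    show "distr M borel (eps' i) = mu" for i by (rule ident)
    show "mu = density lborel (\<lambda>t. ennreal (f0 t))" by (rule dens)
    show "continuous_on UNIV f0"
      unfolding f0_def[abs_def] using A
      by (intro continuous_on_divide continuous_on_const continuous_on_compose2[OF fe(3)]) (auto intro!: continuous_intros)
    show "0 \<le> f0 t" for t using fe(1) by (simp add: f0_def)
    show "f0 t \<le> B / \<bar>A\<bar>" for t using fe(2) by (simp add: f0_def divide_right_mono)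
    show "0 < \<rho>" "\<rho> \<le> 1" by fact+
    show "integrable mu (\<lambda>e. \<bar>e\<bar> powr (2 * \<rho>))"
      unfolding mu by (subst integrable_distr_eq) (use moment in \<open>auto simp: abs_mult powr_mult\<close>)
    show "a' 0 = 1" using A by (simp add: a'_def A_def)
    show "summable (\<lambda>i. \<bar>a' i\<bar> powr \<rho>)"
    proof -
      have "summable (\<lambda>i. \<bar>a (i + i0)\<bar> powr \<rho> / \<bar>A\<bar> powr \<rho>)"
        by (intro summable_divide summable_ignore_initial_segment[OF a_summ])
      then show ?thesis by (simp add: a'_def abs_divide powr_divide)
    qed
    show "Z k \<in> borel_measurable M" for k by (rule Z_rv)
    show "AE \<omega> in M. (\<lambda>i. a' i * eps' (k - int i) \<omega>) sums Z k \<omega>" for k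
      using Z_lin[of k]
    proof eventually_elim
      case (elim \<omega>)
      have "(\<lambda>i. a (i + i0) * eps (k - int (i + i0)) \<omega>) sums (Z k \<omega> - (\<Sum>i<i0. a i * eps (k - int i) \<omega>))"
        using elim by (rule sums_split_initial_segment)
      moreover have "(\<Sum>i<i0. a i * eps (k - int i) \<omega>) = 0" by (intro sum.neutral) (auto simp: below)
      moreover have "a (i + i0) * eps (k - int (i + i0)) \<omega> = a' i * eps' (k - int i) \<omega>" for i
        using A by (simp add: a'_def eps'_def algebra_simps)
      ultimately show ?case by simp
    qed
  qed
  then show ?thesis by blast
qed

text \<open>A density is determined only almost everywhere, but its lower bound on
  \<open>{c..d}\<close> forces \<open>FZ\<close> to grow by at least \<delta> per unit length there.
  The derivative at \<open>x\<close> inherits this, and the mass between \<open>c\<close> and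
  \<open>x\<close> makes the quantile level positive.\<close>

lemma (in linear_process) fZ_pos:
  assumes dens: "distributed M lborel (Z 0) (\<lambda>t. ennreal (h t))" and low: "c < x" "x < d" "\<delta> > 0" "\<And>y. y \<in> {c..d} \<Longrightarrow> \<delta> \<le> h y"
  shows "fZ x > 0" "FZ x > 0"
proof -
  have incr: "\<delta> * (v - u) \<le> FZ v - FZ u" if uv: "c \<le> u" "u \<le> v" "v \<le> d" for u v
  proof -
    have "ennreal (\<delta> * (v - u)) = (\<integral>\<^sup>+y. ennreal \<delta> * indicator {u<..v} y \<partial>lborel)"
      using uv low by (simp add: nn_integral_cmult_indicator ennreal_mult')
    also have "\<dots> \<le> (\<integral>\<^sup>+y. ennreal (h y) * indicator {u<..v} y \<partial>lborel)"
      using uv low(4) by (intro nn_integral_mono) (auto split: split_indicator intro!: ennreal_leI)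
    also have "\<dots> = emeasure M (Z 0 -` {u<..v} \<inter> space M)"
      by (rule distributed_emeasure[OF dens, symmetric]) auto
    finally have "\<delta> * (v - u) \<le> prob (Z 0 -` {u<..v} \<inter> space M)"
      by (simp add: emeasure_eq_measure)
    also have "Z 0 -` {u<..v} \<inter> space M = {\<omega> \<in> space M. Z 0 \<omega> \<le> v} - {\<omega> \<in> space M. Z 0 \<omega> \<le> u}"
      by auto
    also have "prob \<dots> = FZ v - FZ u"
      unfolding FZ_eq_prob[of _ 0] using uv by (intro finite_measure_Diff) auto
    finally show ?thesis .
  qed
  have "\<delta> \<le> fZ x"
  proof (rule tendsto_lowerbound)
    have "((\<lambda>u. (FZ (x + u) - FZ x) / u) \<longlongrightarrow> fZ x) (at 0)" using FZ_deriv unfolding DERIV_def .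
    then show "((\<lambda>u. (FZ (x + u) - FZ x) / u) \<longlongrightarrow> fZ x) (at_right 0)" by (rule tendsto_within_subset) simp
    have "\<forall>\<^sub>F u in at_right 0. u \<in> {0<..<d - x}" using low by (intro eventually_at_right_real) simp
    then show "\<forall>\<^sub>F u in at_right 0. \<delta> \<le> (FZ (x + u) - FZ x) / u"
    proof eventually_elim
      case (elim u)
      then show ?case using incr[of x "x + u"] low by (simp add: pos_le_divide_eq)
    qed
  qed simp
  then show "fZ x > 0" using low by linarith
  have "0 < \<delta> * (x - c)" using low by simp
  moreover have "0 \<le> FZ c" unfolding FZ_eq_prob[of _ 0] by simp
  ultimately show "FZ x > 0" using incr[of c x] low by linarith
qed

theorem theorem6:
  fixes M :: "'a measure"
    and eps :: "int \<Rightarrow> 'a \<Rightarrow> real"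
    and fe fZ :: "real \<Rightarrow> real"
    and a :: "nat \<Rightarrow> real"
    and Z :: "int \<Rightarrow> 'a \<Rightarrow> real"
    and g :: "real \<Rightarrow> real"
    and r q x :: real
    and b :: "nat \<Rightarrow> nat"
  defines "F_Z \<equiv> cdf (distr M borel (Z 0))"
  defines "ghat \<equiv> (\<lambda>n \<omega>. emp_quantile (map (\<lambda>k. g (Z (int k) \<omega>)) [1..<n+1]) (F_Z x))"
  defines "ghat_b \<equiv> (\<lambda>n i \<omega>. emp_quantile (map (\<lambda>k. g (Z (int k) \<omega>)) [i..<i + b n]) (F_Z x))"
  defines "S \<equiv> (\<lambda>n \<eta> \<omega>. (1 / real (n - b n + 1)) *
              (\<Sum>i=1..n - b n + 1. if sqrt (real (b n)) * \<bar>ghat_b n i \<omega> - ghat n \<omega>\<bar> \<le> \<eta> then 1 else 0))"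
  assumes M: "prob_space M"
    and eps_indep: "prob_space.indep_vars M (\<lambda>_. borel) eps UNIV"
    and eps_ident: "\<And>i. distr M borel (eps i) = distr M borel (eps 0)"
    and eps_dens: "distributed M lborel (eps 0) (\<lambda>t. ennreal (fe t))"
    and fe_nonneg: "\<And>t. fe t \<ge> 0"
    and fe_C2: "\<exists>f1 f2. (\<forall>t. (fe has_real_derivative f1 t) (at t)) \<and>
                        (\<forall>t. (f1 has_real_derivative f2 t) (at t)) \<and>
                        (\<exists>C. \<forall>t. \<bar>f2 t\<bar> \<le> C)"
    and r_pos: "r > 0"
    and eps_moment: "integrable M (\<lambda>\<omega>. \<bar>eps 0 \<omega>\<bar> powr r)"
    and q_ge: "q \<ge> 2"
    and a_summ: "summable (\<lambda>i. \<bar>a (Suc i)\<bar> powr (min (r / q) 1))"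
    and Z_rv: "\<And>k. Z k \<in> borel_measurable M"
    and Z_lin: "\<And>k. AE \<omega> in M. (\<lambda>i. a i * eps (k - int i) \<omega>) sums Z k \<omega>"
    and Z_mix: "alpha_mixing M Z"
    and Z_dens: "distributed M lborel (Z 0) (\<lambda>t. ennreal (fZ t))"
    and fZ_nonneg: "\<And>t. fZ t \<ge> 0"
    and g_mono: "strict_mono g"
    and g_diff: "\<And>t. g differentiable (at t)"
    and x_dens: "\<exists>c d \<delta>. c < x \<and> x < d \<and> \<delta> > 0 \<and> (\<forall>y\<in>{c..d}. fZ y \<ge> \<delta>)"
    and g'_pos: "deriv g x > 0"
    and b_inf: "filterlim b at_top sequentially"
    and b_rate: "(\<lambda>n. real (b n) / real n) \<longlonglongrightarrow> 0"
  shows "(\<forall>\<eta>>0. conv_prob_zero M (\<lambda>n \<omega>. S n \<eta> \<omega> -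
             measure M {\<omega>' \<in> space M. sqrt (real n) * \<bar>ghat n \<omega>' - g x\<bar> \<le> \<eta>}))
       \<and> (\<forall>\<alpha>. 0 < \<alpha> \<and> \<alpha> < 1 \<longrightarrow>
            (\<lambda>n. measure M {\<omega> \<in> space M. sqrt (real n) * \<bar>ghat n \<omega> - g x\<bar>
                   \<le> Inf {\<eta>. S n \<eta> \<omega> \<ge> 1 - \<alpha>}}) \<longlonglongrightarrow> 1 - \<alpha>)"
proof -
  interpret prob_space M by (rule M)
  define \<rho> where "\<rho> = min (r / q) 1"
  have rho: "0 < \<rho>" "\<rho> \<le> 1" using r_pos q_ge by (auto simp: \<rho>_def)
  have rho_r: "2 * \<rho> \<le> r"
  proof -
    have "2 * \<rho> \<le> 2 * (r / q)" by (simp add: \<rho>_def)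
    also have "\<dots> \<le> r" using r_pos q_ge by (simp add: field_simps)
    finally show ?thesis .
  qed
  obtain f1 f2 C where fd: "\<And>t. (fe has_real_derivative f1 t) (at t)" "\<And>t. (f1 has_real_derivative f2 t) (at t)" "\<And>t. \<bar>f2 t\<bar> \<le> C"
    using fe_C2 by blast
  have fe_le: "fe t \<le> C + 1" for t by (rule density_bounded[OF M eps_dens fe_nonneg fd])
  have fe_cont: "continuous_on UNIV fe"
    using DERIV_isCont[OF fd(1)] by (intro continuous_at_imp_continuous_on) auto
  have [measurable]: "eps 0 \<in> borel_measurable M" using eps_indep by (auto simp: indep_vars_def)
  have moment: "integrable M (\<lambda>\<omega>. \<bar>eps 0 \<omega>\<bar> powr (2 * \<rho>))"
  proof (rule Bochner_Integration.integrable_bound)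
    show "integrable M (\<lambda>\<omega>. 1 + \<bar>eps 0 \<omega>\<bar> powr r)" using eps_moment by simp
    show "AE \<omega> in M. norm (\<bar>eps 0 \<omega>\<bar> powr (2 * \<rho>)) \<le> norm (1 + \<bar>eps 0 \<omega>\<bar> powr r)"
    proof (rule AE_I2)
      fix \<omega>
      show "norm (\<bar>eps 0 \<omega>\<bar> powr (2 * \<rho>)) \<le> norm (1 + \<bar>eps 0 \<omega>\<bar> powr r)"
      proof (cases "\<bar>eps 0 \<omega>\<bar> \<le> 1")
        case True
        have "\<bar>eps 0 \<omega>\<bar> powr (2 * \<rho>) \<le> 1" using True rho by (intro powr_le1) auto
        then show ?thesis by (simp add: add_increasing2)
      next
        case False
        have "\<bar>eps 0 \<omega>\<bar> powr (2 * \<rho>) \<le> \<bar>eps 0 \<omega>\<bar> powr r" using False rho_r by (intro powr_mono) auto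
        then show ?thesis by simp
      qed
    qed
  qed measurable
  have summ: "summable (\<lambda>i. \<bar>a i\<bar> powr \<rho>)"
    using a_summ unfolding \<rho>_def[symmetric] by (subst (asm) summable_Suc_iff)
  \<comment> \<open>With all coefficients zero, \<open>Z 0\<close> would be almost surely constant,
    contradicting its density.\<close>
  have "\<exists>i. a i \<noteq> 0"
  proof (rule ccontr)
    assume "\<not> (\<exists>i. a i \<noteq> 0)"
    then have "AE \<omega> in M. Z 0 \<omega> = 0" using Z_lin[of 0] by (auto elim!: eventually_mono dest!: sums_unique)
    then have "prob (Z 0 -` {0} \<inter> space M) = 1"
      by (intro prob_eq_1[THEN iffD2]) (use measurable_sets[OF Z_rv, of "{0}" 0] in \<open>auto elim: eventually_mono\<close>)
    moreover have "emeasure M (Z 0 -` {0} \<inter> space M) = 0"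
    proof -
      have "emeasure M (Z 0 -` {0} \<inter> space M) = (\<integral>\<^sup>+y. ennreal (fZ y) * indicator {0} y \<partial>lborel)"
        by (rule distributed_emeasure[OF Z_dens]) auto
      also have "\<dots> = integral\<^sup>N (lborel :: real measure) (\<lambda>_. 0)"
        using AE_lborel_singleton[of 0] by (intro nn_integral_cong_AE) (auto elim!: eventually_mono)
      finally show ?thesis by simp
    qed
    ultimately show False by (simp add: measure_def)
  qed
  then obtain i where "a i \<noteq> 0" by blast
  then obtain eps' mu f0 K a' where lp: "linear_process M eps' mu f0 K \<rho> a' Z"
    using linear_process_normalise[OF M eps_indep eps_ident eps_dens fe_nonneg fe_le fe_cont rho moment summ _ Z_rv Z_lin]
    by blast
  interpret L: linear_process M eps' mu f0 K \<rho> a' Z by (rule lp)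
  obtain c d \<delta> where low: "c < x" "x < d" "\<delta> > 0" "\<And>y. y \<in> {c..d} \<Longrightarrow> \<delta> \<le> fZ y" using x_dens by blast
  note pos = L.fZ_pos[OF Z_dens low]
  have F: "F_Z x = L.FZ x"
    unfolding F_Z_def L.FZ_eq_prob[of x 0] cdf_def using Z_rv[of 0]
    by (subst measure_distr) (auto intro!: arg_cong[where f=prob])
  have "(g has_real_derivative deriv g x) (at x)"
    using g_diff[of x] by (meson DERIV_deriv_iff_real_differentiable)
  moreover have "isCont g t" for t using g_diff[of t] by (rule differentiable_imp_continuous_within)
  ultimately obtain J where J: "subsampling M (\<lambda>n. L.bq g (F_Z x) n 1) (\<lambda>n i. L.bq g (F_Z x) (b n) (int i)) (g x) J b"
    using L.quantile_subsampling[OF pos(1) F _ g_mono _ _ g'_pos Z_mix b_inf b_rate] pos(2) F by metis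
  interpret U: subsampling M "\<lambda>n. L.bq g (F_Z x) n 1" "\<lambda>n i. L.bq g (F_Z x) (b n) (int i)" "g x" J b by (rule J)
  \<comment> \<open>The whole sample is the block of length \<open>n\<close> that starts at time
    1.\<close>
  have gh: "ghat n \<omega> = L.bq g (F_Z x) n 1 \<omega>" for n \<omega>
    unfolding ghat_def L.bq_def using map_upt_shift[of "\<lambda>k. g (Z k \<omega>)" 1 n] by (simp add: add.commute)
  have gb: "ghat_b n i \<omega> = L.bq g (F_Z x) (b n) (int i) \<omega>" for n i \<omega>
    unfolding ghat_b_def L.bq_def by (simp only: map_upt_shift[of "\<lambda>k. g (Z k \<omega>)"])
  have SS: "S n \<eta> \<omega> = U.S n \<eta> \<omega>" for n \<eta> \<omega>
    unfolding S_def U.S_def U.N_def gh gb ..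
  show ?thesis
  proof (intro conjI allI impI)
    fix \<eta> :: real assume "\<eta> > 0"
    then show "conv_prob_zero M (\<lambda>n \<omega>. S n \<eta> \<omega> - measure M {\<omega>' \<in> space M. sqrt (real n) * \<bar>ghat n \<omega>' - g x\<bar> \<le> \<eta>})"
      unfolding SS gh by (rule U.subsampling_consistent)
  next
    fix \<alpha> :: real assume "0 < \<alpha> \<and> \<alpha> < 1"
    then show "(\<lambda>n. measure M {\<omega> \<in> space M. sqrt (real n) * \<bar>ghat n \<omega> - g x\<bar> \<le> Inf {\<eta>. S n \<eta> \<omega> \<ge> 1 - \<alpha>}}) \<longlonglongrightarrow> 1 - \<alpha>"
      unfolding SS gh U.crit_def[symmetric] by (intro U.subsampling_coverage) auto
  qed
qed

end
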